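(* Let $X\subseteq\mathbb{V}$ be an algebraic variety. For any $(\mathbf{u},\mathbf{v})\in\mathbb{V}^2$ the map $(\mathbf{z},\mathbf{w})\mapsto\left(\frac{\mathbf{z}+\mathbf{w}}{2},\frac{\mathbf{z}-\mathbf{w}}{2i}\right)$, with inverse $(\mathbf{x},\mathbf{y})\mapsto(\mathbf{x}+i\mathbf{y},\mathbf{x}-i\mathbf{y})$, from $\mathbb{V}^2$ to the complexification $\mathbb{V}_{\mathbb{R}}^2\otimes\mathbb{C}$, sends the points in the zero set of the Hermitian critical ideal of $X$ of $(\mathbf{u},\mathbf{v})$ to the points in the zero set of the (Euclidean) critical ideal of $\tilde{X}$ of $\left(\frac{\mathbf{u}+\mathbf{v}}{2},\frac{\mathbf{u}-\mathbf{v}}{2i}\right)$; in particular $\mathrm{vHDdeg}(X)=\mathrm{EDdegree}(\tilde{X})$. Moreover, if $\mathbf{v}=\bar{\mathbf{u}}$ this map sends critical points (of the Hermitian distance from $\mathbf{u}$ on $X$) into critical points (of the Euclidean distance on $\tilde X$); in particular $\mathrm{HDdeg}(X)=\mathbb{R}\mathrm{EDdegree}(\tilde{X})$.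
   Context: Setting. $\mathbb{V}\cong\mathbb{C}^n$ is a complex vector space with fixed basis and coordinatewise conjugation; $\mathbb{V}_{\mathbb{R}}$ is the real subspace fixed by conjugation. $q(\mathbf{z},\mathbf{w})=\sum_k z_k\bar w_k$ and $q_{\mathbf{u}}(\mathbf{z})=q(\mathbf{u}-\mathbf{z},\mathbf{u}-\mathbf{z})$. $X=V(I_X)\subseteq\mathbb{V}$ is an irreducible affine variety of codimension $c$, $I_X=\langle f_1,\dots,f_s\rangle\subseteq\mathbb{C}[\mathbf{z}]$ is prime, $J(f)$ is the $s\times n$ Jacobian, $X_{\mathrm{reg}}$ the regular locus, $\overline{X}$ the complex conjugate variety, and $I_{X_{\mathrm{sing}}}=I_X+\langle c\text{-minors of }J(f)\rangle$. Let $\ast:\mathbb{C}[\mathbf{z},\mathbf{w},\mathbf{u},\mathbf{v}]\to\mathbb{C}[\mathbf{z},\mathbf{w},\mathbf{u},\mathbf{v}]$ be the antilinear ring involution with $z_k\leftrightarrow w_k$, $u_k\leftrightarrow v_k$, $a^\ast=\bar a$ for $a\in\mathbb{C}$. With $I_X'=\left\langle (c+1)\text{-minors of }\begin{bmatrix}\mathbf{v}-\mathbf{w}\\ J_{\mathbf{z}}(f)\end{bmatrix}\right\rangle$, the Hermitian critical ideal of $X$ is $$\left(I_X+(I_X)^\ast+I_X'+(I_X')^\ast\right):\left(I_{X_{\mathrm{sing}}}\cdot(I_{X_{\mathrm{sing}}})^\ast\right)^\infty ;$$ for fixed $(\mathbf{u},\mathbf{v})\in\mathbb{V}^2$ the corresponding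 ideal in $\mathbb{C}[\mathbf{z},\mathbf{w}]$ is the Hermitian critical ideal of $(\mathbf{u},\mathbf{v})$. $\mathrm{vHDdeg}(X)$ is the number of zeros of the Hermitian critical ideal of $(\mathbf{u},\mathbf{v})$, constant for $(\mathbf{u},\mathbf{v})$ in a Zariski-open dense subset of $\mathbb{V}^2$. When $\mathbf{v}=\bar{\mathbf{u}}$, the critical points of $q_{\mathbf{u}}$ on $X_{\mathrm{reg}}$ are identified with the zeros of the form $(\mathbf{z},\bar{\mathbf{z}})$. $\mathrm{HDdeg}(X)\subseteq\mathbb{N}$ is the set of those numbers $m$ such that $q_{\mathbf{u}}$ has exactly $m$ critical points on $X_{\mathrm{reg}}$ for all $\mathbf{u}$ in some nonempty Euclidean-open subset of $\mathbb{V}$. Write $\mathbf{z}=\mathbf{x}+i\mathbf{y}$ and split $f_k=f_k^{\Re}+if_k^{\Im}$ with $f_k^{\Re},f_k^{\Im}\in\mathbb{R}[\mathbf{x},\mathbf{y}]$. Then $$\tilde X=\left\{\left(\tfrac{\mathbf{z}+\mathbf{w}}{2},\tfrac{\mathbf{z}-\mathbf{w}}{2i}\right)\in\mathbb{V}_{\mathbb{R}}^2\otimes\mathbb{C}\ \middle|\ \mathbf{z}\in X,\ \mathbf{w}\in\overline X\right\}=V(f_1^{\Re},f_1^{\Im},\dots,f_s^{\Re},f_s^{\Im}),$$ a variety defined by real polynomials in a $2n$-dimensional complex space. Euclidean notions. For a variety $Y$ of codimension $c'$ in a complex vector space $\mathbb{W}$ (with real structure $\mathbb{W}_{\mathbb{R}}$),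 defined by real polynomials $h$, the critical ideal of $Y$ of $\mathbf{a}\in\mathbb{W}$ is $\left(I_Y+\left\langle (c'+1)\text{-minors of }\begin{bmatrix}\mathbf{a}-\mathbf{y}\\ J(h)\end{bmatrix}\right\rangle\right):(I_{Y_{\mathrm{sing}}})^\infty$. $\mathrm{EDdegree}(Y)$ is the number of its zeros for $\mathbf{a}$ in a Zariski-open dense subset of $\mathbb{W}$. For $\mathbf{a}\in\mathbb{W}_{\mathbb{R}}$ the critical points of the Euclidean distance are its zeros in $\mathbb{W}_{\mathbb{R}}$, and $\mathbb{R}\mathrm{EDdegree}(Y)\subseteq\mathbb{N}$ is the set of numbers of critical points that are attained constantly for $\mathbf{a}$ in some nonempty Euclidean-open subset of $\mathbb{W}_{\mathbb{R}}$. *)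

theory Defs
  imports
    "HOL-Analysis.Analysis"
    "HOL-Library.Poly_Mapping"
    "Jordan_Normal_Form.Determinant"
begin

no_notation Matrix.vec_index (infixl \<open>$\<close> 100)


subsection \<open>Multivariate polynomials\<close>

text \<open>
  The monoid algebra of the monomials over \<open>'v\<close> is the polynomial ring in the
  variables \<open>'v\<close>; its ring structure is the convolution product of \<open>Poly_Mapping\<close>.
\<close>

type_synonym ('v, 'a) mpoly = "('v \<Rightarrow>\<^sub>0 nat) \<Rightarrow>\<^sub>0 'a"

definition Const :: "'a \<Rightarrow> ('v, 'a::zero) mpoly" where
  "Const a = Poly_Mapping.single 0 a"

definition Var :: "'v \<Rightarrow> ('v, 'a::zero_neq_one) mpoly" where
  "Var k = Poly_Mapping.single (Poly_Mapping.single k 1) 1"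

text \<open>
  The map that is \<open>\<phi>\<close> on coefficients and sends the variable \<open>k\<close> to \<open>x k\<close>. It is a ring
  homomorphism if \<open>\<phi>\<close> is one, and covers evaluation, substitution and the involution below.
\<close>

definition poly_hom :: "('a::zero \<Rightarrow> 'b::comm_semiring_1) \<Rightarrow> ('v \<Rightarrow> 'b) \<Rightarrow> ('v, 'a) mpoly \<Rightarrow> 'b" where
  "poly_hom \<phi> x p =
     (\<Sum>m\<in>Poly_Mapping.keys p. \<phi> (Poly_Mapping.lookup p m) *
        (\<Prod>k\<in>Poly_Mapping.keys m. x k ^ Poly_Mapping.lookup m k))"

abbreviation subst :: "('v \<Rightarrow> ('w, 'a::comm_semiring_1) mpoly) \<Rightarrow> ('v, 'a) mpoly \<Rightarrow> ('w, 'a) mpoly" where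
  "subst \<equiv> poly_hom Const"

definition poly_at :: "('v, complex) mpoly \<Rightarrow> complex ^ 'v \<Rightarrow> complex" where
  "poly_at p y = poly_hom id (\<lambda>k. y $ k) p"

definition partial_deriv :: "'v \<Rightarrow> ('v, 'a::comm_semiring_1) mpoly \<Rightarrow> ('v, 'a) mpoly" where
  "partial_deriv k p =
     (\<Sum>m\<in>Poly_Mapping.keys p. Poly_Mapping.single (m - Poly_Mapping.single k 1)
        (of_nat (Poly_Mapping.lookup m k) * Poly_Mapping.lookup p m))"

definition jacobian :: "('r \<Rightarrow> ('v, 'a::comm_semiring_1) mpoly) \<Rightarrow> 'r \<Rightarrow> 'v \<Rightarrow> ('v, 'a) mpoly" where
  "jacobian f i k = partial_deriv k (f i)"

text \<open>
  A matrix is a function of a row and a column index. Rows and columns of a minor are chosen in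
  any order, so each minor occurs up to sign; the ideals generated by minors do not see this.
\<close>

definition minors :: "nat \<Rightarrow> ('r \<Rightarrow> 'c \<Rightarrow> 'a::comm_ring_1) \<Rightarrow> 'a set" where
  "minors k M = {Determinant.det (Matrix.mat k k (\<lambda>(i, j). M (r i) (c j))) | r c.
     inj_on r {..<k} \<and> inj_on c {..<k}}"

definition add_row :: "('c \<Rightarrow> 'a) \<Rightarrow> ('r \<Rightarrow> 'c \<Rightarrow> 'a) \<Rightarrow> 'r option \<Rightarrow> 'c \<Rightarrow> 'a" where
  "add_row a M = case_option a M"


subsection \<open>Ideals\<close>

definition ideal_gen :: "'a::comm_ring_1 set \<Rightarrow> 'a set" where
  "ideal_gen S = module.span (*) S"

definition prime_ideal :: "'a::comm_ring_1 set \<Rightarrow> bool" where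
  "prime_ideal I \<longleftrightarrow> module.subspace (*) I \<and> I \<noteq> UNIV \<and> (\<forall>a b. a * b \<in> I \<longrightarrow> a \<in> I \<or> b \<in> I)"

definition ideal_prod :: "'a::comm_ring_1 set \<Rightarrow> 'a set \<Rightarrow> 'a set" where
  "ideal_prod I J = ideal_gen {a * b | a b. a \<in> I \<and> b \<in> J}"

primrec ideal_pow :: "'a::comm_ring_1 set \<Rightarrow> nat \<Rightarrow> 'a set" where
  "ideal_pow J 0 = UNIV"
| "ideal_pow J (Suc k) = ideal_prod J (ideal_pow J k)"

definition ideal_colon :: "'a::comm_ring_1 set \<Rightarrow> 'a set \<Rightarrow> 'a set" where
  "ideal_colon I J = {p. \<forall>b\<in>J. p * b \<in> I}"

definition saturation :: "'a::comm_ring_1 set \<Rightarrow> 'a set \<Rightarrow> 'a set" where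
  "saturation I J = (\<Union>k. ideal_colon I (ideal_pow J k))"


subsection \<open>Affine varieties\<close>

definition zero_locus :: "('v, complex) mpoly set \<Rightarrow> (complex ^ 'v) set" where
  "zero_locus P = {y. \<forall>p\<in>P. poly_at p y = 0}"

definition vanishing_ideal :: "(complex ^ 'v) set \<Rightarrow> ('v, complex) mpoly set" where
  "vanishing_ideal Y = {p. \<forall>y\<in>Y. poly_at p y = 0}"

definition zariski_open :: "(complex ^ 'v) set \<Rightarrow> bool" where
  "zariski_open U \<longleftrightarrow> (\<exists>P. U = - zero_locus P)"

definition zariski_dense :: "(complex ^ 'v) set \<Rightarrow> bool" where
  "zariski_dense U \<longleftrightarrow> (\<forall>P. U \<subseteq> zero_locus P \<longrightarrow> zero_locus P = UNIV)"

definition algebraically_independent_mod ::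
    "('v, complex) mpoly set \<Rightarrow> nat \<Rightarrow> (nat \<Rightarrow> ('v, complex) mpoly) \<Rightarrow> bool" where
  "algebraically_independent_mod I d g \<longleftrightarrow>
     (\<forall>p :: (nat, complex) mpoly. (\<forall>m\<in>Poly_Mapping.keys p. Poly_Mapping.keys m \<subseteq> {..<d}) \<longrightarrow>
        subst g p \<in> I \<longrightarrow> p = 0)"

text \<open>
  The dimension is the transcendence degree over the complex numbers of the coordinate ring: the
  largest number of regular functions that are algebraically independent.
\<close>

definition variety_dim :: "(complex ^ 'v) set \<Rightarrow> nat" where
  "variety_dim Y = (GREATEST d. \<exists>g. algebraically_independent_mod (vanishing_ideal Y) d g)"

definition codim :: "(complex ^ 'v) set \<Rightarrow> nat" where
  "codim (Y :: (complex ^ 'v) set) = CARD('v) - variety_dim Y"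

definition singular_ideal ::
    "(complex ^ 'v) set \<Rightarrow> ('r \<Rightarrow> ('v, complex) mpoly) \<Rightarrow> ('v, complex) mpoly set" where
  "singular_ideal Y f = ideal_gen (vanishing_ideal Y \<union> minors (codim Y) (jacobian f))"


subsection \<open>The Hermitian critical ideal\<close>

datatype 'n hvar = Zvar 'n | Wvar 'n | Uvar 'n | Vvar 'n

primrec swap_var :: "'n hvar \<Rightarrow> 'n hvar" where
  "swap_var (Zvar k) = Wvar k"
| "swap_var (Wvar k) = Zvar k"
| "swap_var (Uvar k) = Vvar k"
| "swap_var (Vvar k) = Uvar k"

definition star :: "('n hvar, complex) mpoly \<Rightarrow> ('n hvar, complex) mpoly" where
  "star = poly_hom (\<lambda>a. Const (cnj a)) (\<lambda>x. Var (swap_var x))"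

abbreviation in_z :: "('n, complex) mpoly \<Rightarrow> ('n hvar, complex) mpoly" where
  "in_z \<equiv> subst (\<lambda>k. Var (Zvar k))"

definition herm_minor_ideal ::
    "(complex ^ 'n) set \<Rightarrow> ('s \<Rightarrow> ('n, complex) mpoly) \<Rightarrow> ('n hvar, complex) mpoly set" where
  "herm_minor_ideal X f = ideal_gen (minors (codim X + 1)
     (add_row (\<lambda>k. Var (Vvar k) - Var (Wvar k)) (\<lambda>i k. in_z (jacobian f i k))))"

definition herm_base_ideal ::
    "(complex ^ 'n) set \<Rightarrow> ('s \<Rightarrow> ('n, complex) mpoly) \<Rightarrow> ('n hvar, complex) mpoly set" where
  "herm_base_ideal X f =
     (let I = ideal_gen (in_z ` vanishing_ideal X); I' = herm_minor_ideal X f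
      in ideal_gen (I \<union> star ` I \<union> I' \<union> star ` I'))"

definition herm_singular_ideal ::
    "(complex ^ 'n) set \<Rightarrow> ('s \<Rightarrow> ('n, complex) mpoly) \<Rightarrow> ('n hvar, complex) mpoly set" where
  "herm_singular_ideal X f =
     (let S = ideal_gen (in_z ` singular_ideal X f) in ideal_prod S (star ` S))"

text \<open>In \<open>\<complex>[z,w]\<close> the variables \<open>z\<close> and \<open>w\<close> are \<open>Inl\<close> and \<open>Inr\<close>.\<close>

definition fix_uv ::
    "complex ^ 'n \<Rightarrow> complex ^ 'n \<Rightarrow> ('n hvar, complex) mpoly \<Rightarrow> ('n + 'n, complex) mpoly" where
  "fix_uv u v = subst (\<lambda>x. case x of
     Zvar k \<Rightarrow> Var (Inl k) | Wvar k \<Rightarrow> Var (Inr k) | Uvar k \<Rightarrow> Const (u $ k) | Vvar k \<Rightarrow> Const (v $ k))"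

text \<open>
  The data \<open>u\<close>, \<open>v\<close> are inserted after applying \<open>star\<close>, which exchanges them, and before
  saturating. As \<open>fix_uv u v\<close> is surjective, it maps ideals to ideals.
\<close>

definition herm_critical_ideal :: "(complex ^ 'n) set \<Rightarrow> ('s \<Rightarrow> ('n, complex) mpoly) \<Rightarrow>
    complex ^ 'n \<Rightarrow> complex ^ 'n \<Rightarrow> ('n + 'n, complex) mpoly set" where
  "herm_critical_ideal X f u v =
     saturation (fix_uv u v ` herm_base_ideal X f) (fix_uv u v ` herm_singular_ideal X f)"

definition vjoin :: "complex ^ 'n \<Rightarrow> complex ^ 'n \<Rightarrow> complex ^ ('n + 'n)" where
  "vjoin z w = (\<chi> j. case j of Inl k \<Rightarrow> z $ k | Inr k \<Rightarrow> w $ k)"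

definition herm_zeros :: "(complex ^ 'n) set \<Rightarrow> ('s \<Rightarrow> ('n, complex) mpoly) \<Rightarrow>
    complex ^ 'n \<Rightarrow> complex ^ 'n \<Rightarrow> ((complex ^ 'n) \<times> (complex ^ 'n)) set" where
  "herm_zeros X f u v = {(z, w). vjoin z w \<in> zero_locus (herm_critical_ideal X f u v)}"

definition vcnj :: "complex ^ 'n \<Rightarrow> complex ^ 'n" where
  "vcnj z = (\<chi> k. cnj (z $ k))"

text \<open>
  Critical points of the Hermitian distance from \<open>u\<close> on (the regular locus of) \<open>X\<close>, under their
  identification with the zeros of the form \<open>(z, vcnj z)\<close> for \<open>v = vcnj u\<close>.
\<close>

definition herm_critical_points :: "(complex ^ 'n) set \<Rightarrow> ('s \<Rightarrow> ('n, complex) mpoly) \<Rightarrow>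
    complex ^ 'n \<Rightarrow> (complex ^ 'n) set" where
  "herm_critical_points X f u = {z. (z, vcnj z) \<in> herm_zeros X f u (vcnj u)}"

definition has_vHDdeg :: "(complex ^ 'n) set \<Rightarrow> ('s \<Rightarrow> ('n, complex) mpoly) \<Rightarrow> nat \<Rightarrow> bool" where
  "has_vHDdeg X f m \<longleftrightarrow> (\<exists>U. zariski_open U \<and> zariski_dense U \<and>
     (\<forall>u v. vjoin u v \<in> U \<longrightarrow> finite (herm_zeros X f u v) \<and> card (herm_zeros X f u v) = m))"

definition vHDdeg :: "(complex ^ 'n) set \<Rightarrow> ('s \<Rightarrow> ('n, complex) mpoly) \<Rightarrow> nat" where
  "vHDdeg X f = (THE m. has_vHDdeg X f m)"

definition HDdeg :: "(complex ^ 'n) set \<Rightarrow> ('s \<Rightarrow> ('n, complex) mpoly) \<Rightarrow> nat set" where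
  "HDdeg X f = {m. \<exists>U. open U \<and> U \<noteq> {} \<and>
     (\<forall>u\<in>U. finite (herm_critical_points X f u) \<and> card (herm_critical_points X f u) = m)}"


subsection \<open>The Euclidean critical ideal\<close>

text \<open>Here \<open>Y\<close> is a variety in \<open>\<complex>\<^sup>v\<close> and \<open>h\<close> a family of real polynomials defining it.\<close>

abbreviation complexify :: "('v, real) mpoly \<Rightarrow> ('v, complex) mpoly" where
  "complexify \<equiv> Poly_Mapping.map complex_of_real"

definition eucl_critical_ideal :: "(complex ^ 'v) set \<Rightarrow> ('r \<Rightarrow> ('v, real) mpoly) \<Rightarrow>
    complex ^ 'v \<Rightarrow> ('v, complex) mpoly set" where
  "eucl_critical_ideal Y h a =
     (let J = jacobian (\<lambda>i. complexify (h i))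
      in saturation
           (ideal_gen (vanishing_ideal Y \<union>
              minors (codim Y + 1) (add_row (\<lambda>k. Const (a $ k) - Var k) J)))
           (singular_ideal Y (\<lambda>i. complexify (h i))))"

definition eucl_zeros :: "(complex ^ 'v) set \<Rightarrow> ('r \<Rightarrow> ('v, real) mpoly) \<Rightarrow>
    complex ^ 'v \<Rightarrow> (complex ^ 'v) set" where
  "eucl_zeros Y h a = zero_locus (eucl_critical_ideal Y h a)"

definition real_points :: "(complex ^ 'v) set" where
  "real_points = {y. \<forall>k. y $ k \<in> \<real>}"

definition eucl_critical_points :: "(complex ^ 'v) set \<Rightarrow> ('r \<Rightarrow> ('v, real) mpoly) \<Rightarrow>
    complex ^ 'v \<Rightarrow> (complex ^ 'v) set" where
  "eucl_critical_points Y h a = eucl_zeros Y h a \<inter> real_points"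

definition has_EDdegree :: "(complex ^ 'v) set \<Rightarrow> ('r \<Rightarrow> ('v, real) mpoly) \<Rightarrow> nat \<Rightarrow> bool" where
  "has_EDdegree Y h m \<longleftrightarrow> (\<exists>U. zariski_open U \<and> zariski_dense U \<and>
     (\<forall>a\<in>U. finite (eucl_zeros Y h a) \<and> card (eucl_zeros Y h a) = m))"

definition EDdegree :: "(complex ^ 'v) set \<Rightarrow> ('r \<Rightarrow> ('v, real) mpoly) \<Rightarrow> nat" where
  "EDdegree Y h = (THE m. has_EDdegree Y h m)"

definition real_EDdegree :: "(complex ^ 'v) set \<Rightarrow> ('r \<Rightarrow> ('v, real) mpoly) \<Rightarrow> nat set" where
  "real_EDdegree Y h = {m. \<exists>U. openin (top_of_set real_points) U \<and> U \<noteq> {} \<and>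
     (\<forall>a\<in>U. finite (eucl_critical_points Y h a) \<and> card (eucl_critical_points Y h a) = m)}"


subsection \<open>Passing to real and imaginary parts\<close>

definition to_xy :: "(complex ^ 'n) \<times> (complex ^ 'n) \<Rightarrow> complex ^ ('n + 'n)" where
  "to_xy = (\<lambda>(z, w). vjoin (\<chi> k. (z $ k + w $ k) / 2) (\<chi> k. (z $ k - w $ k) / (2 * \<i>)))"

definition from_xy :: "complex ^ ('n + 'n) \<Rightarrow> (complex ^ 'n) \<times> (complex ^ 'n)" where
  "from_xy p = (\<chi> k. p $ Inl k + \<i> * p $ Inr k, \<chi> k. p $ Inl k - \<i> * p $ Inr k)"

definition tilde :: "(complex ^ 'n) set \<Rightarrow> (complex ^ ('n + 'n)) set" where
  "tilde X = {to_xy (z, w) | z w. z \<in> X \<and> w \<in> vcnj ` X}"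

text \<open>
  The variables \<open>x\<close> and \<open>y\<close> are \<open>Inl\<close> and \<open>Inr\<close>. The splitting of \<open>f(x + iy)\<close> into
  \<open>f\<^sup>R + i f\<^sup>I\<close> with real \<open>f\<^sup>R\<close>, \<open>f\<^sup>I\<close> takes real and imaginary parts of all coefficients.
\<close>

abbreviation in_xy :: "('n, complex) mpoly \<Rightarrow> ('n + 'n, complex) mpoly" where
  "in_xy \<equiv> subst (\<lambda>k. Var (Inl k) + Const \<i> * Var (Inr k))"

definition tilde_eqs ::
    "('s \<Rightarrow> ('n, complex) mpoly) \<Rightarrow> 's + 's \<Rightarrow> ('n + 'n, real) mpoly" where
  "tilde_eqs f = case_sum (\<lambda>i. Poly_Mapping.map Re (in_xy (f i)))
                          (\<lambda>i. Poly_Mapping.map Im (in_xy (f i)))"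

end

theory Submission
  imports Defs
begin

text \<open>
  In the coordinates \<open>z = x + iy\<close>, \<open>w = x - iy\<close> the variety \<open>tilde X\<close> becomes \<open>X \<times> cnj X\<close>: its ideal is
  the sum of the ideals of the factors, its Jacobian becomes block diagonal, and its codimension is
  twice the codimension \<open>c\<close> of \<open>X\<close>. By block expansion of determinants the Euclidean base ideal lies in
  the Hermitian one, and the product of the Hermitian base ideal with the two singular ideals lies in
  the Euclidean one, because a \<open>(c+1)\<close>-minor of one augmented block times a \<open>c\<close>-minor of the other
  Jacobian is a \<open>(2c+1)\<close>-minor of the augmented matrix of \<open>tilde X\<close>. Hence both saturations are equal,
  as ideals. Two facts on \<open>X\<close> are needed: \<open>(c+1)\<close>-minors of the Jacobian vanish on \<open>X\<close>, since outside a
  proper subset the ideal is generated by \<open>c\<close> elements, and the dimension is additive in products,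
  since the number of algebraically independent functions is bounded by the growth rate of the
  coordinate ring.
\<close>

subsection \<open>Ideals and saturation\<close>

text \<open>The obstacle is that \<open>vanishing_ideal (tilde X)\<close> is at first only a sum of
  two ideals, so field-theoretic transcendence degree is not at hand for the product. The growth
  estimate asks for less: polynomial relations for the remaining generators whose leading
  coefficients are non-zero-divisors modulo the ideal. Leading coefficients of relations on
  \<open>X\<close> keep this property on the product, because restriction to a slice with one factor
  fixed returns to the prime ideal of \<open>X\<close>. The singular ideals of the two sides also
  have to be compared: the product of the Hermitian ones is contained in the Euclidean one and
  agrees with it modulo the ideal \<open>K\<close> of \<open>tilde X\<close>. As \<open>K\<close>
  lies in the smaller base ideal, powers may be compared modulo \<open>K\<close>, and the exponent
  in the saturation grows by one. The row \<open>v - w\<close> stands over the derivatives in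
  \<open>z\<close>, because in the coordinates \<open>z\<close>, \<open>w\<close> the quadratic form
  is the sum of the \<open>z $ k * w $ k\<close>, whose \<open>z\<close>-derivative is
  \<open>w\<close>. Conjugation makes the maps of the second factor antilinear on constants, so they
  are treated as ring homomorphisms and not as linear maps.\<close>

abbreviation is_ideal :: "'a::comm_ring_1 set \<Rightarrow> bool" where
  "is_ideal \<equiv> module.subspace (*)"

lemma module_mult: "Modules.module ((*) :: 'a::comm_ring_1 \<Rightarrow> 'a \<Rightarrow> 'a)"
  by unfold_locales (auto simp: algebra_simps)

lemma is_ideal_iff:
  "is_ideal I \<longleftrightarrow> 0 \<in> I \<and> (\<forall>x\<in>I. \<forall>y\<in>I. x + y \<in> I) \<and> (\<forall>c. \<forall>x\<in>I. c * x \<in> I)"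
  using Modules.module.subspace_def[OF module_mult, of I] by auto

lemma is_idealI:
  "0 \<in> I \<Longrightarrow> (\<And>x y. x \<in> I \<Longrightarrow> y \<in> I \<Longrightarrow> x + y \<in> I) \<Longrightarrow> (\<And>c x. x \<in> I \<Longrightarrow> c * x \<in> I) \<Longrightarrow> is_ideal I"
  by (auto simp: is_ideal_iff)

lemma is_ideal_0: "is_ideal I \<Longrightarrow> 0 \<in> I"
  and is_ideal_add: "is_ideal I \<Longrightarrow> x \<in> I \<Longrightarrow> y \<in> I \<Longrightarrow> x + y \<in> I"
  and is_ideal_mult: "is_ideal I \<Longrightarrow> x \<in> I \<Longrightarrow> c * x \<in> I"
  by (auto simp: is_ideal_iff)

lemma is_ideal_mult_right: "is_ideal I \<Longrightarrow> x \<in> I \<Longrightarrow> x * c \<in> I"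
  by (subst mult.commute) (rule is_ideal_mult)

lemma is_ideal_uminus: "is_ideal I \<Longrightarrow> x \<in> I \<Longrightarrow> - x \<in> I"
  using is_ideal_mult[of I x "-1"] by simp

lemma is_ideal_diff: "is_ideal I \<Longrightarrow> x \<in> I \<Longrightarrow> y \<in> I \<Longrightarrow> x - y \<in> I"
  using is_ideal_add[of I x "-y"] is_ideal_uminus[of I y] by simp

lemma is_ideal_sum: "is_ideal I \<Longrightarrow> (\<And>a. a \<in> A \<Longrightarrow> f a \<in> I) \<Longrightarrow> sum f A \<in> I"
  by (induction A rule: infinite_finite_induct) (auto intro: is_ideal_0 is_ideal_add)

lemma is_ideal_UNIV: "is_ideal UNIV"
  by (auto simp: is_ideal_iff)

lemma is_ideal_gen [simp]: "is_ideal (ideal_gen S)"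
  unfolding ideal_gen_def by (rule Modules.module.subspace_span[OF module_mult])

lemma ideal_gen_base: "x \<in> S \<Longrightarrow> x \<in> ideal_gen S"
  unfolding ideal_gen_def by (rule Modules.module.span_base[OF module_mult])

lemma ideal_gen_least: "is_ideal J \<Longrightarrow> S \<subseteq> J \<Longrightarrow> ideal_gen S \<subseteq> J"
  unfolding ideal_gen_def by (rule Modules.module.span_minimal[OF module_mult])

lemma ideal_gen_eq: "is_ideal I \<Longrightarrow> ideal_gen I = I"
  by (auto intro: ideal_gen_base dest: ideal_gen_least[of I I, THEN subsetD])

lemma ideal_gen_mono: "S \<subseteq> T \<Longrightarrow> ideal_gen S \<subseteq> ideal_gen T"
  unfolding ideal_gen_def by (rule Modules.module.span_mono[OF module_mult])

lemma ideal_gen_cong: "S \<subseteq> ideal_gen T \<Longrightarrow> T \<subseteq> ideal_gen S \<Longrightarrow> ideal_gen S = ideal_gen T"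
  by (meson ideal_gen_least is_ideal_gen subset_antisym)

lemma ideal_gen_Un_cases:
  assumes "x \<in> ideal_gen (S \<union> T)"
  obtains y z where "y \<in> ideal_gen S" "z \<in> ideal_gen T" "x = y + z"
  using assms module.span_Un[OF module_mult, of S T] unfolding ideal_gen_def by auto

lemma is_ideal_colon: "is_ideal I \<Longrightarrow> is_ideal {p. p * q \<in> I}"
  by (auto simp: is_ideal_iff algebra_simps)

lemma is_ideal_vimage:
  assumes "comm_ring_hom \<phi>" "is_ideal J" shows "is_ideal (\<phi> -` J)"
proof -
  interpret comm_ring_hom \<phi> by fact
  show ?thesis
    using assms(2) by (auto simp: is_ideal_iff hom_add hom_mult)
qed

lemma is_ideal_image_surj:
  assumes "comm_ring_hom \<phi>" "surj \<phi>" "is_ideal J" shows "is_ideal (\<phi> ` J)"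
proof -
  interpret comm_ring_hom \<phi> by fact
  show ?thesis
  proof (rule is_idealI)
    show "0 \<in> \<phi> ` J" using is_ideal_0[OF assms(3)] hom_zero by force
    show "x + y \<in> \<phi> ` J" if "x \<in> \<phi> ` J" "y \<in> \<phi> ` J" for x y
      using that is_ideal_add[OF assms(3)] by (auto simp flip: hom_add)
    show "c * x \<in> \<phi> ` J" if "x \<in> \<phi> ` J" for c x
    proof -
      obtain d where "c = \<phi> d" using assms(2) by (metis surjD)
      then show ?thesis using that is_ideal_mult[OF assms(3)] by (auto simp flip: hom_mult)
    qed
  qed
qed

lemma image_ideal_gen_subset:
  assumes "comm_ring_hom \<phi>" shows "\<phi> ` ideal_gen S \<subseteq> ideal_gen (\<phi> ` S)"
  using ideal_gen_least[OF is_ideal_vimage[OF assms, of "ideal_gen (\<phi> ` S)"], of S]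
  by (auto intro: ideal_gen_base)

lemma image_ideal_gen:
  assumes "comm_ring_hom \<phi>" "surj \<phi>" shows "\<phi> ` ideal_gen S = ideal_gen (\<phi> ` S)"
  using image_ideal_gen_subset[OF assms(1)]
    ideal_gen_least[OF is_ideal_image_surj[OF assms, of "ideal_gen S"], of "\<phi> ` S"]
  by (auto intro: ideal_gen_base)

text \<open>An image under a homomorphism that is not onto need not be an ideal, hence the outer
  \<open>ideal_gen\<close>; this form serves \<open>in_xy\<close> and \<open>in_xyc\<close>.\<close>

lemma ideal_gen_image_ideal_gen:
  assumes "comm_ring_hom \<phi>" shows "ideal_gen (\<phi> ` ideal_gen S) = ideal_gen (\<phi> ` S)"
  using image_ideal_gen_subset[OF assms] by (intro ideal_gen_cong) (auto intro: ideal_gen_base)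

lemma ideal_prod_least:
  "is_ideal L \<Longrightarrow> (\<And>a b. a \<in> I \<Longrightarrow> b \<in> J \<Longrightarrow> a * b \<in> L) \<Longrightarrow> ideal_prod I J \<subseteq> L"
  unfolding ideal_prod_def by (intro ideal_gen_least) auto

lemma ideal_prod_base: "a \<in> I \<Longrightarrow> b \<in> J \<Longrightarrow> a * b \<in> ideal_prod I J"
  unfolding ideal_prod_def by (intro ideal_gen_base) auto

lemma is_ideal_prod: "is_ideal (ideal_prod I J)"
  unfolding ideal_prod_def by simp

lemma is_ideal_pow: "is_ideal (ideal_pow J k)"
  by (cases k) (auto simp: is_ideal_UNIV is_ideal_prod)

lemma ideal_prod_mono: "I \<subseteq> I' \<Longrightarrow> J \<subseteq> J' \<Longrightarrow> ideal_prod I J \<subseteq> ideal_prod I' J'"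
  by (intro ideal_prod_least is_ideal_prod ideal_prod_base) auto

lemma ideal_pow_mono: "I \<subseteq> J \<Longrightarrow> ideal_pow I k \<subseteq> ideal_pow J k"
  by (induction k) (simp_all add: ideal_prod_mono)

lemma image_ideal_prod:
  assumes "comm_ring_hom \<phi>" "surj \<phi>"
  shows "\<phi> ` ideal_prod I J = ideal_prod (\<phi> ` I) (\<phi> ` J)"
proof -
  interpret comm_ring_hom \<phi> by fact
  have "\<phi> ` {a * b | a b. a \<in> I \<and> b \<in> J} = {a * b | a b. a \<in> \<phi> ` I \<and> b \<in> \<phi> ` J}"
  proof (intro equalityI subsetI)
    fix x assume "x \<in> \<phi> ` {a * b | a b. a \<in> I \<and> b \<in> J}"
    then obtain a b where "a \<in> I" "b \<in> J" "x = \<phi> a * \<phi> b" using hom_mult by blast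
    then show "x \<in> {a * b | a b. a \<in> \<phi> ` I \<and> b \<in> \<phi> ` J}" by blast
  next
    fix x assume "x \<in> {a * b | a b. a \<in> \<phi> ` I \<and> b \<in> \<phi> ` J}"
    then obtain a b where "a \<in> I" "b \<in> J" "x = \<phi> (a * b)" using hom_mult by force
    then show "x \<in> \<phi> ` {a * b | a b. a \<in> I \<and> b \<in> J}" by blast
  qed
  then show ?thesis
    unfolding ideal_prod_def image_ideal_gen[OF assms] by simp
qed

lemma image_ideal_pow:
  assumes "comm_ring_hom \<phi>" "surj \<phi>"
  shows "\<phi> ` ideal_pow J k = ideal_pow (\<phi> ` J) k"
  using assms by (induction k) (auto simp: image_ideal_prod)

text \<open>For a fixed cofactor, the elements whose product with it lies in an ideal form an ideal.
  So membership need be checked on generators only, in one factor at a time.\<close>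

lemma ideal_prod_gen_gen:
  "ideal_prod (ideal_gen S) (ideal_gen T) = ideal_gen {a * b | a b. a \<in> S \<and> b \<in> T}" (is "_ = ?R")
proof
  have "a * b \<in> ?R" if a: "a \<in> ideal_gen S" and b: "b \<in> ideal_gen T" for a b
  proof -
    have "T \<subseteq> {y. y * s \<in> ?R}" if "s \<in> S" for s
    proof
      fix y assume "y \<in> T"
      then have "s * y \<in> ?R" using that by (intro ideal_gen_base) blast
      then show "y \<in> {y. y * s \<in> ?R}" by (simp add: mult.commute)
    qed
    from ideal_gen_least[OF is_ideal_colon this] have "S \<subseteq> {x. x * b \<in> ?R}"
      using b by (force simp: mult.commute)
    from ideal_gen_least[OF is_ideal_colon this] show ?thesis using a by auto
  qed
  then show "ideal_prod (ideal_gen S) (ideal_gen T) \<subseteq> ?R"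
    by (intro ideal_prod_least) auto
  show "?R \<subseteq> ideal_prod (ideal_gen S) (ideal_gen T)"
    by (intro ideal_gen_least is_ideal_prod) (auto intro!: ideal_prod_base ideal_gen_base)
qed

text \<open>Injectivity makes \<open>\<phi>\<close> reflect the memberships
  \<open>p * b \<in> I\<close> that define the colon ideal; surjectivity makes it reach every
  candidate \<open>p\<close> and preserve powers of ideals.\<close>

lemma image_saturation:
  assumes "comm_ring_hom \<phi>" "bij \<phi>"
  shows "\<phi> ` saturation I J = saturation (\<phi> ` I) (\<phi> ` J)"
proof -
  interpret comm_ring_hom \<phi> by fact
  have surj: "surj \<phi>" and inj: "inj \<phi>" using assms(2) by (auto simp: bij_def)
  have "\<phi> ` ideal_colon I L = ideal_colon (\<phi> ` I) (\<phi> ` L)" for L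
  proof -
    have "\<phi> p \<in> ideal_colon (\<phi> ` I) (\<phi> ` L) \<longleftrightarrow> p \<in> ideal_colon I L" for p
      by (simp add: ideal_colon_def inj_image_mem_iff[OF inj] flip: hom_mult)
    then show ?thesis using surj by (auto simp: image_iff) (metis surjD)
  qed
  then show ?thesis
    by (simp add: saturation_def image_UN image_ideal_pow[OF assms(1) surj])
qed

text \<open>Replacing the factors of a product one after another changes it by an element of
  \<open>K\<close> only. The set \<open>?L\<close> of elements congruent to a member of the power of
  \<open>S\<close> has to be an ideal, because powers of ideals are generated by products and do not
  consist of them.\<close>

lemma ideal_pow_mod:
  assumes K: "is_ideal K" and T: "\<And>t. t \<in> T \<Longrightarrow> \<exists>s\<in>S. t - s \<in> K"
    and t: "t \<in> ideal_pow T k"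
  shows "\<exists>s\<in>ideal_pow S k. t - s \<in> K"
  using t
proof (induction k arbitrary: t)
  case 0
  then show ?case using is_ideal_0[OF K] by (intro bexI[of _ t]) auto
next
  case (Suc k)
  let ?L = "{t. \<exists>s\<in>ideal_pow S (Suc k). t - s \<in> K}"
  note IS = is_ideal_pow[of S "Suc k"]
  have "is_ideal ?L"
  proof (rule is_idealI)
    show "0 \<in> ?L" using is_ideal_0[OF IS] is_ideal_0[OF K] by force
    show "x + y \<in> ?L" if xy: "x \<in> ?L" "y \<in> ?L" for x y
    proof -
      obtain s s' where "s \<in> ideal_pow S (Suc k)" "x - s \<in> K" "s' \<in> ideal_pow S (Suc k)" "y - s' \<in> K"
        using xy by auto
      then have "s + s' \<in> ideal_pow S (Suc k)" "x + y - (s + s') \<in> K"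
        using is_ideal_add[OF IS, of s s'] is_ideal_add[OF K, of "x - s" "y - s'"]
        by (simp_all add: algebra_simps)
      then show ?thesis by blast
    qed
    show "c * x \<in> ?L" if x: "x \<in> ?L" for c x
    proof -
      obtain s where "s \<in> ideal_pow S (Suc k)" "x - s \<in> K"
        using x by auto
      then have "c * s \<in> ideal_pow S (Suc k)" "c * x - c * s \<in> K"
        using is_ideal_mult[OF IS, of s c] is_ideal_mult[OF K, of "x - s" c]
        by (simp_all add: right_diff_distrib)
      then show ?thesis by blast
    qed
  qed
  moreover have "a * b \<in> ?L" if ab: "a \<in> T" "b \<in> ideal_pow T k" for a b
  proof -
    obtain s where s: "s \<in> S" "a - s \<in> K" using T[OF \<open>a \<in> T\<close>] by blast
    obtain s' where s': "s' \<in> ideal_pow S k" "b - s' \<in> K" using Suc.IH[OF ab(2)] by blast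
    have "a * b - s * s' = b * (a - s) + s * (b - s')" by (simp add: algebra_simps)
    also have "\<dots> \<in> K" using s s' is_ideal_add is_ideal_mult K by blast
    finally show ?thesis using s s' by (auto intro!: ideal_prod_base)
  qed
  ultimately have "ideal_pow T (Suc k) \<subseteq> ?L"
    by (simp add: ideal_prod_least)
  then show ?case using Suc.prems by auto
qed

text \<open>An extra factor from \<open>S\<close> carries \<open>A\<close> into \<open>B\<close>, so
  exponent \<open>k\<close> for \<open>A\<close> and \<open>S\<close> becomes \<open>Suc k\<close>
  for \<open>B\<close> and \<open>T\<close>; exchanging \<open>T\<close> for \<open>S\<close> costs
  an error in \<open>K\<close>, which \<open>B\<close> absorbs. The other inclusion is monotonicity
  with the same exponent.\<close>

lemma saturation_eqI:
  assumes ideals: "is_ideal A" "is_ideal B" "is_ideal K"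
    and sub: "K \<subseteq> B" "B \<subseteq> A" "S \<subseteq> T"
    and AS: "\<And>a s. a \<in> A \<Longrightarrow> s \<in> S \<Longrightarrow> a * s \<in> B"
    and TS: "\<And>t. t \<in> T \<Longrightarrow> \<exists>s\<in>S. t - s \<in> K"
  shows "saturation A S = saturation B T"
proof (intro equalityI subsetI)
  fix x assume "x \<in> saturation A S"
  then obtain k where k: "\<And>s. s \<in> ideal_pow S k \<Longrightarrow> x * s \<in> A"
    by (auto simp: saturation_def ideal_colon_def)
  have sub1: "ideal_pow S (Suc k) \<subseteq> {s. s * x \<in> B}"
    unfolding ideal_pow.simps
  proof (intro ideal_prod_least is_ideal_colon ideals)
    fix a b assume "a \<in> S" "b \<in> ideal_pow S k"
    then have "x * b * a \<in> B" using AS k by blast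
    then show "a * b \<in> {s. s * x \<in> B}" by (simp add: ac_simps)
  qed
  have "x * t \<in> B" if t: "t \<in> ideal_pow T (Suc k)" for t
  proof -
    obtain s where s: "s \<in> ideal_pow S (Suc k)" "t - s \<in> K"
      using ideal_pow_mod[OF ideals(3) TS t] by blast
    have "x * t = s * x + x * (t - s)" by (simp add: algebra_simps)
    also have "\<dots> \<in> B"
    proof (rule is_ideal_add[OF ideals(2) _ is_ideal_mult[OF ideals(2)]])
      show "s * x \<in> B" using s(1) sub1 by blast
      show "t - s \<in> B" using s(2) sub(1) by blast
    qed
    finally show ?thesis .
  qed
  then have "x \<in> ideal_colon B (ideal_pow T (Suc k))"
    unfolding ideal_colon_def by blast
  then show "x \<in> saturation B T"
    unfolding saturation_def by blast
next
  fix x assume "x \<in> saturation B T"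
  then show "x \<in> saturation A S"
    using ideal_pow_mono[OF sub(3)] sub(2) unfolding saturation_def ideal_colon_def by blast
qed


subsection \<open>Polynomials\<close>

lemma poly_mapping_sum_single:
  fixes p :: "'a \<Rightarrow>\<^sub>0 'b::comm_monoid_add"
  shows "p = (\<Sum>m\<in>Poly_Mapping.keys p. Poly_Mapping.single m (Poly_Mapping.lookup p m))"
  by (rule poly_mapping_eqI) (auto simp: lookup_sum lookup_single when_def in_keys_iff)

lemma poly_mapping_additive_induct [case_names zero single add]:
  fixes p :: "'a \<Rightarrow>\<^sub>0 'b::comm_monoid_add"
  assumes "P 0" "\<And>m c. P (Poly_Mapping.single m c)" "\<And>p q. P p \<Longrightarrow> P q \<Longrightarrow> P (p + q)"
  shows "P p"
proof -
  have "P (\<Sum>m\<in>A. Poly_Mapping.single m (Poly_Mapping.lookup p m))" for A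
    by (induction A rule: infinite_finite_induct) (auto intro: assms)
  then show ?thesis by (subst poly_mapping_sum_single)
qed

definition mon_eval :: "('v \<Rightarrow> 'b::comm_semiring_1) \<Rightarrow> ('v \<Rightarrow>\<^sub>0 nat) \<Rightarrow> 'b" where
  "mon_eval x m = (\<Prod>k\<in>Poly_Mapping.keys m. x k ^ Poly_Mapping.lookup m k)"

lemma mon_eval_superset:
  "finite S \<Longrightarrow> Poly_Mapping.keys m \<subseteq> S \<Longrightarrow> mon_eval x m = (\<Prod>k\<in>S. x k ^ Poly_Mapping.lookup m k)"
  unfolding mon_eval_def by (rule prod.mono_neutral_left) (auto simp: in_keys_iff)

lemma mon_eval_0 [simp]: "mon_eval x 0 = 1"
  by (simp add: mon_eval_def)

lemma mon_eval_single [simp]: "mon_eval x (Poly_Mapping.single k n) = x k ^ n"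
  by (simp add: mon_eval_def)

lemma mon_eval_add: "mon_eval x (m + m') = mon_eval x m * mon_eval x m'"
proof -
  let ?S = "Poly_Mapping.keys m \<union> Poly_Mapping.keys m'"
  have "mon_eval x (m + m') = (\<Prod>k\<in>?S. x k ^ Poly_Mapping.lookup (m + m') k)"
    using Poly_Mapping.keys_add[of m m'] by (intro mon_eval_superset) auto
  also have "\<dots> = (\<Prod>k\<in>?S. x k ^ Poly_Mapping.lookup m k) * (\<Prod>k\<in>?S. x k ^ Poly_Mapping.lookup m' k)"
    by (simp add: lookup_add power_add prod.distrib)
  also have "\<dots> = mon_eval x m * mon_eval x m'"
    by (simp add: mon_eval_superset[of ?S])
  finally show ?thesis .
qed

lemma poly_hom_superset:
  assumes "\<phi> 0 = 0" "finite S" "Poly_Mapping.keys p \<subseteq> S"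
  shows "poly_hom \<phi> x p = (\<Sum>m\<in>S. \<phi> (Poly_Mapping.lookup p m) * mon_eval x m)"
  unfolding poly_hom_def mon_eval_def
  by (rule sum.mono_neutral_left) (use assms in \<open>auto simp: in_keys_iff\<close>)

lemma poly_hom_single: "\<phi> 0 = 0 \<Longrightarrow> poly_hom \<phi> x (Poly_Mapping.single m c) = \<phi> c * mon_eval x m"
  by (subst poly_hom_superset[of _ "{m}"]) auto

lemma poly_hom_add:
  assumes "\<phi> 0 = 0" "\<And>a b. \<phi> (a + b) = \<phi> a + \<phi> b"
  shows "poly_hom \<phi> x (p + q) = poly_hom \<phi> x p + poly_hom \<phi> x q"
proof -
  let ?S = "Poly_Mapping.keys p \<union> Poly_Mapping.keys q"
  have "Poly_Mapping.keys (p + q) \<subseteq> ?S" by (rule Poly_Mapping.keys_add)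
  then show ?thesis
    by (simp add: poly_hom_superset[of \<phi> ?S] assms lookup_add distrib_right sum.distrib)
qed

lemma poly_hom_ring_hom:
  fixes \<phi> :: "'a::comm_ring_1 \<Rightarrow> 'b::comm_ring_1"
  assumes "comm_ring_hom \<phi>" shows "comm_ring_hom (poly_hom \<phi> x)"
proof -
  interpret comm_ring_hom \<phi> by fact
  note add = poly_hom_add[of \<phi>, OF hom_zero hom_add]
  have zero: "poly_hom \<phi> x 0 = 0" by (simp add: poly_hom_def)
  have mult1: "poly_hom \<phi> x (Poly_Mapping.single m c * q) = \<phi> c * mon_eval x m * poly_hom \<phi> x q" for m c q
  proof (induction q rule: poly_mapping_additive_induct)
    case (single m c)
    then show ?case by (simp add: mult_single poly_hom_single mon_eval_add hom_mult ac_simps)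
  qed (simp_all add: zero add distrib_left)
  have mult: "poly_hom \<phi> x (p * q) = poly_hom \<phi> x p * poly_hom \<phi> x q" for p q
    by (induction p rule: poly_mapping_additive_induct)
       (simp_all add: mult1 add distrib_right zero poly_hom_single)
  have one: "poly_hom \<phi> x 1 = 1"
    by (subst single_one[symmetric]) (simp add: poly_hom_single del: single_one)
  show ?thesis
    by unfold_locales (auto simp: add mult one poly_hom_def[of _ _ 0])
qed

lemma poly_hom_Const [simp]: "\<phi> 0 = 0 \<Longrightarrow> poly_hom \<phi> x (Const c) = \<phi> c"
  by (simp add: Const_def poly_hom_single)

lemma poly_hom_Var [simp]: "\<phi> 0 = 0 \<Longrightarrow> \<phi> 1 = 1 \<Longrightarrow> poly_hom \<phi> x (Var k) = x k"
  by (simp add: Var_def poly_hom_single)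

lemma Const_0 [simp]: "Const 0 = 0" and Const_1 [simp]: "Const 1 = 1"
  by (simp_all add: Const_def)

lemma Const_hom: "comm_ring_hom (Const :: 'a::comm_ring_1 \<Rightarrow> ('v, 'a) mpoly)"
  by unfold_locales (auto simp: Const_def single_add mult_single)

lemma cnj_hom: "comm_ring_hom cnj"
  by unfold_locales auto

lemma id_hom: "comm_ring_hom (id :: 'a::comm_ring_1 \<Rightarrow> 'a)"
  by unfold_locales auto

lemma comp_hom:
  assumes "comm_ring_hom \<phi>" "comm_ring_hom \<psi>" shows "comm_ring_hom (\<lambda>x. \<phi> (\<psi> x))"
proof -
  interpret \<phi>: comm_ring_hom \<phi> by fact
  interpret \<psi>: comm_ring_hom \<psi> by fact
  show ?thesis
    by unfold_locales (auto simp: \<phi>.hom_add \<phi>.hom_mult \<psi>.hom_add \<psi>.hom_mult)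
qed

lemma Const_cnj_hom: "comm_ring_hom (\<lambda>a. Const (cnj a) :: ('v, complex) mpoly)"
  by (rule comp_hom[OF Const_hom cnj_hom])

lemma single_eq_Const_mult_mon:
  fixes c :: "'a::comm_ring_1"
  shows "Poly_Mapping.single m c = Const c * mon_eval Var m"
proof -
  have Vp: "Var k ^ n = Poly_Mapping.single (Poly_Mapping.single k n) (1::'a)" for k :: 'b and n
    by (induction n) (auto simp: Var_def mult_single simp flip: single_add)
  have "mon_eval Var m = Poly_Mapping.single m (1::'a)"
    by (induction m rule: poly_mapping_additive_induct) (auto simp: Vp mon_eval_add mult_single)
  then show ?thesis by (simp add: Const_def mult_single)
qed

lemma mpoly_induct [case_names Const Var add mult]:
  fixes p :: "('v, 'a::comm_ring_1) mpoly"
  assumes C: "\<And>c. P (Const c)" and V: "\<And>k. P (Var k)"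
    and add: "\<And>p q. P p \<Longrightarrow> P q \<Longrightarrow> P (p + q)" and mult: "\<And>p q. P p \<Longrightarrow> P q \<Longrightarrow> P (p * q)"
  shows "P p"
proof (induction p rule: poly_mapping_additive_induct)
  case zero
  then show ?case using C[of 0] by simp
next
  case (single m c)
  have pow: "P (Var k ^ n)" for k n
    by (induction n) (use C[of 1] in \<open>auto intro: V mult\<close>)
  have "P (\<Prod>k\<in>A. Var k ^ Poly_Mapping.lookup m k)" for A
    by (induction A rule: infinite_finite_induct) (use C[of 1] in \<open>auto intro: pow mult\<close>)
  then show ?case unfolding single_eq_Const_mult_mon mon_eval_def by (intro mult C)
qed (use add in auto)

text \<open>The uniqueness half of the universal property of polynomial rings; identities between
  compositions of substitutions, conjugations and evaluations rest on it.\<close>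

lemma ring_hom_mpoly_eqI:
  fixes F G :: "('v, 'a::comm_ring_1) mpoly \<Rightarrow> 'b::comm_ring_1"
  assumes "comm_ring_hom F" "comm_ring_hom G"
    and "\<And>c. F (Const c) = G (Const c)" "\<And>k. F (Var k) = G (Var k)"
  shows "F p = G p"
proof -
  interpret F: comm_ring_hom F by fact
  interpret G: comm_ring_hom G by fact
  show ?thesis
    by (induction p rule: mpoly_induct) (auto simp: assms F.hom_add G.hom_add F.hom_mult G.hom_mult)
qed

lemma hom_poly_hom:
  fixes \<phi> :: "'a::comm_ring_1 \<Rightarrow> 'b::comm_ring_1" and \<psi> :: "'b \<Rightarrow> 'c::comm_ring_1"
  assumes "comm_ring_hom \<phi>" "comm_ring_hom \<psi>"
  shows "\<psi> (poly_hom \<phi> x p) = poly_hom (\<lambda>a. \<psi> (\<phi> a)) (\<lambda>k. \<psi> (x k)) p"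
proof -
  interpret \<phi>: comm_ring_hom \<phi> by fact
  interpret \<psi>: comm_ring_hom \<psi> by fact
  show ?thesis
    by (rule ring_hom_mpoly_eqI[OF comp_hom[OF assms(2) poly_hom_ring_hom[OF assms(1)]]
          poly_hom_ring_hom[OF comp_hom[OF assms(2,1)]]]) auto
qed

lemma poly_hom_Const_Var [simp]: "poly_hom Const Var p = p"
  for p :: "('v, 'a::comm_ring_1) mpoly"
  by (rule ring_hom_mpoly_eqI[OF poly_hom_ring_hom[OF Const_hom] id_hom[unfolded id_def]]) auto

lemma poly_hom_cong:
  assumes "\<And>k m. m \<in> Poly_Mapping.keys p \<Longrightarrow> k \<in> Poly_Mapping.keys m \<Longrightarrow> x k = y k"
  shows "poly_hom \<phi> x p = poly_hom \<phi> y p"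
  unfolding poly_hom_def by (intro sum.cong arg_cong2[of _ _ _ _ "(*)"] prod.cong) (auto simp: assms)

lemma poly_at_hom: "comm_ring_hom (\<lambda>p. poly_at p y)"
  unfolding poly_at_def by (rule poly_hom_ring_hom[OF id_hom])

lemma poly_at_simps [simp]:
  "poly_at 0 y = 0" "poly_at 1 y = 1" "poly_at (p + q) y = poly_at p y + poly_at q y"
  "poly_at (p - q) y = poly_at p y - poly_at q y" "poly_at (- p) y = - poly_at p y"
  "poly_at (p * q) y = poly_at p y * poly_at q y" "poly_at (p ^ n) y = poly_at p y ^ n"
  "poly_at (sum f A) y = (\<Sum>a\<in>A. poly_at (f a) y)"
  "poly_at (Const c) y = c" "poly_at (Var k) y = y $ k"
proof -
  interpret comm_ring_hom "\<lambda>p. poly_at p y" by (rule poly_at_hom)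
  show "poly_at 0 y = 0" "poly_at 1 y = 1" "poly_at (p + q) y = poly_at p y + poly_at q y"
    "poly_at (p - q) y = poly_at p y - poly_at q y" "poly_at (- p) y = - poly_at p y"
    "poly_at (p * q) y = poly_at p y * poly_at q y" "poly_at (p ^ n) y = poly_at p y ^ n"
    "poly_at (sum f A) y = (\<Sum>a\<in>A. poly_at (f a) y)"
    by (auto simp: hom_distribs)
  show "poly_at (Const c) y = c" "poly_at (Var k) y = y $ k"
    by (auto simp: poly_at_def)
qed

lemma poly_at_poly_hom_Const:
  fixes x :: "'w \<Rightarrow> ('v::finite, complex) mpoly"
  shows "poly_at (poly_hom Const x p) y = poly_hom id (\<lambda>k. poly_at (x k) y) p"
  by (subst hom_poly_hom[OF Const_hom poly_at_hom]) (simp add: id_def)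

lemma is_ideal_vanishing: "is_ideal (vanishing_ideal Y)"
  by (rule is_idealI) (auto simp: vanishing_ideal_def)


subsection \<open>Derivatives\<close>

lemma partial_deriv_superset:
  assumes "finite S" "Poly_Mapping.keys p \<subseteq> S"
  shows "partial_deriv k p = (\<Sum>m\<in>S. Poly_Mapping.single (m - Poly_Mapping.single k 1)
        (of_nat (Poly_Mapping.lookup m k) * Poly_Mapping.lookup p m))"
  unfolding partial_deriv_def
  by (rule sum.mono_neutral_left) (use assms in \<open>auto simp: in_keys_iff\<close>)

lemma partial_deriv_0 [simp]: "partial_deriv k 0 = 0"
  by (simp add: partial_deriv_def)

lemma partial_deriv_single: "partial_deriv k (Poly_Mapping.single m c) =
    Poly_Mapping.single (m - Poly_Mapping.single k 1) (of_nat (Poly_Mapping.lookup m k) * c)"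
  by (subst partial_deriv_superset[of "{m}"]) auto

lemma partial_deriv_Const [simp]: "partial_deriv k (Const c) = 0"
  by (simp add: Const_def partial_deriv_single)

lemma partial_deriv_Var [simp]: "partial_deriv k (Var j) = (if j = k then 1 else 0)"
  by (auto simp: Var_def partial_deriv_single lookup_single)

lemma partial_deriv_add [simp]: "partial_deriv k (p + q) = partial_deriv k p + partial_deriv k q"
proof -
  let ?S = "Poly_Mapping.keys p \<union> Poly_Mapping.keys q"
  have "Poly_Mapping.keys (p + q) \<subseteq> ?S" by (rule Poly_Mapping.keys_add)
  then show ?thesis
    by (simp add: partial_deriv_superset[of ?S] lookup_add distrib_left single_add sum.distrib)
qed

lemma partial_deriv_sum: "partial_deriv k (sum f A) = (\<Sum>a\<in>A. partial_deriv k (f a))"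
  by (induction A rule: infinite_finite_induct) auto

lemma partial_deriv_mult:
  fixes p q :: "('v, 'a::comm_ring_1) mpoly"
  shows "partial_deriv k (p * q) = partial_deriv k p * q + p * partial_deriv k q"
proof -
  \<comment> \<open>Subtraction of exponents is truncated, so the two exponents may differ when
    \<open>k\<close> does not occur in \<open>m\<close>; the coefficient \<open>of_nat 0\<close>
    then kills both terms.\<close>
  have shift: "Poly_Mapping.single (m + m' - Poly_Mapping.single k 1) (of_nat (Poly_Mapping.lookup m k) * a)
      = Poly_Mapping.single (m - Poly_Mapping.single k 1 + m') (of_nat (Poly_Mapping.lookup m k) * a)" for m m' :: "'v \<Rightarrow>\<^sub>0 nat" and a :: 'a
  proof (cases "Poly_Mapping.lookup m k = 0")
    case False
    then have "m + m' - Poly_Mapping.single k 1 = m - Poly_Mapping.single k 1 + m'"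
      by (intro poly_mapping_eqI) (auto simp: lookup_minus lookup_add lookup_single when_def)
    then show ?thesis by simp
  qed simp
  have "partial_deriv k (Poly_Mapping.single m c * Poly_Mapping.single m' c') =
      partial_deriv k (Poly_Mapping.single m c) * Poly_Mapping.single m' c'
      + Poly_Mapping.single m c * partial_deriv k (Poly_Mapping.single m' c')"
    for m m' :: "'v \<Rightarrow>\<^sub>0 nat" and c c' :: 'a
    using shift[of m m' "c * c'"] shift[of m' m "c * c'"]
    by (simp add: mult_single partial_deriv_single lookup_add distrib_right distrib_left single_add ac_simps)
  then have "partial_deriv k (Poly_Mapping.single m c * q) =
      partial_deriv k (Poly_Mapping.single m c) * q + Poly_Mapping.single m c * partial_deriv k q" for m c and q :: "('v, 'a) mpoly"
    by (induction q rule: poly_mapping_additive_induct) (auto simp: algebra_simps)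
  then show ?thesis
    by (induction p rule: poly_mapping_additive_induct) (auto simp: algebra_simps)
qed

lemma partial_deriv_Const_mult [simp]: "partial_deriv k (Const c * p) = Const c * partial_deriv k p"
  for c :: "'a::comm_ring_1"
  by (simp add: partial_deriv_mult)

text \<open>Both sides are derivations along \<open>F\<close>, so constants and variables suffice.
  It is the chain rule in the case where only the image of \<open>k\<close> depends on
  \<open>l\<close>; \<open>F\<close> may change constants, as conjugation does.\<close>

lemma partial_deriv_ring_hom:
  fixes F :: "('v, 'a::comm_ring_1) mpoly \<Rightarrow> ('w, 'b::comm_ring_1) mpoly"
  assumes "comm_ring_hom F"
    and "\<And>a. partial_deriv l (F (Const a)) = 0"
    and "\<And>j. partial_deriv l (F (Var j)) = (if j = k then c else 0)"
  shows "partial_deriv l (F p) = c * F (partial_deriv k p)"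
proof -
  interpret comm_ring_hom F by fact
  show ?thesis
    by (induction p rule: mpoly_induct)
       (auto simp: assms(2,3) hom_distribs partial_deriv_mult algebra_simps)
qed


subsection \<open>Minors\<close>

text \<open>Indices are plain natural numbers starting at 0, so rows and columns are chosen by
  composing functions, without carrier conditions.\<close>

definition fdet :: "nat \<Rightarrow> (nat \<Rightarrow> nat \<Rightarrow> 'a::comm_ring_1) \<Rightarrow> 'a" where
  "fdet k A = Determinant.det (Matrix.mat k k (\<lambda>(i, j). A i j))"

lemma minors_eq:
  "minors k M = {fdet k (\<lambda>i j. M (r i) (c j)) | r c. inj_on r {..<k} \<and> inj_on c {..<k}}"
  by (simp add: minors_def fdet_def)

lemma minorsI: "inj_on r {..<k} \<Longrightarrow> inj_on c {..<k} \<Longrightarrow> fdet k (\<lambda>i j. M (r i) (c j)) \<in> minors k M"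
  unfolding minors_eq by blast

lemma fdet_expand:
  "fdet k A = (\<Sum>p | p permutes {0..<k}. signof p * (\<Prod>i=0..<k. A i (p i)))"
proof -
  have "signof p * (\<Prod>i=0..<k. Matrix.mat k k (\<lambda>(i, j). A i j) $$ (i, p i)) =
      signof p * (\<Prod>i=0..<k. A i (p i))" if "p permutes {0..<k}" for p
    using permutes_in_image[OF that] by (intro arg_cong2[of _ _ _ _ "(*)"] prod.cong) auto
  then show ?thesis
    unfolding fdet_def by (subst det_def'[of _ k]) auto
qed

lemma fdet_cong:
  "k = l \<Longrightarrow> (\<And>i j. i < l \<Longrightarrow> j < l \<Longrightarrow> A i j = B i j) \<Longrightarrow> fdet k A = fdet l B"
  unfolding fdet_def by (intro arg_cong[of _ _ Determinant.det] eq_matI) auto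

lemma fdet_transpose: "fdet k (\<lambda>i j. A j i) = fdet k A"
proof -
  have "Matrix.mat k k (\<lambda>(i, j). A j i) = transpose_mat (Matrix.mat k k (\<lambda>(i, j). A i j))"
    by (rule eq_matI) auto
  then show ?thesis
    unfolding fdet_def by (simp add: Determinant.det_transpose[of _ k])
qed

lemma fdet_identical_rows:
  assumes "i < k" "j < k" "i \<noteq> j" "\<And>l. l < k \<Longrightarrow> A i l = A j l"
  shows "fdet k A = 0"
  unfolding fdet_def
  by (rule Determinant.det_identical_rows[of _ k i j]) (use assms in \<open>auto intro!: eq_vecI\<close>)

lemma fdet_permute_rows:
  assumes "p permutes {0..<k}"
  shows "fdet k (\<lambda>i j. A (p i) j) = signof p * fdet k A"
proof -
  have "Matrix.mat k k (\<lambda>(i, j). A (p i) j)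
      = Matrix.mat k k (\<lambda>(i, j). Matrix.mat k k (\<lambda>(i, j). A i j) $$ (p i, j))"
    using permutes_in_image[OF assms] by (intro eq_matI) auto
  then show ?thesis
    unfolding fdet_def by (simp add: Determinant.det_permute_rows[OF _ assms, of "Matrix.mat k k (\<lambda>(i, j). A i j)"])
qed

lemma fdet_permute_cols:
  assumes "p permutes {0..<k}"
  shows "fdet k (\<lambda>i j. A i (p j)) = signof p * fdet k A"
  using fdet_permute_rows[OF assms, of "\<lambda>i j. A j i"]
  by (simp add: fdet_transpose[of k A] fdet_transpose[of k "\<lambda>i j. A i (p j)"])

lemma fdet_scale_rows: "fdet k (\<lambda>i j. h i * A i j) = (\<Prod>i=0..<k. h i) * fdet k A"
  unfolding fdet_expand by (simp add: prod.distrib sum_distrib_left ac_simps)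

lemma fdet_hom:
  assumes "comm_ring_hom \<phi>" shows "\<phi> (fdet k A) = fdet k (\<lambda>i j. \<phi> (A i j))"
proof -
  interpret comm_ring_hom \<phi> by fact
  show ?thesis unfolding fdet_expand by (simp add: hom_distribs)
qed

lemma image_minors:
  assumes "comm_ring_hom \<phi>" shows "\<phi> ` minors k M = minors k (\<lambda>i j. \<phi> (M i j))"
proof (intro equalityI subsetI)
  fix x assume "x \<in> minors k (\<lambda>i j. \<phi> (M i j))"
  then obtain r c where "x = \<phi> (fdet k (\<lambda>i j. M (r i) (c j)))" "inj_on r {..<k}" "inj_on c {..<k}"
    unfolding minors_eq fdet_hom[OF assms] by blast
  then show "x \<in> \<phi> ` minors k M" unfolding minors_eq by blast
next
  fix x assume "x \<in> \<phi> ` minors k M"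
  then obtain r c where "x = \<phi> (fdet k (\<lambda>i j. M (r i) (c j)))" "inj_on r {..<k}" "inj_on c {..<k}"
    unfolding minors_eq by blast
  then show "x \<in> minors k (\<lambda>i j. \<phi> (M i j))" unfolding minors_eq fdet_hom[OF assms] by blast
qed

lemma prod_diff_mem_ideal:
  assumes I: "is_ideal I" and "\<And>i. i \<in> S \<Longrightarrow> a i - b i \<in> I"
  shows "prod a S - prod b S \<in> I"
  using assms(2)
proof (induction S rule: infinite_finite_induct)
  case (insert x F)
  have "a x * prod a F - b x * prod b F = prod a F * (a x - b x) + b x * (prod a F - prod b F)"
    by (simp add: algebra_simps)
  also have "\<dots> \<in> I" using insert by (intro is_ideal_add[OF I] is_ideal_mult[OF I]) auto
  finally show ?case using insert by simp
qed (auto simp: is_ideal_0[OF I])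

lemma fdet_diff_mem_ideal:
  assumes I: "is_ideal I" and "\<And>i j. i < k \<Longrightarrow> j < k \<Longrightarrow> A i j - B i j \<in> I"
  shows "fdet k A - fdet k B \<in> I"
proof -
  have "fdet k A - fdet k B =
      (\<Sum>p | p permutes {0..<k}. signof p * ((\<Prod>i=0..<k. A i (p i)) - (\<Prod>i=0..<k. B i (p i))))"
    unfolding fdet_expand by (simp add: sum_subtractf right_diff_distrib)
  also have "\<dots> \<in> I"
  proof (intro is_ideal_sum[OF I] is_ideal_mult[OF I] prod_diff_mem_ideal[OF I])
    fix p i assume "p \<in> {p. p permutes {0..<k}}" "i \<in> {0..<k}"
    then show "A i (p i) - B i (p i) \<in> I" using assms(2)[of i "p i"] by (auto simp: permutes_in_image)
  qed
  finally show ?thesis .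
qed

text \<open>Multilinearity in the rows, expanded completely: \<open>\<rho>\<close> picks one summand
  in every row. Terms with repeated picks stay in the sum and vanish as determinants with equal
  rows.\<close>

lemma fdet_row_combination:
  assumes "finite S" and A: "\<And>i j. i < k \<Longrightarrow> j < k \<Longrightarrow> A i j = (\<Sum>l\<in>S. Q i l * M l j)"
  shows "fdet k A = (\<Sum>\<rho>\<in>{0..<k} \<rightarrow>\<^sub>E S. (\<Prod>i=0..<k. Q i (\<rho> i)) * fdet k (\<lambda>i j. M (\<rho> i) j))"
proof -
  have "(\<Prod>i=0..<k. A i (p i)) = (\<Sum>\<rho>\<in>{0..<k} \<rightarrow>\<^sub>E S. \<Prod>i=0..<k. Q i (\<rho> i) * M (\<rho> i) (p i))"
    if "p permutes {0..<k}" for p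
  proof -
    have "(\<Prod>i=0..<k. A i (p i)) = (\<Prod>i=0..<k. \<Sum>l\<in>S. Q i l * M l (p i))"
      using permutes_in_image[OF that] by (intro prod.cong A) auto
    also have "\<dots> = (\<Sum>\<rho>\<in>{0..<k} \<rightarrow>\<^sub>E S. \<Prod>i=0..<k. Q i (\<rho> i) * M (\<rho> i) (p i))"
      by (rule prod_sum_PiE) (use \<open>finite S\<close> in auto)
    finally show ?thesis .
  qed
  then have "fdet k A = (\<Sum>p | p permutes {0..<k}. \<Sum>\<rho>\<in>{0..<k} \<rightarrow>\<^sub>E S.
      (\<Prod>i=0..<k. Q i (\<rho> i)) * (signof p * (\<Prod>i=0..<k. M (\<rho> i) (p i))))"
    unfolding fdet_expand by (simp add: sum_distrib_left prod.distrib ac_simps)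
  also have "\<dots> = (\<Sum>\<rho>\<in>{0..<k} \<rightarrow>\<^sub>E S. (\<Prod>i=0..<k. Q i (\<rho> i)) * fdet k (\<lambda>i j. M (\<rho> i) j))"
    unfolding fdet_expand by (subst sum.swap) (simp add: sum_distrib_left)
  finally show ?thesis .
qed

text \<open>A repeated row or column gives determinant 0. Index functions built by deletion or
  concatenation can therefore be used without an injectivity proof.\<close>

lemma fdet_mem_ideal_gen_minors: "fdet k (\<lambda>i j. M (r i) (c j)) \<in> ideal_gen (minors k M)"
proof -
  consider "inj_on r {..<k} \<and> inj_on c {..<k}" | "\<not> inj_on r {..<k}" | "\<not> inj_on c {..<k}" by auto
  then show ?thesis
  proof cases
    case 1
    then show ?thesis by (intro ideal_gen_base) (auto simp: minors_eq)
  next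
    case 2
    then obtain i j where "i < k" "j < k" "i \<noteq> j" "r i = r j" by (auto simp: inj_on_def)
    then have "fdet k (\<lambda>i j. M (r i) (c j)) = 0" by (intro fdet_identical_rows[of i k j]) auto
    then show ?thesis by (simp add: is_ideal_0)
  next
    case 3
    then obtain i j where "i < k" "j < k" "i \<noteq> j" "c i = c j" by (auto simp: inj_on_def)
    then have "fdet k (\<lambda>j i. M (r i) (c j)) = 0" by (intro fdet_identical_rows[of i k j]) auto
    then show ?thesis by (simp add: is_ideal_0 fdet_transpose[of k "\<lambda>i j. M (r i) (c j)"])
  qed
qed

lemma minors_row_combination:
  fixes M :: "'r::finite \<Rightarrow> 'c \<Rightarrow> 'a::comm_ring_1"
  assumes "\<And>i j. N i j = (\<Sum>l\<in>UNIV. Q i l * M l j)"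
  shows "minors k N \<subseteq> ideal_gen (minors k M)"
proof
  fix x assume "x \<in> minors k N"
  then obtain r c where x: "x = fdet k (\<lambda>i j. N (r i) (c j))" by (auto simp: minors_eq)
  show "x \<in> ideal_gen (minors k M)"
    unfolding x
    by (subst fdet_row_combination[of UNIV _ _ "\<lambda>i. Q (r i)" "\<lambda>l j. M l (c j)"])
       (auto simp: assms intro!: is_ideal_sum is_ideal_mult fdet_mem_ideal_gen_minors)
qed

lemma minors_transpose: "minors k (\<lambda>j i. M i j) = minors k M"
proof -
  have "minors k (\<lambda>j i. M i j) \<subseteq> minors k M" for M :: "'x \<Rightarrow> 'y \<Rightarrow> 'z::comm_ring_1"
  proof
    fix x assume "x \<in> minors k (\<lambda>j i. M i j)"
    then obtain c r where "x = fdet k (\<lambda>i j. M (r j) (c i))" "inj_on r {..<k}" "inj_on c {..<k}"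
      unfolding minors_eq by blast
    then show "x \<in> minors k M"
      using fdet_transpose[of k "\<lambda>i j. M (r i) (c j)"] unfolding minors_eq by blast
  qed
  from this[of M] this[of "\<lambda>j i. M i j"] show ?thesis by blast
qed

lemma minors_col_combination:
  fixes M :: "'r \<Rightarrow> 'c::finite \<Rightarrow> 'a::comm_ring_1"
  assumes "\<And>i j. N i j = (\<Sum>l\<in>UNIV. M i l * Q l j)"
  shows "minors k N \<subseteq> ideal_gen (minors k M)"
proof -
  have "minors k (\<lambda>j i. N i j) \<subseteq> ideal_gen (minors k (\<lambda>j i. M i j))"
    by (rule minors_row_combination[of _ "\<lambda>j l. Q l j"]) (simp add: assms mult.commute)
  then show ?thesis unfolding minors_transpose[of k N] minors_transpose[of k M] .
qed

text \<open>By pigeonhole, every choice of \<open>k\<close> rows among fewer than \<open>k\<close>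
  repeats one, so all terms of the expansion vanish.\<close>

lemma fdet_row_combination_eq_0:
  assumes "finite S" "card S < k" "\<And>i j. i < k \<Longrightarrow> j < k \<Longrightarrow> A i j = (\<Sum>l\<in>S. Q i l * M l j)"
  shows "fdet k A = 0"
proof -
  have "fdet k (\<lambda>i j. M (\<rho> i) j) = 0" if \<rho>: "\<rho> \<in> {0..<k} \<rightarrow>\<^sub>E S" for \<rho>
  proof -
    have "\<not> inj_on \<rho> {0..<k}"
    proof
      assume "inj_on \<rho> {0..<k}"
      then have "card {0..<k} \<le> card S" using \<rho> assms(1) by (intro card_inj_on_le[of \<rho>]) auto
      then show False using assms(2) by simp
    qed
    then obtain i j where "i < k" "j < k" "i \<noteq> j" "\<rho> i = \<rho> j" by (auto simp: inj_on_def)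
    then show ?thesis by (intro fdet_identical_rows[of i k j]) auto
  qed
  then show ?thesis by (subst fdet_row_combination[OF assms(1,3)]) auto
qed

text \<open>Laplace expansion along the first column, by induction on the size of the upper block:
  only rows of that block contribute, and deleting one of them leaves the lower right block
  unchanged.\<close>

lemma fdet_block_triangular:
  assumes "\<And>i j. n \<le> i \<Longrightarrow> i < n + m \<Longrightarrow> j < n \<Longrightarrow> A i j = 0"
  shows "fdet (n + m) A = fdet n A * fdet m (\<lambda>i j. A (n + i) (n + j))"
  using assms
proof (induction n arbitrary: A)
  case 0
  have "fdet 0 A = 1" by (simp add: fdet_expand)
  then show ?case by simp
next
  case (Suc n)
  define del where "del i = (\<lambda>i' j'. A (if i' < i then i' else Suc i') (Suc j'))" for i
  have expand: "fdet (Suc k) A = (\<Sum>i<Suc k. A i 0 * ((-1) ^ i * fdet k (del i)))" for k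
  proof -
    have "mat_delete (Matrix.mat (Suc k) (Suc k) (\<lambda>(i, j). A i j)) i 0
        = Matrix.mat k k (\<lambda>(i', j'). del i i' j')" if "i < Suc k" for i
      using that by (intro eq_matI) (auto simp: mat_delete_def del_def)
    then show ?thesis
      unfolding fdet_def by (subst laplace_expansion_column[of _ "Suc k" 0]) (auto simp: cofactor_def intro!: sum.cong)
  qed
  have zero: "A i 0 * ((-1) ^ i * fdet (n + m) (del i)) = 0" if "i \<in> {..<Suc (n + m)} - {..<Suc n}" for i
    using that Suc.prems[of i 0] by simp
  have IH: "fdet (n + m) (del i) = fdet n (del i) * fdet m (\<lambda>i j. A (Suc n + i) (Suc n + j))" if "i < Suc n" for i
  proof -
    have "fdet (n + m) (del i) = fdet n (del i) * fdet m (\<lambda>i' j'. del i (n + i') (n + j'))"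
      by (rule Suc.IH) (use Suc.prems that in \<open>auto simp: del_def\<close>)
    also have "fdet m (\<lambda>i' j'. del i (n + i') (n + j')) = fdet m (\<lambda>i j. A (Suc n + i) (Suc n + j))"
      using that by (intro fdet_cong) (auto simp: del_def)
    finally show ?thesis .
  qed
  have "fdet (Suc n + m) A = (\<Sum>i<Suc (n + m). A i 0 * ((-1) ^ i * fdet (n + m) (del i)))"
    using expand[of "n + m"] by simp
  also have "\<dots> = (\<Sum>i<Suc n. A i 0 * ((-1) ^ i * fdet (n + m) (del i)))"
    by (rule sum.mono_neutral_right) (use zero in auto)
  also have "\<dots> = (\<Sum>i<Suc n. A i 0 * ((-1) ^ i * fdet n (del i))) * fdet m (\<lambda>i j. A (Suc n + i) (Suc n + j))"
    unfolding sum_distrib_right by (rule sum.cong) (auto simp: IH)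
  finally show ?case using expand[of n] by simp
qed

section \<open>Minors of block diagonal matrices\<close>

definition block_diag :: "('r1 \<Rightarrow> 'c1 \<Rightarrow> 'a) \<Rightarrow> ('r2 \<Rightarrow> 'c2 \<Rightarrow> 'a) \<Rightarrow> 'r1 + 'r2 \<Rightarrow> 'c1 + 'c2 \<Rightarrow> 'a::zero" where
  "block_diag M N = case_sum (\<lambda>i. case_sum (M i) (\<lambda>_. 0)) (\<lambda>i. case_sum (\<lambda>_. 0) (N i))"

lemma block_diag_simps [simp]:
  "block_diag M N (Inl i) (Inl j) = M i j" "block_diag M N (Inl i) (Inr j') = 0"
  "block_diag M N (Inr i') (Inl j) = 0" "block_diag M N (Inr i') (Inr j') = N i' j'"
  by (simp_all add: block_diag_def)

lemma sorting_permutation: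
  fixes P :: "nat \<Rightarrow> bool"
  obtains \<sigma> where "\<sigma> permutes {0..<k}" "\<And>i. i < k \<Longrightarrow> P (\<sigma> i) \<longleftrightarrow> i < card {i\<in>{0..<k}. P i}"
proof -
  let ?A = "{i\<in>{0..<k}. P i}" and ?B = "{i\<in>{0..<k}. \<not> P i}"
  define a where "a = card ?A"
  have "k = card (?A \<union> ?B)" by (simp add: Un_def conj_disj_distribL[symmetric])
  then have k: "k = a + card ?B" unfolding a_def by (subst (asm) card_Un_disjoint) auto
  obtain f where f: "bij_betw f {0..<a} ?A" using ex_bij_betw_nat_finite[of ?A] a_def by auto
  have "card {a..<k} = card ?B" using k by simp
  then obtain g where g: "bij_betw g {a..<k} ?B"
    using finite_same_card_bij[of "{a..<k}" ?B] by auto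
  define \<sigma> where "\<sigma> i = (if i < a then f i else if i < k then g i else i)" for i
  have "bij_betw \<sigma> ({0..<a} \<union> {a..<k}) (?A \<union> ?B)"
  proof (rule bij_betw_combine)
    show "bij_betw \<sigma> {0..<a} ?A" using f by (rule bij_betw_cong[THEN iffD1, rotated]) (auto simp: \<sigma>_def)
    show "bij_betw \<sigma> {a..<k} ?B" using g by (rule bij_betw_cong[THEN iffD1, rotated]) (auto simp: \<sigma>_def)
  qed auto
  moreover have "{0..<a} \<union> {a..<k} = {0..<k}" "?A \<union> ?B = {0..<k}" using k by auto
  ultimately have "bij_betw \<sigma> {0..<k} {0..<k}" by simp
  then have 1: "\<sigma> permutes {0..<k}" by (rule bij_imp_permutes) (use k in \<open>auto simp: \<sigma>_def\<close>)
  have 2: "P (\<sigma> i) \<longleftrightarrow> i < a" if "i < k" for i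
    using that bij_betwE[OF f] bij_betwE[OF g] by (auto simp: \<sigma>_def)
  show ?thesis using that[OF 1] 2 a_def by blast
qed

text \<open>Let a minor use \<open>a\<close> rows and \<open>a'\<close> columns of the first block.
  If these numbers differ, each term of the Leibniz expansion contains a zero entry; otherwise
  sorting rows and columns by block makes the matrix block triangular and changes at most the
  sign.\<close>

lemma minors_block_diag:
  assumes "x \<in> minors k (block_diag M N)"
  shows "x = 0 \<or> (\<exists>a b p q. a + b = k \<and> p \<in> minors a M \<and> q \<in> minors b N \<and> (x = p * q \<or> x = - (p * q)))"
proof -
  obtain r c where r: "inj_on r {..<k}" and c: "inj_on c {..<k}"
    and x: "x = fdet k (\<lambda>i j. block_diag M N (r i) (c j))"
    using assms by (auto simp: minors_eq)
  define a where "a = card {i\<in>{0..<k}. isl (r i)}"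
  define a' where "a' = card {i\<in>{0..<k}. isl (c i)}"
  have ak: "a \<le> k" unfolding a_def by (rule order.trans[OF card_mono[of "{0..<k}"]]) auto
  show ?thesis
  proof (cases "a = a'")
    case False
    \<comment> \<open>A nonzero term would make \<open>p\<close> a bijection between the rows and
      the columns of the first block, contradicting \<open>a \<noteq> a'\<close>.\<close>
    have "(\<Prod>i=0..<k. block_diag M N (r i) (c (p i))) = 0" if p: "p permutes {0..<k}" for p
    proof (rule ccontr)
      assume "(\<Prod>i=0..<k. block_diag M N (r i) (c (p i))) \<noteq> 0"
      then have "block_diag M N (r i) (c (p i)) \<noteq> 0" if "i < k" for i
        using that by (metis atLeastLessThan_iff finite_atLeastLessThan le0 prod_zero)
      then have isl: "isl (r i) \<longleftrightarrow> isl (c (p i))" if "i < k" for i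
        using that by (cases "r i"; cases "c (p i)") fastforce+
      have "bij_betw p {i\<in>{0..<k}. isl (r i)} {i\<in>{0..<k}. isl (c i)}"
      proof (rule bij_betw_imageI)
        show "inj_on p {i\<in>{0..<k}. isl (r i)}" using permutes_inj[OF p] by (auto simp: inj_on_def inj_def)
        show "p ` {i\<in>{0..<k}. isl (r i)} = {i\<in>{0..<k}. isl (c i)}"
        proof (intro equalityI subsetI)
          fix y assume y: "y \<in> {i\<in>{0..<k}. isl (c i)}"
          then obtain i where i: "i \<in> {0..<k}" "y = p i" using permutes_image[OF p] by blast
          then show "y \<in> p ` {i\<in>{0..<k}. isl (r i)}" using y isl[of i] by auto
        qed (use isl permutes_in_image[OF p] in auto)
      qed
      then show False using False bij_betw_same_card unfolding a_def a'_def by blast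
    qed
    then show ?thesis unfolding x fdet_expand by simp
  next
    case True
    obtain \<sigma> where \<sigma>: "\<sigma> permutes {0..<k}" "\<And>i. i < k \<Longrightarrow> isl (r (\<sigma> i)) \<longleftrightarrow> i < a"
      using sorting_permutation[of k "\<lambda>i. isl (r i)"] a_def by auto
    obtain \<tau> where \<tau>: "\<tau> permutes {0..<k}" "\<And>i. i < k \<Longrightarrow> isl (c (\<tau> i)) \<longleftrightarrow> i < a"
      using sorting_permutation[of k "\<lambda>i. isl (c i)"] a'_def True by auto
    define b where "b = k - a"
    have k: "k = a + b" using ak b_def by simp
    let ?A = "\<lambda>i j. block_diag M N (r (\<sigma> i)) (c (\<tau> j))"
    have inj: "inj_on (\<lambda>i. r (\<sigma> i)) {..<k}" "inj_on (\<lambda>i. c (\<tau> i)) {..<k}"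
      using comp_inj_on[OF permutes_inj_on[OF \<sigma>(1)], of r] comp_inj_on[OF permutes_inj_on[OF \<tau>(1)], of c]
        r c permutes_image[OF \<sigma>(1)] permutes_image[OF \<tau>(1)]
      by (simp_all add: comp_def lessThan_atLeast0)
    have r1: "r (\<sigma> i) = Inl (projl (r (\<sigma> i)))" if "i < a" for i using that \<sigma>(2)[of i] ak by (cases "r (\<sigma> i)") auto
    have r2: "r (\<sigma> (a + i)) = Inr (projr (r (\<sigma> (a + i))))" if "i < b" for i using that \<sigma>(2)[of "a + i"] k by (cases "r (\<sigma> (a + i))") auto
    have c1: "c (\<tau> i) = Inl (projl (c (\<tau> i)))" if "i < a" for i using that \<tau>(2)[of i] ak by (cases "c (\<tau> i)") auto
    have c2: "c (\<tau> (a + i)) = Inr (projr (c (\<tau> (a + i))))" if "i < b" for i using that \<tau>(2)[of "a + i"] k by (cases "c (\<tau> (a + i))") auto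
    have "fdet k ?A = fdet a ?A * fdet b (\<lambda>i j. ?A (a + i) (a + j))"
      unfolding k
    proof (rule fdet_block_triangular)
      fix i j assume "a \<le> i" "i < a + b" "j < a"
      then show "?A i j = 0" using r2[of "i - a"] c1[of j] by (metis add_diff_inverse_nat block_diag_simps(3) less_diff_conv2 linorder_not_less add.commute)
    qed
    moreover have "fdet a ?A \<in> minors a M"
    proof -
      have "fdet a ?A = fdet a (\<lambda>i j. M (projl (r (\<sigma> i))) (projl (c (\<tau> j))))"
        by (intro fdet_cong refl) (metis block_diag_simps(1) r1 c1)
      moreover have "inj_on (\<lambda>i. projl (r (\<sigma> i))) {..<a}" "inj_on (\<lambda>i. projl (c (\<tau> i))) {..<a}"
        using inj r1 c1 ak unfolding inj_on_def by (metis lessThan_iff order.strict_trans2)+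
      ultimately show ?thesis
        using minorsI[of "\<lambda>i. projl (r (\<sigma> i))" a "\<lambda>i. projl (c (\<tau> i))" M] by simp
    qed
    moreover have "fdet b (\<lambda>i j. ?A (a + i) (a + j)) \<in> minors b N"
    proof -
      have "fdet b (\<lambda>i j. ?A (a + i) (a + j)) = fdet b (\<lambda>i j. N (projr (r (\<sigma> (a + i)))) (projr (c (\<tau> (a + j)))))"
        by (intro fdet_cong refl) (metis block_diag_simps(4) r2 c2)
      moreover have "inj_on (\<lambda>i. projr (r (\<sigma> (a + i)))) {..<b}" "inj_on (\<lambda>i. projr (c (\<tau> (a + i)))) {..<b}"
        using inj r2 c2 k unfolding inj_on_def by (metis add_left_cancel lessThan_iff nat_add_left_cancel_less)+
      ultimately show ?thesis
        using minorsI[of "\<lambda>i. projr (r (\<sigma> (a + i)))" b "\<lambda>i. projr (c (\<tau> (a + i)))" N] by simp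
    qed
    moreover have "fdet k ?A = signof \<sigma> * (signof \<tau> * x)"
      unfolding x using fdet_permute_rows[OF \<sigma>(1), of "\<lambda>i j. block_diag M N (r i) (c (\<tau> j))"]
        fdet_permute_cols[OF \<tau>(1), of "\<lambda>i j. block_diag M N (r i) (c j)"] by simp
    then have "fdet k ?A = x \<or> fdet k ?A = - x"
      by (cases "evenperm \<sigma>"; cases "evenperm \<tau>") (simp_all add: sign_def)
    ultimately show ?thesis using k by (metis minus_minus)
  qed
qed

text \<open>Laplace expansion along the first column writes a minor of size \<open>Suc l\<close>
  through determinants of size \<open>l\<close> of the same matrix.\<close>

lemma minors_subset_ideal_mono:
  assumes I: "is_ideal I" and "minors k M \<subseteq> I" "k \<le> l"
  shows "minors l M \<subseteq> I"
  using assms(3)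
proof (induction l rule: dec_induct)
  case (step l)
  have "fdet (Suc l) (\<lambda>i j. M (r i) (c j)) \<in> I" if "inj_on r {..<Suc l}" "inj_on c {..<Suc l}" for r c
  proof -
    let ?A = "Matrix.mat (Suc l) (Suc l) (\<lambda>(i, j). M (r i) (c j))"
    have "Determinant.det (mat_delete ?A i 0) \<in> I" if i: "i < Suc l" for i
    proof -
      let ?r = "\<lambda>i'. r (if i' < i then i' else Suc i')" and ?c = "\<lambda>j'. c (Suc j')"
      have "mat_delete ?A i 0 = Matrix.mat l l (\<lambda>(i, j). M (?r i) (?c j))"
        using i by (intro eq_matI) (auto simp: mat_delete_def)
      then have "Determinant.det (mat_delete ?A i 0) = fdet l (\<lambda>i j. M (?r i) (?c j))"
        by (simp add: fdet_def)
      moreover have "fdet l (\<lambda>i j. M (?r i) (?c j)) \<in> ideal_gen (minors l M)"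
        by (rule fdet_mem_ideal_gen_minors)
      ultimately show ?thesis using ideal_gen_least[OF I step.IH] by auto
    qed
    then show ?thesis
      unfolding fdet_def
      by (subst laplace_expansion_column[of _ "Suc l" 0])
         (auto simp: cofactor_def simp del: sum.lessThan_Suc intro!: is_ideal_sum[OF I] is_ideal_mult[OF I])
  qed
  then show ?case by (auto simp: minors_eq)
qed (use assms in auto)


subsection \<open>The ring of the product variety\<close>

text \<open>In the coordinates \<open>x\<close>, \<open>y\<close> the variables count as real, so
  this exchanges \<open>x + iy\<close> and \<open>x - iy\<close>: it is what \<open>star\<close>
  becomes on polynomials in \<open>z\<close> and \<open>w\<close>.\<close>

definition conj_poly :: "('v, complex) mpoly \<Rightarrow> ('v, complex) mpoly" where
  "conj_poly = poly_hom (\<lambda>a. Const (cnj a)) Var"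

text \<open>
  If \<open>in_xy\<close> regards \<open>p(z)\<close> as a function on \<open>X \<times> cnj X\<close>, then \<open>in_xyc\<close> regards the
  conjugate polynomial as a function of the second factor.
\<close>

definition in_xyc :: "('n, complex) mpoly \<Rightarrow> ('n + 'n, complex) mpoly" where
  "in_xyc p = conj_poly (in_xy p)"

lemma conj_poly_hom: "comm_ring_hom conj_poly"
  unfolding conj_poly_def by (rule poly_hom_ring_hom[OF Const_cnj_hom])

lemma conj_poly_Const [simp]: "conj_poly (Const c) = Const (cnj c)"
  and conj_poly_Var [simp]: "conj_poly (Var k) = Var k"
  by (simp_all add: conj_poly_def)

lemma in_xy_hom: "comm_ring_hom in_xy"
  by (rule poly_hom_ring_hom[OF Const_hom])

lemma in_xyc_hom: "comm_ring_hom in_xyc"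
  unfolding in_xyc_def by (rule comp_hom[OF conj_poly_hom in_xy_hom])

lemma conj_poly_simps [simp]:
  "conj_poly (p + q) = conj_poly p + conj_poly q" "conj_poly (p * q) = conj_poly p * conj_poly q"
  "conj_poly (p - q) = conj_poly p - conj_poly q" "conj_poly (- p) = - conj_poly p"
proof -
  interpret comm_ring_hom conj_poly by (rule conj_poly_hom)
  show "conj_poly (p + q) = conj_poly p + conj_poly q" "conj_poly (p * q) = conj_poly p * conj_poly q"
    "conj_poly (p - q) = conj_poly p - conj_poly q" "conj_poly (- p) = - conj_poly p"
    by (auto simp: hom_distribs)
qed

lemma Const_minus: "Const (- a) = - Const (a::'a::ab_group_add)"
  by (simp add: Const_def single_uminus)

lemma Const_mult: "Const (a * b) = (Const a * Const b :: ('v, 'a::comm_ring_1) mpoly)"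
  by (simp add: Const_def mult_single)

lemma Const_add: "Const (a + b) = (Const a + Const b :: ('v, 'a::comm_ring_1) mpoly)"
  by (simp add: Const_def single_add)

lemma in_xyc_Var: "in_xyc (Var k) = Var (Inl k) - Const \<i> * Var (Inr k)"
  by (simp add: in_xyc_def Const_minus)

lemma in_xyc_Const: "in_xyc (Const c) = Const (cnj c)"
  by (simp add: in_xyc_def)

lemma poly_at_in_xy: "poly_at (in_xy p) (to_xy (z, w)) = poly_at p z"
proof -
  have "poly_at (in_xy p) (to_xy (z, w)) = poly_hom id (\<lambda>k. poly_at (Var (Inl k) + Const \<i> * Var (Inr k)) (to_xy (z, w))) p"
    by (rule poly_at_poly_hom_Const)
  also have "(\<lambda>k. poly_at (Var (Inl k) + Const \<i> * Var (Inr k)) (to_xy (z, w))) = (\<lambda>k. z $ k)"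
    by (auto simp: to_xy_def vjoin_def field_simps)
  finally show ?thesis by (simp add: poly_at_def id_def)
qed

lemma poly_at_conj_poly: "poly_at (conj_poly p) y = cnj (poly_at p (vcnj y))"
proof (rule ring_hom_mpoly_eqI[OF comp_hom[OF poly_at_hom conj_poly_hom] comp_hom[OF cnj_hom poly_at_hom]])
qed (auto simp: vcnj_def)

lemma vcnj_vcnj [simp]: "vcnj (vcnj z) = z"
  by (simp add: vcnj_def vec_eq_iff)

lemma vcnj_to_xy: "vcnj (to_xy (z, w)) = to_xy (vcnj w, vcnj z)"
proof (rule Finite_Cartesian_Product.vec_eq_iff[THEN iffD2], rule allI)
  fix k :: "'a + 'a"
  show "vcnj (to_xy (z, w)) $ k = to_xy (vcnj w, vcnj z) $ k"
    by (cases k) (simp_all add: vcnj_def to_xy_def vjoin_def field_simps)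
qed

lemma poly_at_in_xyc: "poly_at (in_xyc p) (to_xy (z, w)) = cnj (poly_at p (vcnj w))"
  by (simp add: in_xyc_def poly_at_conj_poly vcnj_to_xy poly_at_in_xy)

section \<open>The ideal of the product variety\<close>

lemma tilde_eq: "tilde X = {to_xy (z, vcnj z') | z z'. z \<in> X \<and> z' \<in> X}"
  by (auto simp: tilde_def)

lemma vanishing_ideal_tilde_iff:
  "p \<in> vanishing_ideal (tilde X) \<longleftrightarrow> (\<forall>z\<in>X. \<forall>z'\<in>X. poly_at p (to_xy (z, vcnj z')) = 0)"
  by (auto simp: vanishing_ideal_def tilde_eq)

text \<open>A representation in the tensor product of the two polynomial rings. It is a list, since
  it is not unique and its length serves as induction measure.\<close>

definition tensor_sum :: "(('n, complex) mpoly \<times> ('n, complex) mpoly) list \<Rightarrow> ('n + 'n, complex) mpoly" where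
  "tensor_sum xs = (\<Sum>(a, b)\<leftarrow>xs. in_xy a * in_xyc b)"

lemma tensor_sum_simps [simp]:
  "tensor_sum [] = 0" "tensor_sum ((a, b) # xs) = in_xy a * in_xyc b + tensor_sum xs"
  "tensor_sum (xs @ ys) = tensor_sum xs + tensor_sum ys"
  by (simp_all add: tensor_sum_def)

lemma tensor_sum_mult: "\<exists>zs. tensor_sum zs = tensor_sum xs * tensor_sum ys"
proof -
  interpret E: comm_ring_hom in_xy by (rule in_xy_hom)
  interpret E': comm_ring_hom in_xyc by (rule in_xyc_hom)
  have 1: "tensor_sum (map (\<lambda>(a', b'). (a * a', b * b')) ys) = in_xy a * in_xyc b * tensor_sum ys" for a b
    by (induction ys) (auto simp: E.hom_mult E'.hom_mult algebra_simps)
  show ?thesis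
  proof (induction xs)
    case (Cons x xs)
    then obtain zs where "tensor_sum zs = tensor_sum xs * tensor_sum ys" by blast
    then have "tensor_sum (map (\<lambda>(a', b'). (fst x * a', snd x * b')) ys @ zs) = tensor_sum (x # xs) * tensor_sum ys"
      by (cases x) (simp add: 1 algebra_simps)
    then show ?case by blast
  qed (auto intro: exI[of _ "[]"])
qed

lemma Var_Inl_eq: "Var (Inl k) = Const (1/2) * (in_xy (Var k) + in_xyc (Var k))"
  and Var_Inr_eq: "Var (Inr k) = Const (- \<i> / 2) * (in_xy (Var k) - in_xyc (Var k))"
proof -
  have "Const (1/2) * (in_xy (Var k) + in_xyc (Var k)) = Const (1/2 + 1/2) * (Var (Inl k) :: ('a + 'a, complex) mpoly)"
    unfolding Const_add by (simp add: in_xyc_Var algebra_simps)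
  then show "Var (Inl k) = Const (1/2) * (in_xy (Var k) + in_xyc (Var k))" by simp
  have "Const (- \<i> / 2) * (in_xy (Var k) - in_xyc (Var k)) = Const (- \<i> / 2 * \<i> + - \<i> / 2 * \<i>) * (Var (Inr k) :: ('a + 'a, complex) mpoly)"
    unfolding Const_add Const_mult by (simp add: in_xyc_Var algebra_simps)
  then show "Var (Inr k) = Const (- \<i> / 2) * (in_xy (Var k) - in_xyc (Var k))" by simp
qed

lemma xy_induct [case_names Const in_xy in_xyc add mult]:
  assumes C: "\<And>c. P (Const c)" and "\<And>k. P (in_xy (Var k))" "\<And>k. P (in_xyc (Var k))"
    and add: "\<And>p q. P p \<Longrightarrow> P q \<Longrightarrow> P (p + q)" and mult: "\<And>p q. P p \<Longrightarrow> P q \<Longrightarrow> P (p * q)"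
  shows "P (p :: ('n + 'n, complex) mpoly)"
proof (induction p rule: mpoly_induct)
  case (Var k)
  have "P (in_xy (Var k) + Const (-1) * in_xyc (Var k))" for k by (intro assms)
  then have diff: "P (in_xy (Var k) - in_xyc (Var k))" for k by (simp add: Const_minus)
  show ?case
  proof (cases k)
    case (Inl j)
    show ?thesis unfolding Inl by (subst Var_Inl_eq) (intro assms)
  next
    case (Inr j)
    show ?thesis unfolding Inr by (subst Var_Inr_eq) (intro assms diff)
  qed
qed (use assms in auto)

lemma tensor_sum_exists: "\<exists>xs. p = tensor_sum xs"
proof (induction p rule: xy_induct)
  interpret E: comm_ring_hom in_xy by (rule in_xy_hom)
  interpret E': comm_ring_hom in_xyc by (rule in_xyc_hom)
  case (Const c)
  show ?case by (rule exI[of _ "[(Const c, 1)]"]) simp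
next
  interpret E': comm_ring_hom in_xyc by (rule in_xyc_hom)
  case (in_xy k)
  show ?case by (rule exI[of _ "[(Var k, 1)]"]) simp
next
  interpret E: comm_ring_hom in_xy by (rule in_xy_hom)
  case (in_xyc k)
  show ?case by (rule exI[of _ "[(1, Var k)]"]) simp
next
  case (add p q)
  then show ?case by (metis tensor_sum_simps(3))
next
  case (mult p q)
  then show ?case by (metis tensor_sum_mult)
qed

lemma poly_at_tensor_sum:
  "poly_at (tensor_sum xs) (to_xy (z, vcnj z')) = (\<Sum>(a, b)\<leftarrow>xs. poly_at a z * cnj (poly_at b z'))"
  by (induction xs) (auto simp: poly_at_in_xy poly_at_in_xyc)

lemma tensor_sum_fix_right:
  "\<exists>q. \<forall>z. poly_at q z = poly_at p (to_xy (z, vcnj z'))"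
proof -
  obtain xs where "p = tensor_sum xs" using tensor_sum_exists by blast
  moreover have "poly_at (\<Sum>(a, b)\<leftarrow>xs. Const (cnj (poly_at b z')) * a) z = (\<Sum>(a, b)\<leftarrow>xs. poly_at a z * cnj (poly_at b z'))" for z
    by (induction xs) (auto simp: mult.commute)
  ultimately show ?thesis by (metis poly_at_tensor_sum)
qed

text \<open>On the slice with fixed \<open>z\<close> the second point enters through its conjugate;
  conjugating the value turns it into a polynomial in \<open>z'\<close>.\<close>

lemma tensor_sum_fix_left:
  "\<exists>q. \<forall>z'. poly_at q z' = cnj (poly_at p (to_xy (z, vcnj z')))"
proof -
  obtain xs where "p = tensor_sum xs" using tensor_sum_exists by blast
  moreover have "poly_at (\<Sum>(a, b)\<leftarrow>xs. Const (cnj (poly_at a z)) * b) z' = cnj (\<Sum>(a, b)\<leftarrow>xs. poly_at a z * cnj (poly_at b z'))" for z'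
    by (induction xs) (auto simp: mult.commute)
  ultimately show ?thesis by (metis poly_at_tensor_sum)
qed

lemma in_xy_in_vanishing_ideal_tilde: "p \<in> vanishing_ideal X \<Longrightarrow> in_xy p \<in> vanishing_ideal (tilde X)"
  and in_xyc_in_vanishing_ideal_tilde: "p \<in> vanishing_ideal X \<Longrightarrow> in_xyc p \<in> vanishing_ideal (tilde X)"
  by (auto simp: vanishing_ideal_tilde_iff poly_at_in_xy poly_at_in_xyc) (auto simp: vanishing_ideal_def)

text \<open>
  Induction on the number of tensors: if some \<open>b\<^sub>0\<close> does not vanish at \<open>z\<^sub>0\<close>, evaluating there
  expresses \<open>a\<^sub>0\<close> modulo the ideal of \<open>X\<close> through the remaining \<open>a\<close>'s.
\<close>

lemma tensor_sum_vanishing: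
  assumes "tensor_sum xs \<in> vanishing_ideal (tilde X)"
  shows "tensor_sum xs \<in> ideal_gen (in_xy ` vanishing_ideal X \<union> in_xyc ` vanishing_ideal X)" (is "_ \<in> ?K")
  using assms
proof (induction "length xs" arbitrary: xs rule: less_induct)
  case less
  interpret E: comm_ring_hom in_xy by (rule in_xy_hom)
  interpret E': comm_ring_hom in_xyc by (rule in_xyc_hom)
  have K: "is_ideal ?K" by simp
  show ?case
  proof (cases "\<forall>(a, b)\<in>set xs. b \<in> vanishing_ideal X")
    case True
    then show ?thesis
    proof (induction xs)
      case Nil
      show ?case using is_ideal_0[OF K] by simp
    next
      case (Cons x xs)
      obtain a b where x: "x = (a, b)" by force
      have "in_xyc b \<in> ?K" using Cons.prems x by (auto intro: ideal_gen_base)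
      then show ?case using Cons x by (auto intro!: is_ideal_add[OF K] is_ideal_mult[OF K])
    qed
  next
    case False
    then obtain a0 b0 where ab: "(a0, b0) \<in> set xs" "b0 \<notin> vanishing_ideal X" by auto
    then obtain z0 where z0: "z0 \<in> X" "poly_at b0 z0 \<noteq> 0" by (auto simp: vanishing_ideal_def)
    obtain ys zs where xs: "xs = ys @ (a0, b0) # zs" using ab(1) by (meson split_list)
    define \<mu> where "\<mu> b = poly_at b z0 / poly_at b0 z0" for b
    define ws where "ws = ys @ zs"
    define u where "u = a0 + (\<Sum>(a, b)\<leftarrow>ws. Const (cnj (\<mu> b)) * a)"
    have sum: "tensor_sum xs = in_xy a0 * in_xyc b0 + tensor_sum ws"
      by (simp add: xs ws_def)
    have u: "u \<in> vanishing_ideal X"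
      unfolding vanishing_ideal_def
    proof safe
      fix z assume z: "z \<in> X"
      have "poly_at (\<Sum>(a, b)\<leftarrow>ws. Const (cnj (\<mu> b)) * a) z * cnj (poly_at b0 z0) =
          (\<Sum>(a, b)\<leftarrow>ws. poly_at a z * cnj (poly_at b z0))" for ws
        using z0 by (induction ws) (auto simp: \<mu>_def field_simps)
      moreover have "poly_at (tensor_sum xs) (to_xy (z, vcnj z0)) = 0"
        using less.prems z z0 by (auto simp: vanishing_ideal_tilde_iff)
      ultimately have "poly_at u z * cnj (poly_at b0 z0) = 0"
        unfolding sum u_def
        by (simp add: poly_at_tensor_sum poly_at_in_xy poly_at_in_xyc distrib_right)
      then show "poly_at u z = 0" using z0 by simp
    qed
    \<comment> \<open>Subtracting \<open>\<mu> b\<close> times \<open>b0\<close> from each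
      \<open>b\<close> moves these terms into the single tensor with factors \<open>u\<close> and
      \<open>b0\<close>. That tensor lies in the ideal, and the list becomes shorter by one.\<close>
    define vs where "vs = map (\<lambda>(a, b). (a, b - Const (\<mu> b) * b0)) ws"
    have vs: "tensor_sum vs + (in_xy (\<Sum>(a, b)\<leftarrow>ws. Const (cnj (\<mu> b)) * a)) * in_xyc b0 = tensor_sum ws"
      unfolding vs_def
      by (induction ws) (auto simp: hom_distribs in_xyc_Const E.hom_add E.hom_mult E'.hom_mult E'.hom_minus algebra_simps)
    then have eq: "tensor_sum xs = in_xyc b0 * in_xy u + tensor_sum vs"
      unfolding sum u_def by (simp add: E.hom_add algebra_simps flip: vs)
    have "in_xy u \<in> vanishing_ideal (tilde X)" by (rule in_xy_in_vanishing_ideal_tilde[OF u])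
    then have "tensor_sum vs \<in> vanishing_ideal (tilde X)"
      using less.prems unfolding eq by (simp add: vanishing_ideal_tilde_iff)
    moreover have "length vs < length xs" by (simp add: vs_def ws_def xs)
    ultimately have "tensor_sum vs \<in> ?K" by (intro less.hyps)
    moreover have "in_xy u \<in> ?K" using u by (auto intro: ideal_gen_base)
    ultimately show ?thesis unfolding eq by (intro is_ideal_add[OF K] is_ideal_mult[OF K])
  qed
qed

lemma vanishing_ideal_tilde:
  "vanishing_ideal (tilde X) = ideal_gen (in_xy ` vanishing_ideal X \<union> in_xyc ` vanishing_ideal X)"
proof
  show "vanishing_ideal (tilde X) \<subseteq> ideal_gen (in_xy ` vanishing_ideal X \<union> in_xyc ` vanishing_ideal X)"
  proof
    fix p assume "p \<in> vanishing_ideal (tilde X)"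
    moreover obtain xs where "p = tensor_sum xs" using tensor_sum_exists by blast
    ultimately show "p \<in> ideal_gen (in_xy ` vanishing_ideal X \<union> in_xyc ` vanishing_ideal X)"
      using tensor_sum_vanishing by simp
  qed
  show "ideal_gen (in_xy ` vanishing_ideal X \<union> in_xyc ` vanishing_ideal X) \<subseteq> vanishing_ideal (tilde X)"
    by (intro ideal_gen_least is_ideal_vanishing)
       (auto intro: in_xy_in_vanishing_ideal_tilde in_xyc_in_vanishing_ideal_tilde)
qed

section \<open>Non-zero-divisors on the product\<close>

lemma prime_idealD: "prime_ideal I \<Longrightarrow> a * b \<in> I \<Longrightarrow> a \<notin> I \<Longrightarrow> b \<in> I"
  by (auto simp: prime_ideal_def)

text \<open>A slice argument: for fixed \<open>z'\<close> the polynomial \<open>p\<close> restricts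
  to some \<open>q\<close> on \<open>X\<close>, and since \<open>a * q\<close> vanishes there,
  primality of the ideal of \<open>X\<close> makes \<open>q\<close> vanish.\<close>

lemma in_xy_nonzerodivisor:
  assumes "prime_ideal (vanishing_ideal X)" "a \<notin> vanishing_ideal X"
    and ap: "in_xy a * p \<in> vanishing_ideal (tilde X)"
  shows "p \<in> vanishing_ideal (tilde X)"
  unfolding vanishing_ideal_tilde_iff
proof safe
  fix z z' assume z: "z \<in> X" "z' \<in> X"
  obtain q where q: "\<And>z. poly_at q z = poly_at p (to_xy (z, vcnj z'))"
    using tensor_sum_fix_right by blast
  have "a * q \<in> vanishing_ideal X"
    using ap z by (auto simp: vanishing_ideal_tilde_iff vanishing_ideal_def[of X] q poly_at_in_xy)
  then have "q \<in> vanishing_ideal X" using assms prime_idealD by blast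
  then show "poly_at p (to_xy (z, vcnj z')) = 0" using z q by (auto simp: vanishing_ideal_def)
qed

lemma in_xyc_nonzerodivisor:
  assumes "prime_ideal (vanishing_ideal X)" "a \<notin> vanishing_ideal X"
    and ap: "in_xyc a * p \<in> vanishing_ideal (tilde X)"
  shows "p \<in> vanishing_ideal (tilde X)"
  unfolding vanishing_ideal_tilde_iff
proof safe
  fix z z' assume z: "z \<in> X" "z' \<in> X"
  obtain q where q: "\<And>z'. poly_at q z' = cnj (poly_at p (to_xy (z, vcnj z')))"
    using tensor_sum_fix_left by blast
  have "a * q \<in> vanishing_ideal X"
    using ap z by (auto simp: vanishing_ideal_tilde_iff vanishing_ideal_def[of X] q poly_at_in_xyc)
  then have "q \<in> vanishing_ideal X" using assms prime_idealD by blast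
  then show "poly_at p (to_xy (z, vcnj z')) = 0" using z q by (auto simp: vanishing_ideal_def)
qed


subsection \<open>Algebraic independence and growth\<close>

text \<open>Gaussian elimination for a homogeneous system with equations \<open>B\<close> and
  unknowns \<open>A\<close>: equation \<open>b\<close> is solved for the unknown \<open>a0\<close>,
  which is substituted into the others.\<close>

lemma nontrivial_linear_relation:
  fixes L :: "'a \<Rightarrow> 'b \<Rightarrow> 'k::field"
  assumes "finite B" "finite A" "card B < card A"
  shows "\<exists>c. (\<exists>a\<in>A. c a \<noteq> 0) \<and> (\<forall>b\<in>B. (\<Sum>a\<in>A. c a * L a b) = 0)"
  using assms
proof (induction B arbitrary: A L rule: finite_induct)
  case empty
  then show ?case by (intro exI[of _ "\<lambda>_. 1"]) (auto simp: card_gt_0_iff)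
next
  case (insert b B)
  show ?case
  proof (cases "\<forall>a\<in>A. L a b = 0")
    case True
    have "card B < card A" using insert.prems insert.hyps by simp
    from insert.IH[OF insert.prems(1) this, of L] show ?thesis using True by auto
  next
    case False
    then obtain a0 where a0: "a0 \<in> A" "L a0 b \<noteq> 0" by blast
    define A' where "A' = A - {a0}"
    have A': "A = insert a0 A'" "a0 \<notin> A'" "finite A'" using a0 insert.prems by (auto simp: A'_def)
    have "card B < card A'" using insert.prems insert.hyps A' by simp
    from insert.IH[OF A'(3) this, of "\<lambda>a b'. L a b' - L a b / L a0 b * L a0 b'"]
    obtain c where c: "\<exists>a\<in>A'. c a \<noteq> 0"
      "\<And>b'. b' \<in> B \<Longrightarrow> (\<Sum>a\<in>A'. c a * (L a b' - L a b / L a0 b * L a0 b')) = 0" by blast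
    define c0 where "c0 = - (\<Sum>a\<in>A'. c a * L a b) / L a0 b"
    define d where "d = c(a0 := c0)"
    have d: "(\<Sum>a\<in>A. d a * L a b') = c0 * L a0 b' + (\<Sum>a\<in>A'. c a * L a b')" for b'
      using A' by (auto simp: d_def intro!: sum.cong)
    have "(\<Sum>a\<in>A. d a * L a b') = 0" if "b' \<in> insert b B" for b'
    proof (cases "b' = b")
      case True
      then show ?thesis unfolding d c0_def using a0 by simp
    next
      case False
      then have "0 = (\<Sum>a\<in>A'. c a * L a b') - (\<Sum>a\<in>A'. c a * L a b) / L a0 b * L a0 b'"
        using c(2)[of b'] that by (simp add: right_diff_distrib sum_subtractf sum_distrib_right sum_divide_distrib mult.assoc)
      then show ?thesis unfolding d c0_def by simp
    qed
    moreover have "\<exists>a\<in>A. d a \<noteq> 0" using c(1) A' by (auto simp: d_def)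
    ultimately show ?thesis by blast
  qed
qed

definition polys_over :: "'v set \<Rightarrow> ('v, 'a::zero) mpoly set" where
  "polys_over B = {p. \<forall>m\<in>Poly_Mapping.keys p. Poly_Mapping.keys m \<subseteq> B}"

text \<open>
  The space \<open>layer N\<close> below has dimension \<open>O(N ^ card B)\<close> modulo \<open>I\<close>. Multiplication by a generator and
  by the common denominator \<open>denom\<close> raises \<open>N\<close> by a constant only, so the \<open>(N + 1) ^ D\<close> products of
  powers of \<open>D\<close> given elements lie, up to a denominator, in a layer of index \<open>O(N)\<close>.
\<close>

locale algebraic_generators =
  fixes I :: "('v, complex) mpoly set" and t :: "'k::finite \<Rightarrow> ('v, complex) mpoly"
    and B :: "'k set" and a :: "'k \<Rightarrow> ('v, complex) mpoly" and m :: "'k \<Rightarrow> nat"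
    and r :: "'k \<Rightarrow> nat \<Rightarrow> ('v, complex) mpoly"
  assumes ideal_I: "is_ideal I"
    and generators: "\<And>P p. (\<And>c. P (Const c)) \<Longrightarrow> (\<And>k. P (t k)) \<Longrightarrow>
      (\<And>p q. P p \<Longrightarrow> P q \<Longrightarrow> P (p + q)) \<Longrightarrow> (\<And>p q. P p \<Longrightarrow> P q \<Longrightarrow> P (p * q)) \<Longrightarrow> P p"
    and over: "\<And>j. j \<notin> B \<Longrightarrow> a j \<in> subst t ` polys_over B"
      "\<And>j i. j \<notin> B \<Longrightarrow> i < m j \<Longrightarrow> r j i \<in> subst t ` polys_over B"
    and degree_pos: "\<And>j. 0 < m j"
    and relation: "\<And>j. j \<notin> B \<Longrightarrow> a j * t j ^ m j - (\<Sum>i<m j. r j i * t j ^ i) \<in> I"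
    and nonzerodivisor: "\<And>j p. j \<notin> B \<Longrightarrow> a j * p \<in> I \<Longrightarrow> p \<in> I"
begin

text \<open>Generators in \<open>B\<close> get exponents up to \<open>N\<close>; for the others the
  relation reduces exponents below \<open>m k\<close>, up to the denominator. So
  \<open>card_exps\<close> is polynomial in \<open>N\<close> of degree
  \<open>card B\<close>.\<close>

definition exps :: "nat \<Rightarrow> ('k \<Rightarrow> nat) set" where
  "exps N = (\<Pi>\<^sub>E k\<in>UNIV. if k \<in> B then {..N} else {..<m k})"

definition power_prod :: "('k \<Rightarrow> nat) \<Rightarrow> ('v, complex) mpoly" where
  "power_prod e = (\<Prod>k\<in>UNIV. t k ^ e k)"

definition layer :: "nat \<Rightarrow> ('v, complex) mpoly set" where
  "layer N = {p. \<exists>c. p - (\<Sum>e\<in>exps N. Const (c e) * power_prod e) \<in> I}"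

lemma finite_exps: "finite (exps N)"
  unfolding exps_def by (intro finite_PiE) auto

lemma card_exps: "card (exps N) = (N + 1) ^ card B * (\<Prod>k\<in>-B. m k)"
proof -
  have "card (exps N) = (\<Prod>k\<in>UNIV. card (if k \<in> B then {..N} else {..<m k}))"
    unfolding exps_def by (rule card_PiE) auto
  also have "\<dots> = (\<Prod>k\<in>B \<union> -B. card (if k \<in> B then {..N} else {..<m k}))" by simp
  also have "\<dots> = (\<Prod>k\<in>B. card (if k \<in> B then {..N} else {..<m k})) * (\<Prod>k\<in>-B. card (if k \<in> B then {..N} else {..<m k}))"
    by (rule prod.union_disjoint) auto
  finally show ?thesis by simp
qed

lemma mem_exps: "e \<in> exps N \<longleftrightarrow> (\<forall>k. if k \<in> B then e k \<le> N else e k < m k)"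
  by (auto simp: exps_def PiE_iff split: if_splits)

lemma exps_mono: "N \<le> N' \<Longrightarrow> exps N \<subseteq> exps N'"
  by (rule subsetI) (metis mem_exps order_trans)

lemma power_prod_upd: "power_prod (e(k := i)) = t k ^ i * power_prod (e(k := 0))"
proof -
  have *: "power_prod (e(k := i)) = t k ^ i * (\<Prod>j\<in>UNIV-{k}. t j ^ (e(k := i)) j)" for i
    unfolding power_prod_def by (subst prod.remove[of UNIV k]) simp_all
  have "(\<Prod>j\<in>UNIV-{k}. t j ^ (e(k := i)) j) = (\<Prod>j\<in>UNIV-{k}. t j ^ (e(k := 0)) j)"
    by (rule prod.cong) auto
  then show ?thesis using *[of 0] *[of i] by simp
qed

lemma ideal_layer: "p \<in> I \<Longrightarrow> p \<in> layer N"
  unfolding layer_def by (auto intro!: exI[of _ "\<lambda>_. 0"])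

lemma layer_add: "p \<in> layer N \<Longrightarrow> q \<in> layer N \<Longrightarrow> p + q \<in> layer N"
proof -
  assume "p \<in> layer N" "q \<in> layer N"
  then obtain c d where "p - (\<Sum>e\<in>exps N. Const (c e) * power_prod e) \<in> I" "q - (\<Sum>e\<in>exps N. Const (d e) * power_prod e) \<in> I"
    by (auto simp: layer_def)
  from is_ideal_add[OF ideal_I this] have "p + q - (\<Sum>e\<in>exps N. Const (c e + d e) * power_prod e) \<in> I"
    by (simp add: Const_add distrib_right sum.distrib algebra_simps)
  then show ?thesis unfolding layer_def by (auto intro!: exI[of _ "\<lambda>e. c e + d e"])
qed

lemma layer_scale: "p \<in> layer N \<Longrightarrow> Const x * p \<in> layer N"
proof -
  assume "p \<in> layer N"
  then obtain c where "p - (\<Sum>e\<in>exps N. Const (c e) * power_prod e) \<in> I"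
    by (auto simp: layer_def)
  from is_ideal_mult[OF ideal_I this, of "Const x"]
  have "Const x * p - (\<Sum>e\<in>exps N. Const (x * c e) * power_prod e) \<in> I"
    by (simp add: Const_mult sum_distrib_left right_diff_distrib mult.assoc)
  then show ?thesis unfolding layer_def by (auto intro!: exI[of _ "\<lambda>e. x * c e"])
qed

lemma layer_sum: "(\<And>i. i \<in> S \<Longrightarrow> f i \<in> layer N) \<Longrightarrow> sum f S \<in> layer N"
  by (induction S rule: infinite_finite_induct)
     (auto intro: layer_add ideal_layer is_ideal_0[OF ideal_I])

lemma power_prod_layer: "e \<in> exps N \<Longrightarrow> power_prod e \<in> layer N"
  unfolding layer_def
proof safe
  assume "e \<in> exps N"
  then have "(\<Sum>e'\<in>exps N. Const (if e' = e then 1 else 0) * power_prod e') = power_prod e"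
    by (subst sum.mono_neutral_right[of _ "{e}"]) (auto simp: finite_exps)
  then show "\<exists>c. power_prod e - (\<Sum>e\<in>exps N. Const (c e) * power_prod e) \<in> I"
    by (intro exI[of _ "\<lambda>e'. if e' = e then 1 else 0"]) (simp add: is_ideal_0[OF ideal_I])
qed

lemma layer_induct [consumes 1, case_names ideal add scale power_prod]:
  assumes "p \<in> layer N"
    and "\<And>p. p \<in> I \<Longrightarrow> P p" "\<And>p q. P p \<Longrightarrow> P q \<Longrightarrow> P (p + q)" "\<And>x p. P p \<Longrightarrow> P (Const x * p)"
    and "\<And>e. e \<in> exps N \<Longrightarrow> P (power_prod e)"
  shows "P p"
proof -
  obtain c where c: "p - (\<Sum>e\<in>exps N. Const (c e) * power_prod e) \<in> I"
    using assms(1) by (auto simp: layer_def)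
  have "P (\<Sum>e\<in>S. Const (c e) * power_prod e)" if "S \<subseteq> exps N" for S
    using that by (induction S rule: infinite_finite_induct)
      (auto intro: assms(3-) assms(2)[OF is_ideal_0[OF ideal_I]])
  then have "P ((p - (\<Sum>e\<in>exps N. Const (c e) * power_prod e)) + (\<Sum>e\<in>exps N. Const (c e) * power_prod e))"
    by (intro assms(3) assms(2)[OF c]) auto
  then show ?thesis by simp
qed

lemma layer_mono: "N \<le> N' \<Longrightarrow> p \<in> layer N \<Longrightarrow> p \<in> layer N'"
  by (rule layer_induct[of p N])
     (auto intro: ideal_layer layer_add layer_scale power_prod_layer dest: exps_mono)

text \<open>The multipliers of degree at most \<open>d\<close> with respect to the layers. The bound
  is uniform in \<open>N\<close>, so degrees add under multiplication.\<close>

definition raises :: "nat \<Rightarrow> ('v, complex) mpoly set" where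
  "raises d = {p. \<forall>N. \<forall>q\<in>layer N. p * q \<in> layer (N + d)}"

lemma raises_mono: "d \<le> d' \<Longrightarrow> p \<in> raises d \<Longrightarrow> p \<in> raises d'"
proof -
  assume "d \<le> d'" and p: "p \<in> raises d"
  then have "p * q \<in> layer (N + d')" if "q \<in> layer N" for N q
    using that layer_mono[of "N + d" "N + d'" "p * q"] by (simp add: raises_def)
  then show "p \<in> raises d'" by (simp add: raises_def)
qed

lemma raises_Const: "Const c \<in> raises 0"
  by (simp add: raises_def layer_scale)

lemma raises_add: "p \<in> raises d \<Longrightarrow> q \<in> raises d \<Longrightarrow> p + q \<in> raises d"
  by (simp add: raises_def distrib_right layer_add)

lemma raises_mult: "p \<in> raises d \<Longrightarrow> q \<in> raises d' \<Longrightarrow> p * q \<in> raises (d + d')"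
proof -
  assume p: "p \<in> raises d" and q: "q \<in> raises d'"
  have "p * q * x \<in> layer (N + (d + d'))" if "x \<in> layer N" for N x
  proof -
    have "q * x \<in> layer (N + d')" using q that by (simp add: raises_def)
    then have "p * (q * x) \<in> layer (N + d' + d)" using p unfolding raises_def by blast
    then show ?thesis by (simp add: ac_simps)
  qed
  then show "p * q \<in> raises (d + d')" by (simp add: raises_def)
qed

lemma raises_generator:
  assumes k: "k \<in> B" shows "t k \<in> raises 1"
  unfolding raises_def
proof safe
  fix N q assume "q \<in> layer N"
  then show "t k * q \<in> layer (N + 1)"
  proof (induction rule: layer_induct)
    case (ideal p)
    then show ?case by (intro ideal_layer is_ideal_mult[OF ideal_I])
  next
    case (power_prod e)
    have "t k * power_prod e = power_prod (e(k := Suc (e k)))"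
      using power_prod_upd[of e k "e k"] power_prod_upd[of e k "Suc (e k)"] by simp
    moreover have "e(k := Suc (e k)) \<in> exps (N + 1)"
      using power_prod k by (auto simp: mem_exps le_SucI split: if_splits)
    ultimately show ?case using power_prod_layer by simp
  qed (auto simp: distrib_left layer_add mult.left_commute layer_scale)
qed

lemma over_raises:
  assumes "p \<in> subst t ` polys_over B" shows "\<exists>d. p \<in> raises d"
proof -
  obtain q where q: "q \<in> polys_over B" "p = subst t q" using assms by blast
  have pow: "\<exists>d. t k ^ n \<in> raises d" if "k \<in> B" for k n
  proof (induction n)
    case 0
    show ?case using raises_Const[of 1] by auto
  next
    case (Suc n)
    then show ?case using raises_mult[OF raises_generator[OF that]] by auto
  qed
  have mono: "\<exists>d. mon_eval t \<mu> \<in> raises d" if "Poly_Mapping.keys \<mu> \<subseteq> B" for \<mu>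
  proof -
    have "\<exists>d. (\<Prod>k\<in>S. t k ^ Poly_Mapping.lookup \<mu> k) \<in> raises d" if "S \<subseteq> B" for S
      using that
    proof (induction S rule: infinite_finite_induct)
      case (insert x F)
      then obtain d d' where "t x ^ Poly_Mapping.lookup \<mu> x \<in> raises d" "(\<Prod>k\<in>F. t k ^ Poly_Mapping.lookup \<mu> k) \<in> raises d'"
        using pow by blast
      from raises_mult[OF this] show ?case using insert.hyps by auto
    qed (use raises_Const[of 1] in auto)
    then show ?thesis unfolding mon_eval_def using that by blast
  qed
  have "\<exists>d. (\<Sum>\<mu>\<in>S. Const (Poly_Mapping.lookup q \<mu>) * mon_eval t \<mu>) \<in> raises d" if "S \<subseteq> Poly_Mapping.keys q" for S
    using that
  proof (induction S rule: infinite_finite_induct)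
    case (insert \<mu> F)
    then have "Poly_Mapping.keys \<mu> \<subseteq> B" using q by (auto simp: polys_over_def)
    then obtain d where "mon_eval t \<mu> \<in> raises d" using mono by blast
    then have "Const (Poly_Mapping.lookup q \<mu>) * mon_eval t \<mu> \<in> raises d" using raises_mult[OF raises_Const] by fastforce
    moreover obtain d' where "(\<Sum>\<mu>\<in>F. Const (Poly_Mapping.lookup q \<mu>) * mon_eval t \<mu>) \<in> raises d'" using insert by auto
    ultimately have "Const (Poly_Mapping.lookup q \<mu>) * mon_eval t \<mu> + (\<Sum>\<mu>\<in>F. Const (Poly_Mapping.lookup q \<mu>) * mon_eval t \<mu>) \<in> raises (max d d')"
      by (intro raises_add) (auto intro: raises_mono[rotated])
    then show ?case using insert by auto
  qed (use raises_Const[of 0] in auto)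
  then show ?thesis unfolding q(2) poly_hom_def mon_eval_def by blast
qed

lemma finite_raises:
  assumes "finite S" "\<And>x. x \<in> S \<Longrightarrow> \<exists>d. f x \<in> raises d"
  shows "\<exists>d. \<forall>x\<in>S. f x \<in> raises d"
  using assms
proof (induction S rule: finite_induct)
  case (insert x F)
  obtain d where "f x \<in> raises d" using insert.prems by blast
  moreover obtain d' where "\<forall>x\<in>F. f x \<in> raises d'" using insert by blast
  ultimately have "\<forall>y\<in>insert x F. f y \<in> raises (max d d')" by (auto intro: raises_mono[rotated])
  then show ?case by blast
qed auto

definition denom :: "('v, complex) mpoly" where
  "denom = (\<Prod>j\<in>-B. a j)"

lemma denom_nonzerodivisor: "denom ^ s * p \<in> I \<Longrightarrow> p \<in> I"
proof -
  have *: "(\<Prod>j\<in>S. a j) * p \<in> I \<Longrightarrow> p \<in> I" if "S \<subseteq> -B" for S p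
    using that
  proof (induction S rule: infinite_finite_induct)
    case (insert x F)
    then show ?case using nonzerodivisor[of x "prod a F * p"] by (auto simp: mult.assoc)
  qed auto
  show "denom ^ s * p \<in> I \<Longrightarrow> p \<in> I"
    by (induction s) (auto simp: denom_def mult.assoc dest: *[OF order.refl])
qed

text \<open>Multiplying the relation of \<open>j\<close> by the leading coefficients of all other
  relations gives every relation the same leading coefficient \<open>denom\<close>. Only finitely
  many coefficients occur, so one \<open>d\<close> bounds their degrees.\<close>

lemma denom_relation:
  obtains d r' where "denom \<in> raises d" "\<And>j i. j \<notin> B \<Longrightarrow> i < m j \<Longrightarrow> r' j i \<in> raises d"
    "\<And>j. j \<notin> B \<Longrightarrow> denom * t j ^ m j - (\<Sum>i<m j. r' j i * t j ^ i) \<in> I"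
proof -
  have "\<exists>d. (\<Prod>j\<in>S. a j) \<in> raises d" if "S \<subseteq> -B" for S
    using that
  proof (induction S rule: infinite_finite_induct)
    case (insert x F)
    then obtain d d' where "a x \<in> raises d" "prod a F \<in> raises d'"
      using over_raises[OF over(1), of x] by auto
    from raises_mult[OF this] show ?case using insert.hyps by auto
  qed (use raises_Const[of 1] in auto)
  note prod = this
  define r' where "r' j i = (\<Prod>j'\<in>-B-{j}. a j') * r j i" for j i
  have "\<exists>d. r' j i \<in> raises d" if "j \<notin> B" "i < m j" for i j
    unfolding r'_def using prod[of "-B-{j}"] over_raises[OF over(2)[OF that]] raises_mult by blast
  then have "\<exists>d. \<forall>x\<in>(SIGMA j:-B. {..<m j}). case_prod r' x \<in> raises d"
    by (intro finite_raises) auto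
  then obtain d where d: "\<And>j i. j \<notin> B \<Longrightarrow> i < m j \<Longrightarrow> r' j i \<in> raises d" by auto
  obtain d' where d': "denom \<in> raises d'" using prod[of "-B"] by (auto simp: denom_def)
  have rel: "denom * t j ^ m j - (\<Sum>i<m j. r' j i * t j ^ i) \<in> I" if "j \<notin> B" for j
  proof -
    have "denom = (\<Prod>j'\<in>-B-{j}. a j') * a j"
      unfolding denom_def using that by (subst prod.remove[of _ j]) (auto simp: mult.commute)
    then have "denom * t j ^ m j - (\<Sum>i<m j. r' j i * t j ^ i)
        = (\<Prod>j'\<in>-B-{j}. a j') * (a j * t j ^ m j - (\<Sum>i<m j. r j i * t j ^ i))"
      by (simp add: r'_def right_diff_distrib sum_distrib_left mult.assoc)
    then show ?thesis using is_ideal_mult[OF ideal_I relation[OF that]] by simp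
  qed
  show ?thesis
    by (rule that[of "max d d'" r']) (use rel raises_mono[OF max.cobounded1 d] raises_mono[OF max.cobounded2 d'] in auto)
qed

text \<open>A generator in \<open>B\<close> only raises an exponent. For \<open>k\<close> outside
  \<open>B\<close> the exponent can overflow to \<open>m k\<close>; then the relation, paid for by
  one factor \<open>denom\<close>, rewrites the power through lower ones.\<close>

lemma denom_generator_layer:
  obtains d where "denom \<in> raises d" "\<And>k. denom * t k \<in> raises d"
proof -
  obtain d r' where d: "denom \<in> raises d" "\<And>j i. j \<notin> B \<Longrightarrow> i < m j \<Longrightarrow> r' j i \<in> raises d"
    "\<And>j. j \<notin> B \<Longrightarrow> denom * t j ^ m j - (\<Sum>i<m j. r' j i * t j ^ i) \<in> I"
    using denom_relation by blast
  have "denom * t k \<in> raises (d + 1)" for k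
  proof (cases "k \<in> B")
    case True
    then show ?thesis using raises_mult[OF d(1) raises_generator] by simp
  next
    case False
    have "denom * t k \<in> raises d"
      unfolding raises_def
    proof safe
      fix N q assume "q \<in> layer N"
      then show "denom * t k * q \<in> layer (N + d)"
      proof (induction rule: layer_induct)
        case (ideal p)
        then show ?case by (intro ideal_layer is_ideal_mult[OF ideal_I])
      next
        case (power_prod e)
        have upd: "e(k := i) \<in> exps N" if "i < m k" for i
          using power_prod False that by (auto simp: mem_exps)
        have tk: "t k * power_prod e = power_prod (e(k := Suc (e k)))"
          using power_prod_upd[of e k "e k"] power_prod_upd[of e k "Suc (e k)"] by simp
        show ?case
        proof (cases "Suc (e k) < m k")
          case True
          then show ?thesis
            using d(1) power_prod_layer[OF upd] unfolding mult.assoc tk raises_def by blast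
        next
          case F: False
          have "e k < m k" using power_prod False by (auto simp: mem_exps)
          then have "Suc (e k) = m k" using F by simp
          then have "denom * t k * power_prod e = denom * t k ^ m k * power_prod (e(k := 0))"
            using tk power_prod_upd[of e k "m k"] by (simp add: mult.assoc)
          also have "\<dots> = (denom * t k ^ m k - (\<Sum>i<m k. r' k i * t k ^ i)) * power_prod (e(k := 0))
              + (\<Sum>i<m k. r' k i * power_prod (e(k := i)))"
            by (subst (3) power_prod_upd) (simp add: left_diff_distrib sum_distrib_right mult.assoc)
          also have "\<dots> \<in> layer (N + d)"
          proof (rule layer_add[OF ideal_layer[OF is_ideal_mult_right[OF ideal_I d(3)[OF False]]] layer_sum])
            fix i assume "i \<in> {..<m k}"
            then show "r' k i * power_prod (e(k := i)) \<in> layer (N + d)"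
              using d(2)[OF False, of i] power_prod_layer[OF upd[of i]] unfolding raises_def by blast
          qed
          finally show ?thesis .
        qed
      next
        case (scale x p)
        then show ?case using layer_scale[of "denom * t k * p" _ x] by (simp add: ac_simps)
      qed (auto simp: distrib_left layer_add)
    qed
    then show ?thesis by (rule raises_mono[rotated]) simp
  qed
  then show ?thesis using that[of "d + 1"] raises_mono[OF _ d(1), of "d + 1"] by auto
qed

definition rate :: nat where
  "rate = (SOME d. denom \<in> raises d \<and> (\<forall>k. denom * t k \<in> raises d))"

lemma denom_raises: "denom \<in> raises rate"
  and denom_generator_raises: "denom * t k \<in> raises rate"
proof -
  have "\<exists>d. denom \<in> raises d \<and> (\<forall>k. denom * t k \<in> raises d)"
    using denom_generator_layer by blast
  from someI_ex[OF this] show "denom \<in> raises rate" "denom * t k \<in> raises rate"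
    unfolding rate_def by auto
qed

text \<open>Clearing \<open>s\<close> denominators leaves a multiplier of degree
  \<open>rate * s\<close>. Denominators and layer indices are counted by the same \<open>s\<close>,
  so both grow only linearly with the number of factors in a product.\<close>

definition filtration :: "nat \<Rightarrow> ('v, complex) mpoly set" where
  "filtration s = {p. denom ^ s * p \<in> raises (rate * s)}"

lemma filtration_mono:
  assumes "s \<le> s'" "p \<in> filtration s" shows "p \<in> filtration s'"
proof -
  have "p \<in> filtration (s + n)" for n
  proof (induction n)
    case (Suc n)
    then show ?case using raises_mult[OF denom_raises, of "denom ^ (s + n) * p" "rate * (s + n)"]
      by (simp add: filtration_def mult.assoc)
  qed (use assms in simp)
  from this[of "s' - s"] show ?thesis using assms(1) by simp
qed

lemma filtration_mult: "p \<in> filtration s \<Longrightarrow> q \<in> filtration s' \<Longrightarrow> p * q \<in> filtration (s + s')"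
  using raises_mult[of "denom ^ s * p" "rate * s" "denom ^ s' * q" "rate * s'"]
  by (simp add: filtration_def power_add distrib_left distrib_right ac_simps)

lemma filtration_1: "1 \<in> filtration 0"
  using raises_Const[of 1] by (simp add: filtration_def)

lemma filtration_exhaustive: "\<exists>s. p \<in> filtration s"
proof (induction p rule: generators)
  show "\<exists>s. Const c \<in> filtration s" for c
    by (rule exI[of _ 0]) (simp add: filtration_def raises_Const)
  show "\<exists>s. t k \<in> filtration s" for k
    by (rule exI[of _ 1]) (simp add: filtration_def denom_generator_raises)
  show "\<exists>s. p * q \<in> filtration s" if "\<exists>s. p \<in> filtration s" "\<exists>s. q \<in> filtration s" for p q
    using that filtration_mult by blast
  show "\<exists>s. p + q \<in> filtration s" if pq: "\<exists>s. p \<in> filtration s" "\<exists>s. q \<in> filtration s" for p q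
  proof -
    obtain s s' where "p \<in> filtration s" "q \<in> filtration s'" using pq by blast
    then have "p \<in> filtration (max s s')" "q \<in> filtration (max s s')"
      by (auto intro: filtration_mono[rotated])
    then have "p + q \<in> filtration (max s s')"
      by (simp add: filtration_def distrib_left raises_add)
    then show ?thesis by blast
  qed
qed

lemma filtration_layer: "p \<in> filtration s \<Longrightarrow> denom ^ s * p \<in> layer (rate * s)"
proof -
  have "1 \<in> layer 0"
    using power_prod_layer[of "\<lambda>_. 0" 0] degree_pos by (simp add: power_prod_def mem_exps)
  then show "p \<in> filtration s \<Longrightarrow> denom ^ s * p \<in> layer (rate * s)"
    unfolding filtration_def raises_def by fastforce
qed

text \<open>If there are more monomials in the \<open>g i\<close> than elements of
  \<open>exps M\<close>, linear algebra gives a relation among their multiples by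
  \<open>denom ^ s\<close>. The common factor can be cancelled, and what remains is an algebraic
  relation of the \<open>g i\<close> modulo \<open>I\<close>.\<close>

lemma filtration_dependence:
  assumes ind: "algebraically_independent_mod I D g"
    and F: "\<And>e. e \<in> {..<D} \<rightarrow>\<^sub>E {..N} \<Longrightarrow> denom ^ s * (\<Prod>i<D. g i ^ e i) \<in> layer M"
  shows "(N + 1) ^ D \<le> card (exps M)"
proof (rule ccontr)
  let ?A = "{..<D} \<rightarrow>\<^sub>E {..N}"
  assume "\<not> ?thesis"
  moreover have "card ?A = (N + 1) ^ D" by (subst card_PiE) auto
  ultimately have card: "card (exps M) < card ?A" by simp
  have "\<forall>e\<in>?A. \<exists>c. denom ^ s * (\<Prod>i<D. g i ^ e i) - (\<Sum>x\<in>exps M. Const (c x) * power_prod x) \<in> I"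
    using F unfolding layer_def by blast
  from bchoice[OF this] obtain c where
    c: "\<And>e. e \<in> ?A \<Longrightarrow> denom ^ s * (\<Prod>i<D. g i ^ e i) - (\<Sum>x\<in>exps M. Const (c e x) * power_prod x) \<in> I"
    by blast
  have fin: "finite ?A" by (intro finite_PiE) auto
  obtain l where l: "\<exists>e\<in>?A. l e \<noteq> 0" "\<And>x. x \<in> exps M \<Longrightarrow> (\<Sum>e\<in>?A. l e * c e x) = 0"
    using nontrivial_linear_relation[OF finite_exps fin card, of c] by blast
  have "denom ^ s * (\<Sum>e\<in>?A. Const (l e) * (\<Prod>i<D. g i ^ e i)) =
      (\<Sum>e\<in>?A. Const (l e) * (denom ^ s * (\<Prod>i<D. g i ^ e i) - (\<Sum>x\<in>exps M. Const (c e x) * power_prod x)))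
      + (\<Sum>x\<in>exps M. Const (\<Sum>e\<in>?A. l e * c e x) * power_prod x)" (is "_ = ?S + _")
  proof -
    interpret C: comm_ring_hom "Const :: complex \<Rightarrow> ('v, complex) mpoly" by (rule Const_hom)
    have "(\<Sum>x\<in>exps M. Const (\<Sum>e\<in>?A. l e * c e x) * power_prod x)
        = (\<Sum>e\<in>?A. Const (l e) * (\<Sum>x\<in>exps M. Const (c e x) * power_prod x))"
      unfolding C.hom_sum sum_distrib_right sum_distrib_left Const_mult
      by (subst sum.swap) (simp add: mult.assoc)
    then show ?thesis
      by (simp add: right_diff_distrib sum_subtractf sum_distrib_left mult.left_commute)
  qed
  also have "\<dots> = ?S" by (simp add: l(2))
  also have "\<dots> \<in> I" by (intro is_ideal_sum[OF ideal_I] is_ideal_mult[OF ideal_I] c)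
  finally have "(\<Sum>e\<in>?A. Const (l e) * (\<Prod>i<D. g i ^ e i)) \<in> I"
    by (rule denom_nonzerodivisor)
  define \<mu> where "\<mu> e = (\<Sum>i<D. Poly_Mapping.single i (e i))" for e :: "nat \<Rightarrow> nat"
  have lookup: "Poly_Mapping.lookup (\<mu> e) i = (if i < D then e i else 0)" for e i
    by (auto simp: \<mu>_def lookup_sum lookup_single when_def)
  define p where "p = (\<Sum>e\<in>?A. Poly_Mapping.single (\<mu> e) (l e))"
  have keys: "Poly_Mapping.keys (\<mu> e) \<subseteq> {..<D}" for e by (auto simp: in_keys_iff lookup split: if_splits)
  interpret S: comm_ring_hom "subst g" by (rule poly_hom_ring_hom[OF Const_hom])
  have "subst g p = (\<Sum>e\<in>?A. Const (l e) * (\<Prod>i<D. g i ^ e i))"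
    by (simp add: p_def S.hom_sum poly_hom_single mon_eval_superset[OF _ keys] lookup)
  also have "\<dots> \<in> I" by fact
  finally have "subst g p \<in> I" .
  moreover have "\<forall>m\<in>Poly_Mapping.keys p. Poly_Mapping.keys m \<subseteq> {..<D}"
  proof
    fix x assume "x \<in> Poly_Mapping.keys p"
    then have "\<exists>e. x = \<mu> e"
      unfolding p_def by (auto dest!: Poly_Mapping.keys_sum[THEN subsetD] split: if_splits)
    then show "Poly_Mapping.keys x \<subseteq> {..<D}" using keys by blast
  qed
  ultimately have "p = 0" using ind unfolding algebraically_independent_mod_def by blast
  obtain e where e: "e \<in> ?A" "l e \<noteq> 0" using l(1) by blast
  \<comment> \<open>Distinct exponent vectors give distinct monomials, so the nonzero coefficient
    \<open>l e\<close> survives in \<open>p\<close>.\<close>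
  have "e' = e" if "e' \<in> ?A" "\<mu> e' = \<mu> e" for e'
  proof (rule PiE_ext[OF that(1) e(1)])
    fix i assume "i \<in> {..<D}"
    then show "e' i = e i" using lookup[of e i] lookup[of e' i] that(2) by simp
  qed
  then have "Poly_Mapping.lookup p (\<mu> e) = (\<Sum>e'\<in>{e}. l e')"
    unfolding p_def lookup_sum lookup_single when_def
    by (intro sum.mono_neutral_cong_right fin) (use e in auto)
  then show False using \<open>p = 0\<close> e by simp
qed

text \<open>If \<open>D\<close> exceeded \<open>card B\<close>, the bound
  \<open>(N + 1) ^ D \<le> C * (N + 1) ^ card B\<close> would fail for large
  \<open>N\<close>.\<close>

lemma algebraically_independent_le:
  assumes ind: "algebraically_independent_mod I D g"
  shows "D \<le> card B"
proof (rule ccontr)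
  assume D: "\<not> ?thesis"
  have "\<forall>i. \<exists>s. g i \<in> filtration s" using filtration_exhaustive by blast
  from choice[OF this] obtain s where s: "\<And>i. g i \<in> filtration (s i)" by blast
  \<comment> \<open>The sum is a common filtration degree for all \<open>g i\<close> with
    \<open>i < D\<close>.\<close>
  define E where "E = (\<Sum>i<D. s i)"
  have gE: "g i \<in> filtration E" if "i < D" for i
    unfolding E_def by (rule filtration_mono[OF _ s[of i]]) (use that in \<open>simp add: member_le_sum\<close>)
  have pow: "p ^ n \<in> filtration (E * n)" if "p \<in> filtration E" for p n
    by (induction n) (use filtration_1 filtration_mult[OF that] in auto)
  have prod: "(\<Prod>i\<in>S. g i ^ e i) \<in> filtration (\<Sum>i\<in>S. E * e i)" if "S \<subseteq> {..<D}" for S e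
    using that by (induction S rule: infinite_finite_induct) (use filtration_1 in \<open>auto intro!: filtration_mult pow gE\<close>)
  \<comment> \<open>\<open>N\<close> is taken out of the layer index by
    \<open>rate * (D * E * N) + 1 \<le> (rate * (D * E) + 1) * (N + 1)\<close>; \<open>C\<close>
    collects what does not depend on \<open>N\<close>.\<close>
  define C where "C = (rate * (D * E) + 1) ^ card B * (\<Prod>k\<in>-B. m k)"
  have bound: "(N + 1) ^ D \<le> C * (N + 1) ^ card B" for N
  proof -
    have "denom ^ (D * E * N) * (\<Prod>i<D. g i ^ e i) \<in> layer (rate * (D * E * N))" if e: "e \<in> {..<D} \<rightarrow>\<^sub>E {..N}" for e
    proof (rule filtration_layer, rule filtration_mono[OF _ prod])
      have "(\<Sum>i<D. E * e i) \<le> (\<Sum>i<D. E * N)"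
        using e by (intro sum_mono mult_left_mono) auto
      then show "(\<Sum>i<D. E * e i) \<le> D * E * N" by (simp add: mult.assoc)
    qed simp
    from filtration_dependence[OF ind this]
    have "(N + 1) ^ D \<le> (rate * (D * E * N) + 1) ^ card B * (\<Prod>k\<in>-B. m k)"
      unfolding card_exps by simp
    also have "\<dots> \<le> ((rate * (D * E) + 1) * (N + 1)) ^ card B * (\<Prod>k\<in>-B. m k)"
      by (intro mult_right_mono power_mono) (auto simp: algebra_simps)
    also have "\<dots> = C * (N + 1) ^ card B"
      by (simp only: C_def power_mult_distrib ac_simps)
    finally show ?thesis .
  qed
  \<comment> \<open>The bound is used at \<open>N = C\<close>, where a single surplus factor
    \<open>C + 1\<close> already exceeds \<open>C\<close>.\<close>
  have "(C + 1) * (C + 1) ^ card B \<le> (C + 1) ^ D"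
    using power_increasing[of "Suc (card B)" D "C + 1"] D by simp
  also have "\<dots> \<le> C * (C + 1) ^ card B" by (rule bound)
  finally show False by simp
qed

end


subsection \<open>Transcendence bases\<close>

lemma polys_over_mono: "A \<subseteq> B \<Longrightarrow> polys_over A \<subseteq> polys_over B"
  by (auto simp: polys_over_def)

lemma polys_over_UNIV [simp]: "polys_over UNIV = UNIV"
  by (simp add: polys_over_def)

lemma polys_over_Const [simp]: "Const c \<in> polys_over A"
  by (simp add: polys_over_def Const_def)

lemma polys_over_1 [simp]: "(1 :: ('v, 'a::comm_ring_1) mpoly) \<in> polys_over A"
  unfolding Const_1[symmetric] by (rule polys_over_Const)

lemma polys_over_single: "Poly_Mapping.keys m \<subseteq> A \<Longrightarrow> Poly_Mapping.single m c \<in> polys_over A"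
  by (simp add: polys_over_def)

lemma polys_over_Var: "k \<in> A \<Longrightarrow> Var k \<in> polys_over A"
  by (simp add: polys_over_def Var_def)

lemma polys_over_0 [simp]: "0 \<in> polys_over A"
  by (simp add: polys_over_def)

lemma polys_over_add: "p \<in> polys_over A \<Longrightarrow> q \<in> polys_over A \<Longrightarrow> p + q \<in> polys_over A"
  using Poly_Mapping.keys_add[of p q] by (auto simp: polys_over_def)

lemma polys_over_mult: "p \<in> polys_over A \<Longrightarrow> q \<in> polys_over A \<Longrightarrow> p * q \<in> polys_over A"
  for p :: "('v, 'a::comm_ring_1) mpoly"
proof -
  assume pq: "p \<in> polys_over A" "q \<in> polys_over A"
  have "Poly_Mapping.keys m \<subseteq> A" if m: "m \<in> Poly_Mapping.keys (p * q)" for m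
  proof -
    obtain m1 m2 where "m1 \<in> Poly_Mapping.keys p" "m2 \<in> Poly_Mapping.keys q" "m = m1 + m2"
      using subsetD[OF Poly_Mapping.keys_mult m] by blast
    then show ?thesis using pq Poly_Mapping.keys_add[of m1 m2] unfolding polys_over_def by blast
  qed
  then show ?thesis by (simp add: polys_over_def)
qed

lemma polys_over_uminus: "p \<in> polys_over A \<Longrightarrow> - p \<in> polys_over A"
  for p :: "('v, 'a::comm_ring_1) mpoly"
  using polys_over_mult[OF polys_over_Const[of "-1"], of p A] by (simp add: Const_minus)

lemma polys_over_diff: "p \<in> polys_over A \<Longrightarrow> q \<in> polys_over A \<Longrightarrow> p - q \<in> polys_over A"
  for p :: "('v, 'a::comm_ring_1) mpoly"
  using polys_over_add[OF _ polys_over_uminus, of p A q] by simp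

lemma polys_over_sum: "(\<And>i. i \<in> S \<Longrightarrow> f i \<in> polys_over A) \<Longrightarrow> sum f S \<in> polys_over A"
  by (induction S rule: infinite_finite_induct) (auto intro: polys_over_add)

lemma polys_over_power: "p \<in> polys_over A \<Longrightarrow> p ^ n \<in> polys_over A"
  for p :: "('v, 'a::comm_ring_1) mpoly"
  by (induction n) (auto intro: polys_over_mult)

lemma polys_over_prod: "(\<And>i. i \<in> S \<Longrightarrow> f i \<in> polys_over A) \<Longrightarrow> prod f S \<in> polys_over A"
  for f :: "'i \<Rightarrow> ('v, 'a::comm_ring_1) mpoly"
  by (induction S rule: infinite_finite_induct) (auto intro: polys_over_mult)

lemma poly_hom_polys_over:
  fixes \<phi> :: "'a::zero \<Rightarrow> ('w, 'b::comm_ring_1) mpoly"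
  assumes "p \<in> polys_over B" "\<And>c. \<phi> c \<in> polys_over A" "\<And>k. k \<in> B \<Longrightarrow> x k \<in> polys_over A"
  shows "poly_hom \<phi> x p \<in> polys_over A"
  unfolding poly_hom_def
  by (intro polys_over_sum polys_over_mult polys_over_prod polys_over_power assms)
     (use assms(1) in \<open>auto simp: polys_over_def\<close>)

lemma subst_inj_Var:
  fixes p :: "('v, 'a::comm_ring_1) mpoly"
  assumes "inj_on b S" "p \<in> polys_over S" "subst (\<lambda>i. Var (b i)) p = 0"
  shows "p = 0"
proof -
  have "subst (\<lambda>v. Var (inv_into S b v)) (subst (\<lambda>i. Var (b i)) p)
      = poly_hom Const (\<lambda>i. Var (inv_into S b (b i))) p"
    by (subst hom_poly_hom[OF Const_hom poly_hom_ring_hom[OF Const_hom]]) simp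
  also have "\<dots> = poly_hom Const Var p"
  proof (rule poly_hom_cong)
    fix k m assume "m \<in> Poly_Mapping.keys p" "k \<in> Poly_Mapping.keys m"
    then have "k \<in> S" using assms(2) by (auto simp: polys_over_def)
    then show "Var (inv_into S b (b k)) = (Var k :: ('v, 'a) mpoly)" using assms(1) by simp
  qed
  finally have "p = subst (\<lambda>v. Var (inv_into S b v)) 0" using assms(3) by simp
  then show ?thesis by (simp add: poly_hom_def)
qed

text \<open>Reads \<open>p\<close> as a univariate polynomial in \<open>Var j\<close>, so that
  degrees in \<open>j\<close> become available. The coefficients stay in the full polynomial ring,
  and \<open>poly\<close> evaluates inside that ring.\<close>

lemma polys_over_insert:
  fixes p :: "('v, 'a::comm_ring_1) mpoly"
  assumes "p \<in> polys_over (insert j A)"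
  obtains P where "\<And>i. coeff P i \<in> polys_over A" "p = poly P (Var j)"
proof -
  define m' where "m' m = m - Poly_Mapping.single j (Poly_Mapping.lookup m j)" for m :: "'v \<Rightarrow>\<^sub>0 nat"
  have keys: "Poly_Mapping.keys (m' m) \<subseteq> A" if "m \<in> Poly_Mapping.keys p" for m
  proof
    fix k assume "k \<in> Poly_Mapping.keys (m' m)"
    then have "k \<noteq> j" "k \<in> Poly_Mapping.keys m"
      by (auto simp: m'_def in_keys_iff lookup_minus lookup_single when_def split: if_splits)
    then show "k \<in> A" using assms that by (auto simp: polys_over_def)
  qed
  define P where "P = (\<Sum>m\<in>Poly_Mapping.keys p. Polynomial.monom (Poly_Mapping.single (m' m) (Poly_Mapping.lookup p m)) (Poly_Mapping.lookup m j))"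
  have "Poly_Mapping.single m c = Poly_Mapping.single (m' m) c * Var j ^ Poly_Mapping.lookup m j" for m and c :: 'a
  proof -
    have "m = m' m + Poly_Mapping.single j (Poly_Mapping.lookup m j)"
      by (rule poly_mapping_eqI) (auto simp: m'_def lookup_add lookup_minus lookup_single when_def)
    then have "mon_eval Var m = (mon_eval Var (m' m) * Var j ^ Poly_Mapping.lookup m j :: ('v, 'a) mpoly)"
      by (metis mon_eval_add mon_eval_single)
    then show ?thesis by (simp add: single_eq_Const_mult_mon mult.assoc)
  qed
  then have "(\<Sum>m\<in>Poly_Mapping.keys p. Poly_Mapping.single m (Poly_Mapping.lookup p m)) =
      (\<Sum>m\<in>Poly_Mapping.keys p. Poly_Mapping.single (m' m) (Poly_Mapping.lookup p m) * Var j ^ Poly_Mapping.lookup m j)"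
    by (intro sum.cong refl)
  with poly_mapping_sum_single[of p]
  have "p = (\<Sum>m\<in>Poly_Mapping.keys p. Poly_Mapping.single (m' m) (Poly_Mapping.lookup p m) * Var j ^ Poly_Mapping.lookup m j)"
    by (rule trans)
  also have "\<dots> = poly P (Var j)"
    by (simp add: P_def poly_sum poly_monom)
  finally have "p = poly P (Var j)" .
  moreover have "coeff P i \<in> polys_over A" for i
    unfolding P_def coeff_sum coeff_monom by (intro polys_over_sum) (simp add: polys_over_single keys)
  ultimately show ?thesis using that by blast
qed

lemma prime_ideal_ideal: "prime_ideal I \<Longrightarrow> is_ideal I"
  by (simp add: prime_ideal_def)

lemma prime_ideal_1: "prime_ideal I \<Longrightarrow> 1 \<notin> I"
  using is_ideal_mult[of I 1] by (auto simp: prime_ideal_def)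

lemma prime_ideal_prod:
  assumes "prime_ideal I" "\<And>i. i \<in> S \<Longrightarrow> h i \<notin> I" shows "prod h S \<notin> I"
  using assms(2)
proof (induction S rule: infinite_finite_induct)
  case (insert x F)
  then show ?case using prime_idealD[OF assms(1), of "h x" "prod h F"] by auto
qed (use prime_ideal_1[OF assms(1)] in auto)

text \<open>A transcendence basis of the coordinate ring chosen among the coordinates themselves.
  Maximality is asked for one added variable at a time, which yields one relation per remaining
  variable.\<close>

definition variable_basis :: "('v, complex) mpoly set \<Rightarrow> 'v set \<Rightarrow> bool" where
  "variable_basis I B \<longleftrightarrow> I \<inter> polys_over B \<subseteq> {0} \<and>
     (\<forall>j. j \<notin> B \<longrightarrow> (\<exists>p\<in>I \<inter> polys_over (insert j B). p \<noteq> 0))"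

lemma variable_basis_exists:
  fixes I :: "('v::finite, complex) mpoly set"
  assumes "prime_ideal I"
  obtains B where "variable_basis I B"
proof -
  let ?\<B> = "{B. I \<inter> polys_over B \<subseteq> {0}}"
  \<comment> \<open>Without variables \<open>p\<close> is constant, and a nonzero constant in
    \<open>I\<close> would be a unit; so the empty set is admissible and a maximal set
    exists.\<close>
  have "p = 0" if p: "p \<in> I" "p \<in> polys_over {}" for p
  proof (rule ccontr)
    assume "p \<noteq> 0"
    have "Poly_Mapping.keys p \<subseteq> {0}" using p(2) by (auto simp: polys_over_def)
    then have "p = Const (Poly_Mapping.lookup p 0)"
      by (intro poly_mapping_eqI) (auto simp: Const_def lookup_single when_def in_keys_iff)
    then obtain c where c: "p = Const c" "c \<noteq> 0" using \<open>p \<noteq> 0\<close> by (metis Const_0)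
    have "Const (inverse c) * p \<in> I" using p is_ideal_mult prime_ideal_ideal[OF assms] by blast
    moreover have "Const (inverse c) * p = 1" using c by (simp flip: Const_mult)
    ultimately show False using prime_ideal_1[OF assms] by simp
  qed
  then have "{} \<in> ?\<B>" by blast
  then obtain B where B: "B \<in> ?\<B>" "\<And>B'. B' \<in> ?\<B> \<Longrightarrow> B \<subseteq> B' \<Longrightarrow> B = B'"
    using finite_has_maximal[of ?\<B>] by auto
  have "\<exists>p\<in>I \<inter> polys_over (insert j B). p \<noteq> 0" if "j \<notin> B" for j
    using B(2)[of "insert j B"] that by blast
  then show ?thesis using that B(1) by (auto simp: variable_basis_def)
qed

text \<open>A nonzero polynomial over \<open>B\<close> lies outside \<open>I\<close>; this applies
  to the leading coefficient and excludes degree 0.\<close>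

lemma variable_basis_relation:
  assumes "variable_basis I B" "j \<notin> B"
  obtains P where "\<And>i. coeff P i \<in> polys_over B" "poly P (Var j) \<in> I"
    "lead_coeff P \<notin> I" "0 < degree P"
proof -
  obtain p where p: "p \<in> I" "p \<in> polys_over (insert j B)" "p \<noteq> 0"
    using assms by (auto simp: variable_basis_def)
  obtain P where P: "\<And>i. coeff P i \<in> polys_over B" "p = poly P (Var j)"
    using polys_over_insert[OF p(2)] by blast
  have "lead_coeff P \<noteq> 0" using P(2) p(3) by auto
  then have lc: "lead_coeff P \<notin> I" using assms P(1) by (auto simp: variable_basis_def)
  have "0 < degree P"
  proof (rule ccontr)
    assume "\<not> 0 < degree P"
    then have "p = lead_coeff P" unfolding P(2) by (simp add: poly_altdef)
    then show False using lc p(1) by simp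
  qed
  then show ?thesis using that P p(1) lc by blast
qed

lemma variable_basis_relations:
  assumes "variable_basis I B"
  obtains a :: "'v \<Rightarrow> ('v, complex) mpoly" and m r where
    "\<And>j. j \<notin> B \<Longrightarrow> a j \<in> polys_over B" "\<And>j i. j \<notin> B \<Longrightarrow> r j i \<in> polys_over B" "\<And>j. 0 < m j"
    "\<And>j. j \<notin> B \<Longrightarrow> a j * Var j ^ m j - (\<Sum>i<m j. r j i * Var j ^ i) \<in> I"
    "\<And>j. j \<notin> B \<Longrightarrow> a j \<notin> I"
proof -
  have "\<forall>j. \<exists>P. j \<notin> B \<longrightarrow> (\<forall>i. coeff P i \<in> polys_over B) \<and> poly P (Var j) \<in> I \<and>
      lead_coeff P \<notin> I \<and> 0 < degree P"
    using variable_basis_relation[OF assms] by metis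
  from choice[OF this] obtain P where P: "\<And>j i. j \<notin> B \<Longrightarrow> coeff (P j) i \<in> polys_over B"
    "\<And>j. j \<notin> B \<Longrightarrow> poly (P j) (Var j) \<in> I" "\<And>j. j \<notin> B \<Longrightarrow> lead_coeff (P j) \<notin> I"
    "\<And>j. j \<notin> B \<Longrightarrow> 0 < degree (P j)" by blast
  show ?thesis
  \<comment> \<open>Degree 1 is a default on \<open>B\<close>, for which no relation is chosen; it
    keeps \<open>m\<close> positive everywhere.\<close>
  proof (rule that[of "\<lambda>j. lead_coeff (P j)" "\<lambda>j i. - coeff (P j) i" "\<lambda>j. if j \<in> B then 1 else degree (P j)"])
    fix j assume j: "j \<notin> B"
    have "lead_coeff (P j) * Var j ^ degree (P j) - (\<Sum>i<degree (P j). - coeff (P j) i * Var j ^ i)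
        = poly (P j) (Var j)"
      unfolding poly_altdef by (simp add: lessThan_Suc_atMost[symmetric] sum_negf)
    then show "lead_coeff (P j) * Var j ^ (if j \<in> B then 1 else degree (P j))
        - (\<Sum>i<(if j \<in> B then 1 else degree (P j)). - coeff (P j) i * Var j ^ i) \<in> I"
      using P(2)[OF j] j by simp
  qed (use P in \<open>auto intro: polys_over_uminus\<close>)
qed


subsection \<open>Dimension of the product\<close>

lemma algebraically_independent_basis:
  assumes "finite S" and *: "\<And>q. q \<in> polys_over S \<Longrightarrow> subst t q \<in> I \<Longrightarrow> q = 0"
  shows "\<exists>g. algebraically_independent_mod I (card S) g"
proof -
  obtain b where b: "bij_betw b {..<card S} S"
    using ex_bij_betw_nat_finite[OF assms(1)] by (auto simp: lessThan_atLeast0)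
  have "p = 0" if p: "\<forall>m\<in>Poly_Mapping.keys p. Poly_Mapping.keys m \<subseteq> {..<card S}" "subst (\<lambda>i. t (b i)) p \<in> I" for p :: "(nat, complex) mpoly"
  proof -
    let ?q = "subst (\<lambda>i. Var (b i)) p"
    have p': "p \<in> polys_over {..<card S}" using p(1) by (simp add: polys_over_def)
    have "subst t ?q = subst (\<lambda>i. t (b i)) p"
      by (subst hom_poly_hom[OF Const_hom poly_hom_ring_hom[OF Const_hom]]) simp
    moreover have "?q \<in> polys_over S"
      by (rule poly_hom_polys_over[OF p']) (use bij_betwE[OF b] in \<open>auto intro: polys_over_Var\<close>)
    ultimately have "?q = 0" using p(2) * by simp
    then show "p = 0" using subst_inj_Var p' bij_betw_imp_inj_on[OF b] by blast
  qed
  then show ?thesis unfolding algebraically_independent_mod_def by blast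
qed

text \<open>\<open>GREATEST\<close> needs a bound for arbitrary independent polynomials, not just
  for coordinates; the growth estimate gives it, and primality makes each \<open>a j\<close> a
  non-zero-divisor.\<close>

lemma variety_dim_eq_card_basis:
  fixes X :: "(complex ^ 'n) set"
  assumes prime: "prime_ideal (vanishing_ideal X)" and B: "variable_basis (vanishing_ideal X) B"
  shows "variety_dim X = card B"
  unfolding variety_dim_def
proof (rule Greatest_equality)
  let ?I = "vanishing_ideal X"
  show "\<exists>g. algebraically_independent_mod ?I (card B) g"
    by (rule algebraically_independent_basis[of B Var]) (use B in \<open>auto simp: variable_basis_def\<close>)
  obtain a m r where rel: "\<And>j. j \<notin> B \<Longrightarrow> a j \<in> polys_over B" "\<And>j i. j \<notin> B \<Longrightarrow> r j i \<in> polys_over B" "\<And>j. 0 < m j"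
    "\<And>j. j \<notin> B \<Longrightarrow> a j * Var j ^ m j - (\<Sum>i<m j. r j i * Var j ^ i) \<in> ?I" "\<And>j. j \<notin> B \<Longrightarrow> a j \<notin> ?I"
    by (rule variable_basis_relations[OF B]) blast
  interpret algebraic_generators ?I Var B a m r
  proof
    show "P p" if "\<And>c. P (Const c)" "\<And>k. P (Var k)" "\<And>p q. P p \<Longrightarrow> P q \<Longrightarrow> P (p + q)" "\<And>p q. P p \<Longrightarrow> P q \<Longrightarrow> P (p * q)"
      for P :: "('n, complex) mpoly \<Rightarrow> bool" and p by (rule mpoly_induct[of P, OF that])
    show "p \<in> ?I" if "j \<notin> B" "a j * p \<in> ?I" for j p
      using prime_idealD[OF prime that(2)] rel(5)[OF that(1)] by blast
  qed (use rel is_ideal_vanishing in auto)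
  show "y \<le> card B" if "\<exists>g. algebraically_independent_mod ?I y g" for y
    using that algebraically_independent_le by blast
qed

text \<open>The functions \<open>z\<close> and \<open>w\<close> on the space with coordinates
  \<open>x\<close>, \<open>y\<close>. \<open>subst zw_gen\<close> is the ring automorphism that
  rewrites polynomials in \<open>z\<close>, \<open>w\<close> in terms of \<open>x\<close>,
  \<open>y\<close>.\<close>

definition zw_gen :: "'n + 'n \<Rightarrow> ('n + 'n, complex) mpoly" where
  "zw_gen = case_sum (\<lambda>k. in_xy (Var k)) (\<lambda>k. in_xyc (Var k))"

lemma zw_gen_simps [simp]: "zw_gen (Inl k) = in_xy (Var k)" "zw_gen (Inr k) = in_xyc (Var k)"
  by (simp_all add: zw_gen_def)

lemma in_xy_eq_subst_zw: "in_xy p = subst zw_gen (subst (\<lambda>k. Var (Inl k)) p)"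
  by (rule ring_hom_mpoly_eqI[OF in_xy_hom comp_hom[OF poly_hom_ring_hom[OF Const_hom] poly_hom_ring_hom[OF Const_hom]]])
    simp_all

lemma in_xyc_eq_subst_zw: "in_xyc p = subst zw_gen (poly_hom (\<lambda>a. Const (cnj a)) (\<lambda>k. Var (Inr k)) p)"
  by (rule ring_hom_mpoly_eqI[OF in_xyc_hom comp_hom[OF poly_hom_ring_hom[OF Const_hom] poly_hom_ring_hom[OF Const_cnj_hom]]])
    (simp_all add: in_xyc_Const)

lemma mon_eval_case_sum:
  fixes m :: "('a::finite + 'b::finite) \<Rightarrow>\<^sub>0 nat"
  shows "mon_eval x m = mon_eval (\<lambda>k. x (Inl k)) (Poly_Mapping.map_key Inl m) * mon_eval (\<lambda>k. x (Inr k)) (Poly_Mapping.map_key Inr m)"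
proof -
  have "mon_eval x m = (\<Prod>k\<in>Inl ` UNIV \<union> Inr ` UNIV. x k ^ Poly_Mapping.lookup m k)"
    by (rule mon_eval_superset) (auto simp: UNIV_sum[symmetric])
  also have "\<dots> = (\<Prod>k\<in>UNIV. x (Inl k) ^ Poly_Mapping.lookup m (Inl k)) * (\<Prod>k\<in>UNIV. x (Inr k) ^ Poly_Mapping.lookup m (Inr k))"
    by (subst prod.union_disjoint) (auto simp: prod.reindex)
  finally show ?thesis
    by (simp add: mon_eval_superset[of UNIV] map_key.rep_eq)
qed

lemma poly_at_single: "poly_at (Poly_Mapping.single m c) y = c * mon_eval (\<lambda>k. y $ k) m"
  by (simp add: poly_at_def poly_hom_single)

text \<open>Independence of \<open>B\<close> is used twice. For fixed \<open>z'\<close> a polynomial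
  in \<open>z\<close> over \<open>B\<close> vanishes on \<open>X\<close>, so each of its
  coefficients is 0; such a coefficient is a conjugate polynomial in \<open>z'\<close>, to which the
  same applies.\<close>

lemma zw_gen_independent:
  fixes X :: "(complex ^ 'n) set"
  assumes B: "variable_basis (vanishing_ideal X) B"
    and q: "q \<in> polys_over (Inl ` B \<union> Inr ` B)" and van: "subst zw_gen q \<in> vanishing_ideal (tilde X)"
  shows "q = 0"
proof (rule ccontr)
  assume "q \<noteq> 0"
  then obtain m0 where m0: "m0 \<in> Poly_Mapping.keys q" by (metis all_not_in_conv keys_eq_empty)
  let ?L = "Poly_Mapping.map_key Inl :: ('n + 'n \<Rightarrow>\<^sub>0 nat) \<Rightarrow> _" and ?R = "Poly_Mapping.map_key Inr :: ('n + 'n \<Rightarrow>\<^sub>0 nat) \<Rightarrow> _"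
  let ?c = "Poly_Mapping.lookup q"
  have keys: "Poly_Mapping.keys (?L m) \<subseteq> B" "Poly_Mapping.keys (?R m) \<subseteq> B" if "m \<in> Poly_Mapping.keys q" for m
    using q that by (force simp: polys_over_def keys_map_key)+
  have val0: "(\<Sum>m\<in>Poly_Mapping.keys q. ?c m * mon_eval (\<lambda>k. z $ k) (?L m) * mon_eval (\<lambda>k. cnj (z' $ k)) (?R m)) = 0"
    if z: "z \<in> X" "z' \<in> X" for z z'
  proof -
    have "poly_at (zw_gen (Inl k)) (to_xy (z, vcnj z')) = z $ k"
      "poly_at (zw_gen (Inr k)) (to_xy (z, vcnj z')) = cnj (z' $ k)" for k
      unfolding zw_gen_simps poly_at_in_xy poly_at_in_xyc by simp_all
    then have "poly_at (subst zw_gen q) (to_xy (z, vcnj z')) = 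
        (\<Sum>m\<in>Poly_Mapping.keys q. ?c m * mon_eval (\<lambda>k. z $ k) (?L m) * mon_eval (\<lambda>k. cnj (z' $ k)) (?R m))"
      unfolding poly_at_poly_hom_Const
      by (subst poly_hom_superset[OF _ finite_keys order.refl]) (simp_all add: mon_eval_case_sum mult.assoc del: zw_gen_simps)
    then show ?thesis using van z by (simp add: vanishing_ideal_tilde_iff)
  qed
  have zero: "p = 0" if "\<And>z. z \<in> X \<Longrightarrow> poly_at p z = 0" "p \<in> polys_over B" for p
  proof -
    have "p \<in> vanishing_ideal X" using that(1) by (simp add: vanishing_ideal_def)
    then show ?thesis using B that(2) unfolding variable_basis_def by blast
  qed
  let ?\<mu> = "?L m0"
  \<comment> \<open>The monomials of \<open>q\<close> that share the \<open>z\<close>-part of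
    \<open>m0\<close>; together they form one coefficient.\<close>
  define S where "S = {m\<in>Poly_Mapping.keys q. ?L m = ?\<mu>}"
  have S: "(\<Sum>m\<in>S. ?c m * mon_eval (\<lambda>k. cnj (z' $ k)) (?R m)) = 0" if "z' \<in> X" for z'
  proof -
    define p where "p = (\<Sum>m\<in>Poly_Mapping.keys q. Poly_Mapping.single (?L m) (?c m * mon_eval (\<lambda>k. cnj (z' $ k)) (?R m)))"
    have "p = 0"
      by (rule zero) (use val0 that in \<open>auto simp: p_def poly_at_single mult_ac intro!: polys_over_sum polys_over_single keys\<close>)
    then have "0 = Poly_Mapping.lookup p ?\<mu>" by simp
    also have "\<dots> = (\<Sum>m\<in>S. ?c m * mon_eval (\<lambda>k. cnj (z' $ k)) (?R m))"
      unfolding p_def lookup_sum lookup_single when_def S_def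
      by (rule sum.mono_neutral_cong_right) auto
    finally show ?thesis by simp
  qed
  \<comment> \<open>The coefficients are conjugated because \<open>z'\<close> enters through its
    conjugate.\<close>
  define p where "p = (\<Sum>m\<in>S. Poly_Mapping.single (?R m) (cnj (?c m)))"
  have "p = 0"
  proof (rule zero)
    fix z assume "z \<in> X"
    have "cnj (mon_eval (\<lambda>k. cnj (z $ k)) \<nu>) = mon_eval (\<lambda>k. z $ k) \<nu>" for \<nu>
      by (simp add: mon_eval_def)
    then have "poly_at p z = cnj (\<Sum>m\<in>S. ?c m * mon_eval (\<lambda>k. cnj (z $ k)) (?R m))"
      by (simp add: p_def poly_at_single)
    then show "poly_at p z = 0" using S[OF \<open>z \<in> X\<close>] by simp
  qed (auto simp: p_def S_def intro!: polys_over_sum polys_over_single keys)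
  have inj: "m = m0" if "?L m = ?L m0" "?R m = ?R m0" for m
  proof (rule poly_mapping_eqI)
    fix k
    have "Poly_Mapping.lookup (?L m) i = Poly_Mapping.lookup (?L m0) i" "Poly_Mapping.lookup (?R m) i = Poly_Mapping.lookup (?R m0) i" for i
      using that by simp_all
    then show "Poly_Mapping.lookup m k = Poly_Mapping.lookup m0 k"
      by (cases k) (auto simp: map_key.rep_eq)
  qed
  have "finite S" "m0 \<in> S" using m0 by (auto simp: S_def)
  then have "Poly_Mapping.lookup p (?R m0) = (\<Sum>m\<in>{m0}. cnj (?c m))"
    unfolding p_def lookup_sum lookup_single when_def
    by (intro sum.mono_neutral_cong_right) (use inj in \<open>auto simp: S_def\<close>)
  then show False using \<open>p = 0\<close> m0 by (simp add: in_keys_iff)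
qed

text \<open>Each factor contributes one copy of \<open>B\<close> and one copy of the relations of
  \<open>X\<close>, transported along \<open>in_xy\<close> or \<open>in_xyc\<close>; the slice
  argument keeps the leading coefficients non-zero-divisors.\<close>

lemma variety_dim_tilde:
  fixes X :: "(complex ^ 'n) set"
  assumes prime: "prime_ideal (vanishing_ideal X)" and B: "variable_basis (vanishing_ideal X) B"
  shows "variety_dim (tilde X) = 2 * card B"
  unfolding variety_dim_def
proof (rule Greatest_equality)
  let ?I = "vanishing_ideal X" and ?K = "vanishing_ideal (tilde X)" and ?B = "Inl ` B \<union> Inr ` B"
  have card: "card ?B = 2 * card B"
    by (subst card_Un_disjoint) (auto simp: card_image)
  show "\<exists>g. algebraically_independent_mod ?K (2 * card B) g"
    unfolding card[symmetric] by (rule algebraically_independent_basis[of ?B zw_gen]) (auto intro: zw_gen_independent[OF B])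
  obtain a m r where rel: "\<And>j. j \<notin> B \<Longrightarrow> a j \<in> polys_over B" "\<And>j i. j \<notin> B \<Longrightarrow> r j i \<in> polys_over B" "\<And>j. 0 < m j"
    "\<And>j. j \<notin> B \<Longrightarrow> a j * Var j ^ m j - (\<Sum>i<m j. r j i * Var j ^ i) \<in> ?I" "\<And>j. j \<notin> B \<Longrightarrow> a j \<notin> ?I"
    by (rule variable_basis_relations[OF B]) blast
  let ?a = "case_sum (\<lambda>j. in_xy (a j)) (\<lambda>j. in_xyc (a j))"
  let ?m = "case_sum m m"
  let ?r = "case_sum (\<lambda>j i. in_xy (r j i)) (\<lambda>j i. in_xyc (r j i))"
  interpret E: comm_ring_hom in_xy by (rule in_xy_hom)
  interpret E': comm_ring_hom in_xyc by (rule in_xyc_hom)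
  have over1: "in_xy p \<in> subst zw_gen ` polys_over ?B" if "p \<in> polys_over B" for p
    unfolding in_xy_eq_subst_zw
    by (intro imageI poly_hom_polys_over[OF that]) (auto intro: polys_over_Var)
  have over2: "in_xyc p \<in> subst zw_gen ` polys_over ?B" if "p \<in> polys_over B" for p
    unfolding in_xyc_eq_subst_zw
    by (intro imageI poly_hom_polys_over[OF that]) (auto intro: polys_over_Var)
  interpret algebraic_generators ?K zw_gen ?B ?a ?m ?r
  proof
    show "is_ideal ?K" by (rule is_ideal_vanishing)
    show "P p" if "\<And>c. P (Const c)" "\<And>k. P (zw_gen k)" "\<And>p q. P p \<Longrightarrow> P q \<Longrightarrow> P (p + q)" "\<And>p q. P p \<Longrightarrow> P q \<Longrightarrow> P (p * q)"
      for P p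
      by (rule xy_induct[of P, OF that(1) _ _ that(3,4)])
        (use that(2)[of "Inl _"] that(2)[of "Inr _"] in \<open>simp_all only: zw_gen_simps\<close>)
    show "?a j \<in> subst zw_gen ` polys_over ?B" if "j \<notin> ?B" for j
      using that by (cases j) (auto intro!: over1 over2 rel(1))
    show "?r j i \<in> subst zw_gen ` polys_over ?B" if "j \<notin> ?B" for j i
      using that by (cases j) (auto intro!: over1 over2 rel(2))
    show "0 < ?m j" for j using rel(3) by (cases j) auto
    show "?a j * zw_gen j ^ ?m j - (\<Sum>i<?m j. ?r j i * zw_gen j ^ i) \<in> ?K" if "j \<notin> ?B" for j
    proof (cases j)
      case (Inl k)
      then show ?thesis using in_xy_in_vanishing_ideal_tilde[OF rel(4)[of k]] that
        by (auto simp: E.hom_minus E.hom_mult E.hom_power E.hom_sum)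
    next
      case (Inr k)
      then show ?thesis using in_xyc_in_vanishing_ideal_tilde[OF rel(4)[of k]] that
        by (auto simp: E'.hom_minus E'.hom_mult E'.hom_power E'.hom_sum)
    qed
    show "p \<in> ?K" if "j \<notin> ?B" "?a j * p \<in> ?K" for j p
    proof (cases j)
      case (Inl k)
      then have "k \<notin> B" "in_xy (a k) * p \<in> ?K" using that by auto
      then show ?thesis using in_xy_nonzerodivisor[OF prime rel(5)] by blast
    next
      case (Inr k)
      then have "k \<notin> B" "in_xyc (a k) * p \<in> ?K" using that by auto
      then show ?thesis using in_xyc_nonzerodivisor[OF prime rel(5)] by blast
    qed
  qed
  show "y \<le> 2 * card B" if "\<exists>g. algebraically_independent_mod ?K y g" for y
    using that algebraically_independent_le card by metis
qed

lemma codim_tilde: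
  fixes X :: "(complex ^ 'n) set"
  assumes "prime_ideal (vanishing_ideal X)"
  shows "codim (tilde X) = 2 * codim X"
proof -
  obtain B where "variable_basis (vanishing_ideal X) B" using variable_basis_exists[OF assms] .
  then show ?thesis
    using variety_dim_eq_card_basis[OF assms] variety_dim_tilde[OF assms] by (simp add: codim_def)
qed


subsection \<open>The rank of the Jacobian\<close>

lemma ideal_gen_image_finite:
  assumes "finite S" "x \<in> ideal_gen (G ` S)"
  obtains q where "x = (\<Sum>j\<in>S. q j * G j)"
proof -
  let ?L = "{x. \<exists>q. x = (\<Sum>j\<in>S. q j * G j)}"
  have "is_ideal ?L"
  proof (rule is_idealI)
    show "0 \<in> ?L" by (auto intro: exI[of _ "\<lambda>_. 0"])
    show "x + y \<in> ?L" if xy: "x \<in> ?L" "y \<in> ?L" for x y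
    proof -
      obtain q q' where "x = (\<Sum>j\<in>S. q j * G j)" "y = (\<Sum>j\<in>S. q' j * G j)" using xy by blast
      then have "x + y = (\<Sum>j\<in>S. (q j + q' j) * G j)" by (simp add: sum.distrib distrib_right)
      then show ?thesis by (intro CollectI exI[of _ "\<lambda>j. q j + q' j"])
    qed
    show "c * x \<in> ?L" if x: "x \<in> ?L" for c x
    proof -
      obtain q where "x = (\<Sum>j\<in>S. q j * G j)" using x by blast
      then have "c * x = (\<Sum>j\<in>S. (c * q j) * G j)" by (simp add: sum_distrib_left mult.assoc)
      then show ?thesis by (intro CollectI exI[of _ "\<lambda>j. c * q j"])
    qed
  qed
  moreover have "G ` S \<subseteq> ?L"
  proof safe
    fix k assume "k \<in> S"
    then have "G k = (\<Sum>j\<in>S. (if j = k then 1 else 0) * G j)"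
      using assms(1) by (subst sum.mono_neutral_right[of _ "{k}"]) auto
    then show "\<exists>q. G k = (\<Sum>j\<in>S. q j * G j)" by (intro exI[of _ "\<lambda>j. if j = k then 1 else 0"])
  qed
  ultimately show ?thesis using ideal_gen_least[of ?L "G ` S"] assms(2) that by blast
qed

text \<open>Takes the least degree among the relations over \<open>A\<close> with some coefficient
  outside \<open>I\<close>. A leading coefficient in \<open>I\<close> could be dropped together with
  its term, which would lower the degree.\<close>

lemma minimal_relation:
  assumes prime: "prime_ideal I" and ex: "\<And>i. coeff P0 i \<in> polys_over A"
    "poly P0 z \<in> I" "coeff P0 i0 \<notin> I"
  obtains P where "\<And>i. coeff P i \<in> polys_over A" "poly P z \<in> I" "lead_coeff P \<notin> I"
    "\<And>Q i. (\<And>i. coeff Q i \<in> polys_over A) \<Longrightarrow> poly Q z \<in> I \<Longrightarrow>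
      degree Q < degree P \<Longrightarrow> coeff Q i \<in> I"
proof -
  note I = prime_ideal_ideal[OF prime]
  define good where "good P \<longleftrightarrow> (\<forall>i. coeff P i \<in> polys_over A) \<and> poly P z \<in> I \<and>
    (\<exists>i. coeff P i \<notin> I)" for P
  have "good P0" using ex by (auto simp: good_def)
  then obtain P where P: "good P" "\<And>Q. good Q \<Longrightarrow> degree P \<le> degree Q"
    using ex_has_least_nat[of good P0 Polynomial.degree] by blast
  have "lead_coeff P \<notin> I"
  proof
    assume lc: "lead_coeff P \<in> I"
    define Q where "Q = P - Polynomial.monom (lead_coeff P) (degree P)"
    have coeff: "coeff Q i = (if i = degree P then 0 else coeff P i)" for i
      by (simp add: Q_def coeff_monom)
    obtain i where i: "coeff P i \<notin> I" using P(1) by (auto simp: good_def)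
    then have "i \<noteq> degree P" using lc by auto
    moreover have "i \<le> degree P" using i is_ideal_0[OF I] by (metis coeff_eq_0 linorder_not_le)
    ultimately have pos: "0 < degree P" by simp
    have "coeff Q i \<notin> I" using i \<open>i \<noteq> _\<close> by (simp add: coeff)
    moreover have "poly Q z = poly P z - lead_coeff P * z ^ degree P"
      by (simp add: Q_def poly_monom)
    then have "poly Q z \<in> I"
      using P(1) is_ideal_diff[OF I] is_ideal_mult_right[OF I lc] by (simp add: good_def)
    moreover have "\<forall>i. coeff Q i \<in> polys_over A" using P(1) by (auto simp: good_def coeff)
    ultimately have "good Q" unfolding good_def by blast
    moreover have "degree Q \<le> degree P - 1"
      by (rule degree_le) (use pos in \<open>auto simp: coeff coeff_eq_0\<close>)
    ultimately show False using P(2)[of Q] pos by simp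
  qed
  then show ?thesis
    using that[of P] P unfolding good_def by (meson linorder_not_le)
qed

text \<open>Multiplying by the leading coefficient of \<open>P\<close> takes the place of division;
  since \<open>I\<close> is prime, the accumulated multiplier stays outside \<open>I\<close>. Below
  the degree of \<open>P\<close> all coefficients lie in \<open>I\<close>, and the hypothesis on
  polynomials over \<open>A\<close> handles them one by one.\<close>

lemma pseudo_division:
  assumes prime: "prime_ideal I" and J: "is_ideal J"
    and P: "\<And>i. coeff P i \<in> polys_over A" "poly P z \<in> I" "poly P z \<in> J" "lead_coeff P \<notin> I"
      "\<And>Q i. (\<And>i. coeff Q i \<in> polys_over A) \<Longrightarrow> poly Q z \<in> I \<Longrightarrow>
      degree Q < degree P \<Longrightarrow> coeff Q i \<in> I"
    and A: "\<And>f. f \<in> I \<Longrightarrow> f \<in> polys_over A \<Longrightarrow> \<exists>h. h \<notin> I \<and> h * f \<in> J"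
    and F: "\<And>i. coeff F i \<in> polys_over A" "poly F z \<in> I"
  shows "\<exists>h. h \<notin> I \<and> h * poly F z \<in> J"
  using F
proof (induction "degree F" arbitrary: F rule: less_induct)
  case less
  note I = prime_ideal_ideal[OF prime]
  let ?n = "degree P" and ?d = "degree F"
  have n: "0 < ?n"
  proof (rule ccontr)
    assume "\<not> 0 < ?n"
    then have "poly P z = lead_coeff P" by (simp add: poly_altdef)
    then show False using P by simp
  qed
  show ?case
  proof (cases "?d < ?n")
    case True
    have "\<exists>h. h \<notin> I \<and> h * coeff F i \<in> J" for i
      using A P(5)[OF less.prems True] less.prems by blast
    then obtain h where h: "\<And>i. h i \<notin> I" "\<And>i. h i * coeff F i \<in> J" by metis
    \<comment> \<open>The product of the individual multipliers serves all coefficients at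
      once.\<close>
    have "prod h {..?d} * coeff F i * z ^ i \<in> J" if "i \<le> ?d" for i
    proof -
      have "prod h {..?d} * coeff F i * z ^ i = (prod h ({..?d} - {i}) * z ^ i) * (h i * coeff F i)"
        using that by (subst prod.remove[of _ i]) (auto simp: mult_ac)
      then show ?thesis using is_ideal_mult[OF J h(2)] by simp
    qed
    then have "prod h {..?d} * poly F z \<in> J"
      unfolding poly_altdef sum_distrib_left by (intro is_ideal_sum[OF J]) (simp add: mult.assoc)
    then show ?thesis using prime_ideal_prod[OF prime, of "{..?d}" h] h(1) by blast
  next
    case False
    \<comment> \<open>The multiple of \<open>P\<close> is chosen to cancel the term of degree
      \<open>?d\<close>.\<close>
    define F' where "F' = Polynomial.smult (lead_coeff P) F - Polynomial.monom (lead_coeff F) (?d - ?n) * P"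
    have coeff: "coeff F' i = lead_coeff P * coeff F i
        - (if i < ?d - ?n then 0 else lead_coeff F * coeff P (i - (?d - ?n)))" for i
      by (simp add: F'_def coeff_monom_mult)
    have poly: "poly F' z = lead_coeff P * poly F z - lead_coeff F * z ^ (?d - ?n) * poly P z"
      by (simp add: F'_def poly_monom)
    have "degree F' \<le> ?d - 1"
    proof (rule degree_le, safe)
      fix i assume "?d - 1 < i"
      then consider "i = ?d" | "?d < i" by linarith
      then show "coeff F' i = 0"
      proof cases
        case 1
        then show ?thesis using False by (simp add: coeff)
      next
        case 2
        then have "coeff F i = 0" "coeff P (i - (?d - ?n)) = 0"
          using False by (intro coeff_eq_0; linarith)+
        then show ?thesis by (simp add: coeff)
      qed
    qed
    then have "degree F' < ?d" using False n by linarith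
    moreover have "coeff F' i \<in> polys_over A" for i
      unfolding coeff using P(1) less.prems(1) by (auto intro!: polys_over_diff polys_over_mult)
    moreover have "poly F' z \<in> I"
      unfolding poly using P(2) less.prems(2) by (intro is_ideal_diff[OF I] is_ideal_mult[OF I])
    ultimately obtain h where h: "h \<notin> I" "h * poly F' z \<in> J"
      using less.hyps by blast
    have "(h * lead_coeff P) * poly F z
        = h * poly F' z + (h * lead_coeff F * z ^ (?d - ?n)) * poly P z"
      unfolding poly by (simp add: algebra_simps)
    also have "\<dots> \<in> J" by (rule is_ideal_add[OF J h(2) is_ideal_mult[OF J P(3)]])
    finally show ?thesis using prime_idealD[OF prime] h(1) P(4) by blast
  qed
qed

text \<open>
  The variables outside \<open>B\<close> are adjoined one at a time. A relation of minimal degree divides all others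
  once these are multiplied by a power of its leading coefficient, which is not in \<open>I\<close>.
\<close>

lemma generic_generators:
  fixes I :: "('v::finite, complex) mpoly set"
  assumes prime: "prime_ideal I" and B: "variable_basis I B"
  obtains G where "\<And>j. j \<notin> B \<Longrightarrow> G j \<in> I" "\<And>f. f \<in> I \<Longrightarrow> \<exists>h. h \<notin> I \<and> h * f \<in> ideal_gen (G ` (-B))"
proof -
  have "\<exists>G. (\<forall>j\<in>S. G j \<in> I) \<and> (\<forall>f\<in>I \<inter> polys_over (B \<union> S). \<exists>h. h \<notin> I \<and> h * f \<in> ideal_gen (G ` S))"
    if "finite S" "S \<subseteq> -B" for S
    using that
  proof (induction S rule: finite_induct)
    case empty
    have "\<exists>h. h \<notin> I \<and> h * f \<in> ideal_gen {}" if "f \<in> I \<inter> polys_over B" for f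
      using that B prime_ideal_1[OF prime] is_ideal_0[OF is_ideal_gen]
      by (intro exI[of _ 1]) (auto simp: variable_basis_def)
    then show ?case by auto
  next
    case (insert j S)
    then obtain G where G: "\<forall>j\<in>S. G j \<in> I"
      "\<forall>f\<in>I \<inter> polys_over (B \<union> S). \<exists>h. h \<notin> I \<and> h * f \<in> ideal_gen (G ` S)" by blast
    have "j \<notin> B" using insert.prems by auto
    obtain P0 where P0: "\<And>i. coeff P0 i \<in> polys_over B" "poly P0 (Var j) \<in> I" "lead_coeff P0 \<notin> I"
      using variable_basis_relation[OF B \<open>j \<notin> B\<close>] by metis
    have P0': "coeff P0 i \<in> polys_over (B \<union> S)" for i
      using P0(1) polys_over_mono[of B "B \<union> S"] by blast
    obtain P where P: "\<And>i. coeff P i \<in> polys_over (B \<union> S)" "poly P (Var j) \<in> I" "lead_coeff P \<notin> I"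
      "\<And>Q i. (\<And>i. coeff Q i \<in> polys_over (B \<union> S)) \<Longrightarrow> poly Q (Var j) \<in> I \<Longrightarrow>
        degree Q < degree P \<Longrightarrow> coeff Q i \<in> I"
      by (rule minimal_relation[OF prime P0' P0(2,3)]) blast
    define G' where "G' = G(j := poly P (Var j))"
    have sub: "ideal_gen (G ` S) \<subseteq> ideal_gen (G' ` insert j S)"
      using insert.hyps by (intro ideal_gen_mono) (auto simp: G'_def)
    have "\<exists>h. h \<notin> I \<and> h * f \<in> ideal_gen (G' ` insert j S)" if f: "f \<in> I" "f \<in> polys_over (B \<union> insert j S)" for f
    proof -
      obtain F where F: "\<And>i. coeff F i \<in> polys_over (B \<union> S)" "f = poly F (Var j)"
        using polys_over_insert[of f j "B \<union> S"] f(2) by auto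
      show ?thesis
        unfolding F(2)
      proof (rule pseudo_division[OF prime is_ideal_gen P(1,2) _ P(3,4) _ F(1)])
        show "poly P (Var j) \<in> ideal_gen (G' ` insert j S)"
          by (rule ideal_gen_base) (auto simp: G'_def)
        show "\<exists>h. h \<notin> I \<and> h * g \<in> ideal_gen (G' ` insert j S)" if "g \<in> I" "g \<in> polys_over (B \<union> S)" for g
          using G(2) that sub by blast
        show "poly F (Var j) \<in> I" using f F by simp
      qed
    qed
    moreover have "\<forall>k\<in>insert j S. G' k \<in> I" using G(1) P(2) by (auto simp: G'_def)
    ultimately show ?case by blast
  qed
  from this[of "-B"] obtain G where "\<And>j. j \<notin> B \<Longrightarrow> G j \<in> I"
    "\<And>f. f \<in> I \<Longrightarrow> \<exists>h. h \<notin> I \<and> h * f \<in> ideal_gen (G ` (-B))"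
    by auto
  then show ?thesis by (rule that)
qed

text \<open>Differentiating \<open>h i * f i = (\<Sum>j\<in>-B. q i j * G j)\<close> and dropping
  terms with an undifferentiated factor in the ideal expresses \<open>h i\<close> times row
  \<open>i\<close> of the Jacobian through \<open>codim X\<close> gradients. The scaled minor is
  thus 0 modulo the ideal, and primality cancels the \<open>h i\<close>.\<close>

lemma minors_jacobian_vanish:
  fixes X :: "(complex ^ 'n) set"
  assumes prime: "prime_ideal (vanishing_ideal X)" and f: "\<And>i. f i \<in> vanishing_ideal X"
    and l: "codim X < l"
  shows "minors l (jacobian f) \<subseteq> vanishing_ideal X"
proof
  let ?I = "vanishing_ideal X"
  note I = is_ideal_vanishing[of X]
  obtain B where B: "variable_basis ?I B" using variable_basis_exists[OF prime] .
  have card: "card (-B) < l"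
    using l variety_dim_eq_card_basis[OF prime B] by (simp add: codim_def Compl_eq_Diff_UNIV card_Diff_subset)
  obtain G where G: "\<And>j. j \<notin> B \<Longrightarrow> G j \<in> ?I" "\<And>f. f \<in> ?I \<Longrightarrow> \<exists>h. h \<notin> ?I \<and> h * f \<in> ideal_gen (G ` (-B))"
    by (rule generic_generators[OF prime B]) blast
  have "\<exists>h q. h \<notin> ?I \<and> h * f i = (\<Sum>j\<in>-B. q j * G j)" for i
  proof -
    obtain h where "h \<notin> ?I" "h * f i \<in> ideal_gen (G ` (-B))" using G(2)[OF f] by blast
    then show ?thesis using ideal_gen_image_finite[of "-B" "h * f i" G] by (metis finite)
  qed
  then obtain h q where h: "\<And>i. h i \<notin> ?I" "\<And>i. h i * f i = (\<Sum>j\<in>-B. q i j * G j)" by metis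
  have deriv: "h i * partial_deriv k (f i) - (\<Sum>j\<in>-B. q i j * partial_deriv k (G j)) \<in> ?I" for i k
  proof -
    have "partial_deriv k (h i * f i) = (\<Sum>j\<in>-B. partial_deriv k (q i j) * G j) + (\<Sum>j\<in>-B. q i j * partial_deriv k (G j))"
      unfolding h(2) partial_deriv_sum by (simp add: partial_deriv_mult sum.distrib)
    then have "h i * partial_deriv k (f i) - (\<Sum>j\<in>-B. q i j * partial_deriv k (G j))
        = (\<Sum>j\<in>-B. partial_deriv k (q i j) * G j) - partial_deriv k (h i) * f i"
      by (simp add: partial_deriv_mult algebra_simps)
    also have "\<dots> \<in> ?I" using G(1) f by (intro is_ideal_diff[OF I] is_ideal_sum[OF I] is_ideal_mult[OF I]) auto
    finally show ?thesis .
  qed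
  fix x assume "x \<in> minors l (jacobian f)"
  then obtain r c where x: "x = fdet l (\<lambda>i j. partial_deriv (c j) (f (r i)))"
    by (auto simp: minors_eq jacobian_def)
  have "fdet l (\<lambda>i j. h (r i) * partial_deriv (c j) (f (r i)))
      - fdet l (\<lambda>i j. \<Sum>k\<in>-B. q (r i) k * partial_deriv (c j) (G k)) \<in> ?I"
    by (intro fdet_diff_mem_ideal I deriv)
  moreover have "fdet l (\<lambda>i j. \<Sum>k\<in>-B. q (r i) k * partial_deriv (c j) (G k)) = 0"
    by (rule fdet_row_combination_eq_0[OF _ card, where M = "\<lambda>k j. partial_deriv (c j) (G k)" and Q = "\<lambda>i. q (r i)"]) auto
  ultimately have "(\<Prod>i=0..<l. h (r i)) * x \<in> ?I"
    by (simp add: x fdet_scale_rows)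
  then show "x \<in> ?I"
    using prime_idealD[OF prime] prime_ideal_prod[OF prime, of "{0..<l}" "\<lambda>i. h (r i)"] h(1) by blast
qed


subsection \<open>Comparison of the critical ideals\<close>

lemma ideal_gen_Un_cong: "ideal_gen S = ideal_gen S' \<Longrightarrow> ideal_gen (K \<union> S) = ideal_gen (K \<union> S')"
proof (rule ideal_gen_cong)
  assume eq: "ideal_gen S = ideal_gen S'"
  have "ideal_gen S \<subseteq> ideal_gen (K \<union> S)" "ideal_gen S' \<subseteq> ideal_gen (K \<union> S')"
    by (intro ideal_gen_mono; blast)+
  then show "K \<union> S \<subseteq> ideal_gen (K \<union> S')" "K \<union> S' \<subseteq> ideal_gen (K \<union> S)"
    using eq ideal_gen_base[of _ S] ideal_gen_base[of _ S'] by (auto intro: ideal_gen_base)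
qed

text \<open>The coefficients of the two rows are added, so \<open>r1 i = r2 i\<close> is allowed;
  this covers rows that are only copied or rescaled.\<close>

lemma minors_two_rows:
  fixes M :: "'r::finite \<Rightarrow> 'c \<Rightarrow> 'a::comm_ring_1"
  assumes "\<And>i j. N i j = c1 i * M (r1 i) j + c2 i * M (r2 i) j"
  shows "minors k N \<subseteq> ideal_gen (minors k M)"
  by (rule minors_row_combination[of _ "\<lambda>i l. (if l = r1 i then c1 i else 0) + (if l = r2 i then c2 i else 0)"])
     (simp add: assms distrib_right sum.distrib if_distrib[of "\<lambda>x. x * _"] cong: if_cong)

lemma minors_two_cols:
  fixes M :: "'r \<Rightarrow> 'c::finite \<Rightarrow> 'a::comm_ring_1"
  assumes "\<And>i j. N i j = c1 j * M i (r1 j) + c2 j * M i (r2 j)"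
  shows "minors k N \<subseteq> ideal_gen (minors k M)"
  by (rule minors_col_combination[of _ _ "\<lambda>l j. (if l = r1 j then c1 j else 0) + (if l = r2 j then c2 j else 0)"])
     (simp add: assms distrib_left sum.distrib if_distrib[of "\<lambda>x. _ * x"] mult.commute cong: if_cong)

lemma block_triangular_minors:
  assumes "\<And>i j. i < b \<Longrightarrow> j < a \<Longrightarrow> N (\<rho>2 i) (\<gamma>1 j) = 0"
  shows "fdet a (\<lambda>i j. N (\<rho>1 i) (\<gamma>1 j)) * fdet b (\<lambda>i j. N (\<rho>2 i) (\<gamma>2 j)) \<in> ideal_gen (minors (a + b) N)"
proof -
  define \<rho> where "\<rho> i = (if i < a then \<rho>1 i else \<rho>2 (i - a))" for i
  define \<gamma> where "\<gamma> i = (if i < a then \<gamma>1 i else \<gamma>2 (i - a))" for i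
  have "fdet (a + b) (\<lambda>i j. N (\<rho> i) (\<gamma> j)) = fdet a (\<lambda>i j. N (\<rho> i) (\<gamma> j)) * fdet b (\<lambda>i j. N (\<rho> (a + i)) (\<gamma> (a + j)))"
    by (rule fdet_block_triangular) (auto simp: \<rho>_def \<gamma>_def assms)
  also have "fdet a (\<lambda>i j. N (\<rho> i) (\<gamma> j)) = fdet a (\<lambda>i j. N (\<rho>1 i) (\<gamma>1 j))"
    by (rule fdet_cong) (auto simp: \<rho>_def \<gamma>_def)
  also have "fdet b (\<lambda>i j. N (\<rho> (a + i)) (\<gamma> (a + j))) = fdet b (\<lambda>i j. N (\<rho>2 i) (\<gamma>2 j))"
    by (rule fdet_cong) (auto simp: \<rho>_def \<gamma>_def)
  finally show ?thesis by (metis fdet_mem_ideal_gen_minors)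
qed

text \<open>
  A maximal minor of one augmented block times a maximal minor of the other Jacobian is a minor
  of \<open>N\<close>, so the two base ideals agree after saturation, although not before.
\<close>

lemma critical_saturation_eq:
  fixes M1 :: "'s::finite \<Rightarrow> 'n::finite \<Rightarrow> 'a::comm_ring_1" and M2 :: "'t::finite \<Rightarrow> 'm::finite \<Rightarrow> 'a"
    and \<alpha> :: "'n \<Rightarrow> 'a" and \<beta> :: "'m \<Rightarrow> 'a"
  assumes rank: "minors (c + 1) M1 \<subseteq> ideal_gen (I1 \<union> I2)" "minors (c + 1) M2 \<subseteq> ideal_gen (I1 \<union> I2)"
  defines "K \<equiv> ideal_gen (I1 \<union> I2)"
  defines "N \<equiv> add_row (case_sum \<alpha> \<beta>) (block_diag M1 M2)"
  shows "saturation
      (ideal_gen (I1 \<union> I2 \<union> minors (c + 1) (add_row \<alpha> M1) \<union> minors (c + 1) (add_row \<beta> M2)))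
      (ideal_prod (ideal_gen (I1 \<union> minors c M1)) (ideal_gen (I2 \<union> minors c M2)))
    = saturation (ideal_gen (K \<union> minors (2 * c + 1) N)) (ideal_gen (K \<union> minors (2 * c) (block_diag M1 M2)))"
    (is "saturation ?A ?S = saturation ?B ?T")
proof (rule saturation_eqI[of _ _ K])
  let ?V = "add_row \<alpha> M1" and ?U = "add_row \<beta> M2"
  show "is_ideal ?A" "is_ideal ?B" and K: "is_ideal K" by (simp_all add: K_def)
  show KB: "K \<subseteq> ?B" by (auto intro: ideal_gen_base)
  have KT: "K \<subseteq> ?T" by (auto intro: ideal_gen_base)
  have KA: "K \<subseteq> ?A" unfolding K_def by (rule ideal_gen_mono) auto
  have I12: "I1 \<subseteq> K" "I2 \<subseteq> K" unfolding K_def by (auto intro: ideal_gen_base)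
  have rank': "minors l M1 \<subseteq> K" "minors l M2 \<subseteq> K" if "c < l" for l
    using minors_subset_ideal_mono[OF K, of "c + 1" M1 l] minors_subset_ideal_mono[OF K, of "c + 1" M2 l]
      rank that by (auto simp: K_def)
  show "?B \<subseteq> ?A"
  proof (rule ideal_gen_least, simp, rule Un_least[OF KA])
    \<comment> \<open>The first row of \<open>N\<close> is the sum of the augmented rows of the two
      blocks; all other rows are shared.\<close>
    have "minors (2 * c + 1) N \<subseteq> ideal_gen (minors (2 * c + 1) (block_diag ?V ?U))"
    proof (rule minors_two_rows)
      fix i j
      show "N i j = 1 * block_diag ?V ?U (case i of None \<Rightarrow> Inl None | Some (Inl s) \<Rightarrow> Inl (Some s) | Some (Inr s) \<Rightarrow> Inr (Some s)) j
          + (case i of None \<Rightarrow> 1 | _ \<Rightarrow> 0) * block_diag ?V ?U (Inr None) j"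
        by (auto simp: N_def add_row_def block_diag_def split: option.splits sum.splits)
    qed
    also have "\<dots> \<subseteq> ?A"
    proof (rule ideal_gen_least, simp, rule)
      fix x assume "x \<in> minors (2 * c + 1) (block_diag ?V ?U)"
      then consider "x = 0" | a b p q where "a + b = 2 * c + 1" "p \<in> minors a ?V" "q \<in> minors b ?U" "x = p * q \<or> x = - (p * q)"
        using minors_block_diag by blast
      then show "x \<in> ?A"
      proof cases
        case 1
        then show ?thesis by (simp add: is_ideal_0)
      next
        case 2
        have "minors a ?V \<subseteq> ?A" if "c + 1 \<le> a"
          by (rule minors_subset_ideal_mono[OF _ _ that]) (auto intro: ideal_gen_base)
        moreover have "minors b ?U \<subseteq> ?A" if "c + 1 \<le> b"
          by (rule minors_subset_ideal_mono[OF _ _ that]) (auto intro: ideal_gen_base)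
        \<comment> \<open>Sizes that add up to \<open>2 * c + 1\<close> cannot both be at most
          \<open>c\<close>.\<close>
        moreover have "c + 1 \<le> a \<or> c + 1 \<le> b" using 2 by linarith
        ultimately have "p \<in> ?A \<or> q \<in> ?A" using 2 by blast
        then have "p * q \<in> ?A" using is_ideal_mult[OF is_ideal_gen] is_ideal_mult_right[OF is_ideal_gen] by blast
        then show ?thesis using 2 is_ideal_uminus[OF is_ideal_gen] by blast
      qed
    qed
    finally show "minors (2 * c + 1) N \<subseteq> ?A" .
  qed
  have prods: "p * q \<in> ideal_gen (minors (2 * c) (block_diag M1 M2))" if pq: "p \<in> minors c M1" "q \<in> minors c M2" for p q
  proof -
    obtain r d r' d' where "p = fdet c (\<lambda>i j. M1 (r i) (d j))" "q = fdet c (\<lambda>i j. M2 (r' i) (d' j))"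
      using pq unfolding minors_eq by blast
    then show ?thesis
      using block_triangular_minors[of c c "block_diag M1 M2" "\<lambda>i. Inr (r' i)" "\<lambda>j. Inl (d j)" "\<lambda>i. Inl (r i)" "\<lambda>j. Inr (d' j)"]
      by (simp add: mult_2)
  qed
  have T2: "ideal_gen (minors (2 * c) (block_diag M1 M2)) \<subseteq> ?T" by (rule ideal_gen_mono) auto
  show "?S \<subseteq> ?T"
    unfolding ideal_prod_gen_gen
  proof (rule ideal_gen_least, simp, rule)
    fix x assume "x \<in> {a * b |a b. a \<in> I1 \<union> minors c M1 \<and> b \<in> I2 \<union> minors c M2}"
    then obtain a b where a: "a \<in> I1 \<union> minors c M1" and b: "b \<in> I2 \<union> minors c M2" and x: "x = a * b"
      by blast
    consider "a \<in> K" | "b \<in> K" | "a \<in> minors c M1" "b \<in> minors c M2" using a b I12 by blast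
    then have "a * b \<in> ?T"
    proof cases
      case 1
      then show ?thesis using KT is_ideal_mult_right[OF is_ideal_gen] by blast
    next
      case 2
      then show ?thesis using KT is_ideal_mult[OF is_ideal_gen] by blast
    next
      case 3
      then show ?thesis using prods T2 by blast
    qed
    then show "x \<in> ?T" by (simp only: x)
  qed
  show "\<exists>s\<in>?S. t - s \<in> K" if t: "t \<in> ?T" for t
  proof -
    have S: "is_ideal ?S" by (rule is_ideal_prod)
    let ?SK = "ideal_gen (?S \<union> K)"
    have K': "K \<subseteq> ?SK" by (auto intro: ideal_gen_base)
    have "?T \<subseteq> ?SK"
    proof (rule ideal_gen_least, simp, rule Un_least[OF K'], rule)
      fix x assume "x \<in> minors (2 * c) (block_diag M1 M2)"
      then consider "x = 0" | a b p q where "a + b = 2 * c" "p \<in> minors a M1" "q \<in> minors b M2" "x = p * q \<or> x = - (p * q)"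
        using minors_block_diag by blast
      then show "x \<in> ?SK"
      proof cases
        case 1
        then show ?thesis by (simp add: is_ideal_0)
      next
        case 2
        have "p * q \<in> ?SK"
        proof (cases "a = c")
          case True
          then have "p \<in> minors c M1" "q \<in> minors c M2" using 2 by auto
          then have "p * q \<in> ?S" by (intro ideal_prod_base ideal_gen_base) auto
          then show ?thesis by (auto intro: ideal_gen_base)
        next
          case False
          \<comment> \<open>Unequal sizes with sum \<open>2 * c\<close> make one of them exceed
            \<open>c\<close>, where the rank hypothesis gives membership in
            \<open>K\<close>.\<close>
          then have "c < a \<or> c < b" using 2 by linarith
          then have "p \<in> ?SK \<or> q \<in> ?SK" using rank' 2 K' by blast
          then show ?thesis using is_ideal_mult[OF is_ideal_gen] is_ideal_mult_right[OF is_ideal_gen] by blast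
        qed
        then show ?thesis using 2 is_ideal_uminus[OF is_ideal_gen] by blast
      qed
    qed
    then obtain s k where "s \<in> ideal_gen ?S" "k \<in> ideal_gen K" "t = s + k"
      using ideal_gen_Un_cases[of t ?S K] t by blast
    then show ?thesis by (intro bexI[of _ s]) (auto simp: ideal_gen_eq[OF S] ideal_gen_eq[OF K])
  qed
  \<comment> \<open>On the columns of the first block, \<open>N\<close> shows \<open>?V\<close>
    above zeros; the entries \<open>\<beta>\<close> of the first row fall into the upper right block
    and do not disturb triangularity.\<close>
  have N1: "p * q \<in> ?B" if pq: "p \<in> minors (c + 1) ?V" "q \<in> minors c M2" for p q
  proof -
    obtain r d r' d' where "p = fdet (c + 1) (\<lambda>i j. ?V (r i) (d j))" "q = fdet c (\<lambda>i j. M2 (r' i) (d' j))"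
      using pq unfolding minors_eq by blast
    moreover have "N (map_option Inl s) (Inl j) = ?V s j" "N (Some (Inr t)) (Inr j') = M2 t j'" "N (Some (Inr t)) (Inl j) = 0" for s t j j'
      by (auto simp: N_def add_row_def split: option.splits)
    ultimately have "p * q \<in> ideal_gen (minors (c + 1 + c) N)"
      using block_triangular_minors[of c "c + 1" N "\<lambda>i. Some (Inr (r' i))" "\<lambda>j. Inl (d j)" "\<lambda>i. map_option Inl (r i)" "\<lambda>j. Inr (d' j)"]
      by simp
    also have "\<dots> \<subseteq> ?B" by (rule ideal_gen_mono) (auto simp: mult_2)
    finally show ?thesis .
  qed
  have N2: "p * q \<in> ?B" if pq: "p \<in> minors (c + 1) ?U" "q \<in> minors c M1" for p q
  proof -
    obtain r d r' d' where "p = fdet (c + 1) (\<lambda>i j. ?U (r i) (d j))" "q = fdet c (\<lambda>i j. M1 (r' i) (d' j))"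
      using pq unfolding minors_eq by blast
    moreover have "N (map_option Inr s) (Inr j) = ?U s j" "N (Some (Inl t)) (Inl j') = M1 t j'" "N (Some (Inl t)) (Inr j) = 0" for s t j j'
      by (auto simp: N_def add_row_def split: option.splits)
    ultimately have "p * q \<in> ideal_gen (minors (c + 1 + c) N)"
      using block_triangular_minors[of c "c + 1" N "\<lambda>i. Some (Inl (r' i))" "\<lambda>j. Inr (d j)" "\<lambda>i. map_option Inr (r i)" "\<lambda>j. Inl (d' j)"]
      by simp
    also have "\<dots> \<subseteq> ?B" by (rule ideal_gen_mono) (auto simp: mult_2)
    finally show ?thesis .
  qed
  show "x * s \<in> ?B" if x: "x \<in> ?A" and s: "s \<in> ?S" for x s
  proof -
    note B = is_ideal_gen[of "K \<union> minors (2 * c + 1) N"]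
    have gen: "y * (a * b) \<in> ?B" if y: "y \<in> I1 \<union> I2 \<union> minors (c + 1) ?V \<union> minors (c + 1) ?U"
      and a: "a \<in> I1 \<union> minors c M1" and b: "b \<in> I2 \<union> minors c M2" for y a b
    proof -
      consider "y \<in> K" | "a \<in> K" | "b \<in> K" | "y \<in> minors (c + 1) ?V" "b \<in> minors c M2"
        | "y \<in> minors (c + 1) ?U" "a \<in> minors c M1"
        using y a b I12 by blast
      then show ?thesis
      proof cases
        case 1
        then show ?thesis using KB is_ideal_mult_right[OF B] by blast
      next
        case 2
        then have "(y * b) * a \<in> ?B" using KB is_ideal_mult[OF B] by blast
        then show ?thesis by (simp add: ac_simps)
      next
        case 3
        then have "(y * a) * b \<in> ?B" using KB is_ideal_mult[OF B] by blast
        then show ?thesis by (simp add: ac_simps)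
      next
        case 4
        then have "a * (y * b) \<in> ?B" using N1 is_ideal_mult[OF B] by blast
        then show ?thesis by (simp add: ac_simps)
      next
        case 5
        then have "b * (y * a) \<in> ?B" using N2 is_ideal_mult[OF B] by blast
        then show ?thesis by (simp add: ac_simps)
      qed
    qed
    have "?S \<subseteq> {s. s * y \<in> ?B}" if "y \<in> I1 \<union> I2 \<union> minors (c + 1) ?V \<union> minors (c + 1) ?U" for y
      unfolding ideal_prod_gen_gen
      by (rule ideal_gen_least[OF is_ideal_colon[OF B]]) (use gen[OF that] in \<open>auto simp: mult.commute[of _ y]\<close>)
    then have "I1 \<union> I2 \<union> minors (c + 1) ?V \<union> minors (c + 1) ?U \<subseteq> {x. x * s \<in> ?B}"
      using s by (auto simp: mult.commute[of _ s])
    from ideal_gen_least[OF is_ideal_colon[OF B] this] show ?thesis using x by blast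
  qed
qed


subsection \<open>The Jacobian of the real and imaginary parts\<close>

lemma lookup_Const_mult: "Poly_Mapping.lookup (Const a * p) m = a * Poly_Mapping.lookup p m"
  for a :: "'a::comm_ring_1"
  by (auto simp: Const_def map.rep_eq when_def simp flip: mult_map_scale_conv_mult)

lemma lookup_conj_poly: "Poly_Mapping.lookup (conj_poly p) m = cnj (Poly_Mapping.lookup p m)"
proof (induction p rule: poly_mapping_additive_induct)
  case zero
  show ?case by (simp add: conj_poly_def poly_hom_def)
next
  case (single \<mu> c)
  have "conj_poly (Poly_Mapping.single \<mu> c) = Poly_Mapping.single \<mu> (cnj c)"
    unfolding conj_poly_def by (subst poly_hom_single) (simp_all flip: single_eq_Const_mult_mon)
  then show ?case by (simp add: lookup_single when_def)
qed (auto simp: lookup_add)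

lemma complexify_Re: "complexify (Poly_Mapping.map Re p) = Const (1 / 2) * (p + conj_poly p)"
  by (rule poly_mapping_eqI)
     (auto simp: lookup_Const_mult lookup_add lookup_conj_poly map.rep_eq when_def complex_eq_iff)

lemma complexify_Im: "complexify (Poly_Mapping.map Im p) = Const (- \<i> / 2) * (p - conj_poly p)"
  by (rule poly_mapping_eqI)
     (auto simp: lookup_Const_mult lookup_minus lookup_conj_poly map.rep_eq when_def complex_eq_iff)

lemma partial_deriv_in_xy:
  "partial_deriv (Inl k) (in_xy p) = in_xy (partial_deriv k p)"
  "partial_deriv (Inr k) (in_xy p) = Const \<i> * in_xy (partial_deriv k p)"
  using partial_deriv_ring_hom[OF in_xy_hom, of "Inl k" k 1 p] partial_deriv_ring_hom[OF in_xy_hom, of "Inr k" k "Const \<i>" p]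
  by auto

lemma partial_deriv_in_xyc:
  "partial_deriv (Inl k) (in_xyc p) = in_xyc (partial_deriv k p)"
  "partial_deriv (Inr k) (in_xyc p) = Const (- \<i>) * in_xyc (partial_deriv k p)"
proof -
  have *: "partial_deriv (Inl k) (in_xyc (Var j)) = (if j = k then 1 else 0)"
    "partial_deriv (Inr k) (in_xyc (Var j)) = (if j = k then Const (- \<i>) else 0)" for j
  proof -
    have "in_xyc (Var j) = Var (Inl j) + Const (- \<i>) * Var (Inr j)"
      by (simp add: in_xyc_Var Const_minus)
    then show "partial_deriv (Inl k) (in_xyc (Var j)) = (if j = k then 1 else 0)"
      "partial_deriv (Inr k) (in_xyc (Var j)) = (if j = k then Const (- \<i>) else 0)" by auto
  qed
  show "partial_deriv (Inl k) (in_xyc p) = in_xyc (partial_deriv k p)"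
    using partial_deriv_ring_hom[OF in_xyc_hom, of "Inl k" k 1 p] * by (simp add: in_xyc_Const)
  show "partial_deriv (Inr k) (in_xyc p) = Const (- \<i>) * in_xyc (partial_deriv k p)"
    using partial_deriv_ring_hom[OF in_xyc_hom, of "Inr k" k "Const (- \<i>)" p] * by (simp add: in_xyc_Const)
qed

text \<open>The column transformation that passes from derivatives in \<open>z, w\<close> to derivatives in \<open>x, y\<close>.\<close>

definition col_mix :: "('r \<Rightarrow> 'n + 'n \<Rightarrow> ('v, complex) mpoly) \<Rightarrow> 'r \<Rightarrow> 'n + 'n \<Rightarrow> ('v, complex) mpoly" where
  "col_mix M i = case_sum (\<lambda>k. M i (Inl k) + M i (Inr k)) (\<lambda>k. Const \<i> * (M i (Inl k) - M i (Inr k)))"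

text \<open>The mixing is invertible, and its inverse again combines only two columns at a
  time.\<close>

lemma minors_col_mix:
  fixes M :: "'r \<Rightarrow> 'n::finite + 'n \<Rightarrow> ('v, complex) mpoly"
  shows "ideal_gen (minors k (col_mix M)) = ideal_gen (minors k M)"
proof (rule ideal_gen_cong)
  show "minors k (col_mix M) \<subseteq> ideal_gen (minors k M)"
  proof (rule minors_two_cols)
    show "col_mix M i j = (case j of Inl _ \<Rightarrow> 1 | Inr _ \<Rightarrow> Const \<i>) * M i (case j of Inl k \<Rightarrow> Inl k | Inr k \<Rightarrow> Inl k)
        + (case j of Inl _ \<Rightarrow> 1 | Inr _ \<Rightarrow> Const (- \<i>)) * M i (case j of Inl k \<Rightarrow> Inr k | Inr k \<Rightarrow> Inr k)" for i j
      by (cases j) (simp_all add: col_mix_def Const_minus right_diff_distrib)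
  qed
  show "minors k M \<subseteq> ideal_gen (minors k (col_mix M))"
  proof (rule minors_two_cols)
    show "M i j = Const (1 / 2) * col_mix M i (case j of Inl k \<Rightarrow> Inl k | Inr k \<Rightarrow> Inl k)
        + (case j of Inl _ \<Rightarrow> Const (- \<i> / 2) | Inr _ \<Rightarrow> Const (\<i> / 2)) * col_mix M i (case j of Inl k \<Rightarrow> Inr k | Inr k \<Rightarrow> Inr k)" for i j
      by (cases j; rule poly_mapping_eqI; simp add: col_mix_def lookup_Const_mult lookup_add lookup_minus; simp add: field_simps)
  qed
qed

text \<open>The real and imaginary parts are half the sum of \<open>f\<close> and its conjugate and
  their difference over \<open>2 * i\<close>, which gives the row coefficients; the chain rule for
  \<open>x + iy\<close> and \<open>x - iy\<close> is the column mixing.\<close>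

lemma jacobian_tilde_eqs:
  fixes f :: "'s \<Rightarrow> ('n, complex) mpoly"
  defines "D \<equiv> col_mix (block_diag (\<lambda>i k. in_xy (jacobian f i k)) (\<lambda>i k. in_xyc (jacobian f i k)))"
  shows "jacobian (\<lambda>i. complexify (tilde_eqs f i)) (Inl i) j = Const (1 / 2) * D (Inl i) j + Const (1 / 2) * D (Inr i) j"
    "jacobian (\<lambda>i. complexify (tilde_eqs f i)) (Inr i) j = Const (- \<i> / 2) * D (Inl i) j + Const (\<i> / 2) * D (Inr i) j"
proof -
  have eqs: "complexify (tilde_eqs f (Inl i)) = Const (1 / 2) * (in_xy (f i) + in_xyc (f i))"
    "complexify (tilde_eqs f (Inr i)) = Const (- \<i> / 2) * (in_xy (f i) + Const (- 1) * in_xyc (f i))" for i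
    by (simp_all add: tilde_eqs_def complexify_Re complexify_Im in_xyc_def Const_minus)
  show "jacobian (\<lambda>i. complexify (tilde_eqs f i)) (Inl i) j = Const (1 / 2) * D (Inl i) j + Const (1 / 2) * D (Inr i) j"
    unfolding jacobian_def eqs D_def partial_deriv_Const_mult partial_deriv_add
    by (cases j; rule poly_mapping_eqI; simp add: partial_deriv_in_xy partial_deriv_in_xyc col_mix_def lookup_Const_mult lookup_add lookup_minus; simp add: field_simps)
  show "jacobian (\<lambda>i. complexify (tilde_eqs f i)) (Inr i) j = Const (- \<i> / 2) * D (Inl i) j + Const (\<i> / 2) * D (Inr i) j"
    unfolding jacobian_def eqs D_def partial_deriv_Const_mult partial_deriv_add
    by (cases j; rule poly_mapping_eqI; simp add: partial_deriv_in_xy partial_deriv_in_xyc col_mix_def lookup_Const_mult lookup_add lookup_minus; simp add: field_simps)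
qed

lemma minors_jacobian_tilde_eqs:
  fixes f :: "'s::finite \<Rightarrow> ('n::finite, complex) mpoly"
  shows "ideal_gen (minors l (jacobian (\<lambda>i. complexify (tilde_eqs f i)))) =
    ideal_gen (minors l (block_diag (\<lambda>i k. in_xy (jacobian f i k)) (\<lambda>i k. in_xyc (jacobian f i k))))"
    (is "ideal_gen (minors l ?J) = ideal_gen (minors l ?M)")
proof -
  have "ideal_gen (minors l ?J) = ideal_gen (minors l (col_mix ?M))"
  proof (rule ideal_gen_cong)
    show "minors l ?J \<subseteq> ideal_gen (minors l (col_mix ?M))"
    proof (rule minors_two_rows)
      show "?J i j = (case i of Inl _ \<Rightarrow> Const (1 / 2) | Inr _ \<Rightarrow> Const (- \<i> / 2)) * col_mix ?M (case i of Inl s \<Rightarrow> Inl s | Inr s \<Rightarrow> Inl s) j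
          + (case i of Inl _ \<Rightarrow> Const (1 / 2) | Inr _ \<Rightarrow> Const (\<i> / 2)) * col_mix ?M (case i of Inl s \<Rightarrow> Inr s | Inr s \<Rightarrow> Inr s) j" for i j
        by (cases i) (simp_all only: jacobian_tilde_eqs sum.case)
    qed
    show "minors l (col_mix ?M) \<subseteq> ideal_gen (minors l ?J)"
    proof (rule minors_two_rows)
      show "col_mix ?M i j = 1 * ?J (case i of Inl s \<Rightarrow> Inl s | Inr s \<Rightarrow> Inl s) j
          + (case i of Inl _ \<Rightarrow> Const \<i> | Inr _ \<Rightarrow> Const (- \<i>)) * ?J (case i of Inl s \<Rightarrow> Inr s | Inr s \<Rightarrow> Inr s) j" for i j
        by (cases i; rule poly_mapping_eqI; simp only: jacobian_tilde_eqs sum.case lookup_Const_mult lookup_add mult_1; simp add: field_simps)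
    qed
  qed
  then show ?thesis by (simp only: minors_col_mix)
qed

lemma in_xy_Var: "in_xy (Var k) = Var (Inl k) + Const \<i> * Var (Inr k)"
  by simp

lemma add_row_simps [simp]: "add_row a M None = a" "add_row a M (Some i) = M i"
  by (simp_all add: add_row_def)

text \<open>With \<open>a = to_xy (u, v)\<close>, the row \<open>a - y\<close> is half the mixed row
  that has \<open>v - w\<close> over the \<open>z\<close>-columns and \<open>u - z\<close> over the
  \<open>w\<close>-columns. The other rows change as in the Jacobian alone, and all operations are
  invertible.\<close>

lemma minors_eucl_matrix:
  fixes f :: "'s::finite \<Rightarrow> ('n::finite, complex) mpoly" and u v :: "complex ^ 'n"
  shows "ideal_gen (minors l (add_row (\<lambda>k. Const (to_xy (u, v) $ k) - Var k) (jacobian (\<lambda>i. complexify (tilde_eqs f i))))) =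
    ideal_gen (minors l (add_row (case_sum (\<lambda>k. Const (v $ k) - in_xyc (Var k)) (\<lambda>k. Const (u $ k) - in_xy (Var k)))
      (block_diag (\<lambda>i k. in_xy (jacobian f i k)) (\<lambda>i k. in_xyc (jacobian f i k)))))"
    (is "ideal_gen (minors l ?E) = ideal_gen (minors l (add_row ?r ?M))")
proof -
  let ?N = "add_row ?r ?M" and ?J = "jacobian (\<lambda>i. complexify (tilde_eqs f i))"
  have None: "?E None j = Const (1 / 2) * col_mix ?N None j" for j
  proof (cases j)
    case (Inl k)
    have "Const (to_xy (u, v) $ j) = Const (1 / 2) * (Const (u $ k) + Const (v $ k) :: ('n + 'n, complex) mpoly)"
      by (simp add: Inl to_xy_def vjoin_def flip: Const_mult Const_add)
    then show ?thesis
      unfolding add_row_simps col_mix_def Inl sum.case in_xy_Var in_xyc_Var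
      by (intro poly_mapping_eqI; simp only: lookup_Const_mult lookup_add lookup_minus; simp add: field_simps)
  next
    case (Inr k)
    have "Const (to_xy (u, v) $ j) = Const (- \<i> / 2) * (Const (u $ k) + Const (- (v $ k)) :: ('n + 'n, complex) mpoly)"
    proof -
      have "(u $ k - v $ k) / (2 * \<i>) = - \<i> / 2 * (u $ k + - (v $ k))"
        by (subst nonzero_divide_eq_eq) (simp_all add: algebra_simps)
      then show ?thesis
        unfolding Const_add[symmetric] Const_mult[symmetric] by (simp only: Inr to_xy_def vjoin_def case_prod_conv vec_lambda_beta sum.case)
    qed
    then have "Const (to_xy (u, v) $ j) = Const (- \<i> / 2) * (Const (u $ k) - Const (v $ k) :: ('n + 'n, complex) mpoly)"
      by (simp add: Const_minus)
    then show ?thesis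
      unfolding add_row_simps col_mix_def Inr sum.case in_xy_Var in_xyc_Var
      by (intro poly_mapping_eqI; simp only: lookup_Const_mult lookup_add lookup_minus; simp add: field_simps)
  qed
  have mix: "col_mix ?N (Some i) j = col_mix ?M i j" for i j
    by (simp add: col_mix_def)
  have "ideal_gen (minors l ?E) = ideal_gen (minors l (col_mix ?N))"
  proof (rule ideal_gen_cong)
    show "minors l ?E \<subseteq> ideal_gen (minors l (col_mix ?N))"
    proof (rule minors_two_rows)
      show "?E i j = (case i of Some (Inr _) \<Rightarrow> Const (- \<i> / 2) | _ \<Rightarrow> Const (1 / 2)) *
            col_mix ?N (case i of None \<Rightarrow> None | Some (Inl s) \<Rightarrow> Some (Inl s) | Some (Inr s) \<Rightarrow> Some (Inl s)) j
          + (case i of None \<Rightarrow> 0 | Some (Inl _) \<Rightarrow> Const (1 / 2) | Some (Inr _) \<Rightarrow> Const (\<i> / 2)) *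
            col_mix ?N (case i of None \<Rightarrow> None | Some (Inl s) \<Rightarrow> Some (Inr s) | Some (Inr s) \<Rightarrow> Some (Inr s)) j" for i j
      proof (cases i)
        case None
        then show ?thesis by (simp only: \<open>\<And>j. ?E None j = _\<close> option.case mult_zero_left add_0_right)
      next
        case (Some s)
        then show ?thesis by (cases s) (simp_all only: option.case sum.case mix add_row_simps jacobian_tilde_eqs)
      qed
    qed
    show "minors l (col_mix ?N) \<subseteq> ideal_gen (minors l ?E)"
    proof (rule minors_two_rows)
      show "col_mix ?N i j = (case i of None \<Rightarrow> Const 2 | _ \<Rightarrow> 1) *
            ?E (case i of None \<Rightarrow> None | Some (Inl s) \<Rightarrow> Some (Inl s) | Some (Inr s) \<Rightarrow> Some (Inl s)) j
          + (case i of None \<Rightarrow> 0 | Some (Inl _) \<Rightarrow> Const \<i> | Some (Inr _) \<Rightarrow> Const (- \<i>)) *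
            ?E (case i of None \<Rightarrow> None | Some (Inl s) \<Rightarrow> Some (Inr s) | Some (Inr s) \<Rightarrow> Some (Inr s)) j" for i j
      proof (cases i)
        case None
        then show ?thesis
          by (simp only: \<open>\<And>j. ?E None j = _\<close> option.case mult_zero_left add_0_right)
             (simp flip: Const_mult mult.assoc)
      next
        case (Some s)
        show ?thesis unfolding Some
          by (cases s; rule poly_mapping_eqI; simp only: option.case sum.case mix add_row_simps jacobian_tilde_eqs lookup_Const_mult lookup_add mult_1; simp add: field_simps)
      qed
    qed
  qed
  then show ?thesis by (simp only: minors_col_mix)
qed


subsection \<open>The Hermitian critical ideal in real coordinates\<close>

definition to_zw :: "('n + 'n, complex) mpoly \<Rightarrow> ('n + 'n, complex) mpoly" where
  "to_zw = subst (case_sum (\<lambda>k. Const (1 / 2) * (Var (Inl k) + Var (Inr k))) (\<lambda>k. Const (- \<i> / 2) * (Var (Inl k) - Var (Inr k))))"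

lemma subst_zw_gen_hom: "comm_ring_hom (subst zw_gen)"
  by (rule poly_hom_ring_hom[OF Const_hom])

lemma to_zw_hom: "comm_ring_hom to_zw"
  unfolding to_zw_def by (rule poly_hom_ring_hom[OF Const_hom])

lemma to_zw_subst_zw_gen: "to_zw (subst zw_gen p) = p"
proof (rule ring_hom_mpoly_eqI[OF comp_hom[OF to_zw_hom subst_zw_gen_hom] id_hom[unfolded id_def]])
  interpret comm_ring_hom to_zw by (rule to_zw_hom)
  show "to_zw (subst zw_gen (Var k)) = Var k" for k
  proof (cases k)
    case (Inl j)
    have "to_zw (subst zw_gen (Var k)) = Const (1 / 2) * (Var (Inl j) + Var (Inr j)) + Const \<i> * (Const (- \<i> / 2) * (Var (Inl j) - Var (Inr j)))"
      by (simp add: Inl hom_distribs) (simp add: to_zw_def distrib_left)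
    also have "\<dots> = Var k"
      unfolding Inl by (rule poly_mapping_eqI; simp only: lookup_Const_mult lookup_add lookup_minus; simp add: field_simps)
    finally show ?thesis .
  next
    case (Inr j)
    have "to_zw (subst zw_gen (Var k)) = Const (1 / 2) * (Var (Inl j) + Var (Inr j)) - Const \<i> * (Const (- \<i> / 2) * (Var (Inl j) - Var (Inr j)))"
      by (simp add: Inr in_xyc_Var hom_distribs) (simp add: to_zw_def distrib_left)
    also have "\<dots> = Var k"
      unfolding Inr by (rule poly_mapping_eqI; simp only: lookup_Const_mult lookup_add lookup_minus; simp add: field_simps)
    finally show ?thesis .
  qed
qed (simp add: to_zw_def)

lemma subst_zw_gen_to_zw: "subst zw_gen (to_zw p) = p"
proof (rule ring_hom_mpoly_eqI[OF comp_hom[OF subst_zw_gen_hom to_zw_hom] id_hom[unfolded id_def]])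
  interpret comm_ring_hom "subst zw_gen" by (rule subst_zw_gen_hom)
  show "subst zw_gen (to_zw (Var k)) = Var k" for k
  proof (cases k)
    case (Inl j)
    have "subst zw_gen (to_zw (Var k)) = Const (1 / 2) * (in_xy (Var j) + in_xyc (Var j))"
      unfolding Inl to_zw_def by (simp add: hom_distribs)
    then show ?thesis unfolding Inl by (simp only: Var_Inl_eq[symmetric])
  next
    case (Inr j)
    have "subst zw_gen (to_zw (Var k)) = Const (- \<i> / 2) * (in_xy (Var j) - in_xyc (Var j))"
      unfolding Inr to_zw_def by (simp add: hom_distribs)
    then show ?thesis unfolding Inr by (simp only: Var_Inr_eq[symmetric])
  qed
qed (simp add: to_zw_def)

lemma bij_subst_zw_gen: "bij (subst zw_gen)"
  by (rule bij_betw_byWitness[of _ to_zw]) (auto simp: to_zw_subst_zw_gen subst_zw_gen_to_zw)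

text \<open>\<open>to_xy\<close> as a map of one space to itself, so that zero loci and the Zariski
  topology can be transported. On polynomials, composition with its inverse is
  \<open>subst zw_gen\<close>.\<close>

definition linear_xy :: "complex ^ ('n::finite + 'n) \<Rightarrow> complex ^ ('n + 'n)" where
  "linear_xy y = to_xy (\<chi> k. y $ Inl k, \<chi> k. y $ Inr k)"

lemma vjoin_simps [simp]: "vjoin z w $ Inl k = z $ k" "vjoin z w $ Inr k = w $ k"
  by (simp_all add: vjoin_def)

lemma vjoin_components: "vjoin (\<chi> k. y $ Inl k) (\<chi> k. y $ Inr k) = y"
  by (simp add: Finite_Cartesian_Product.vec_eq_iff vjoin_def split: sum.splits)

lemma linear_xy_vjoin [simp]: "linear_xy (vjoin z w) = to_xy (z, w)"
  by (simp add: linear_xy_def)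

lemma from_xy_to_xy: "from_xy (to_xy (z, w)) = (z, w)"
  by (simp add: from_xy_def to_xy_def Finite_Cartesian_Product.vec_eq_iff field_simps)

lemma to_xy_from_xy: "to_xy (from_xy p) = p"
  unfolding from_xy_def to_xy_def
  by (simp add: Finite_Cartesian_Product.vec_eq_iff vjoin_def field_simps split: sum.splits)

lemma to_xy_eq_iff [simp]: "to_xy (z, w) = to_xy (z', w') \<longleftrightarrow> z = z' \<and> w = w'"
  by (metis from_xy_to_xy prod.inject)

lemma to_xy_exhaust: obtains z w where "y = to_xy (z, w)"
  by (metis to_xy_from_xy prod.exhaust)

lemma bij_linear_xy: "bij linear_xy"
proof (rule bijI)
  show "inj linear_xy"
    by (rule injI) (metis linear_xy_def to_xy_eq_iff vjoin_components)
  show "surj linear_xy"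
    unfolding surj_def by (metis linear_xy_vjoin to_xy_exhaust)
qed

lemma poly_at_subst_zw_gen: "poly_at (subst zw_gen p) (linear_xy y) = poly_at p y"
proof -
  have "poly_at (zw_gen k) (linear_xy y) = y $ k" for k
    by (cases k) (simp_all only: zw_gen_simps linear_xy_def poly_at_in_xy poly_at_in_xyc, simp_all add: vcnj_def)
  moreover have "poly_at (subst zw_gen p) (linear_xy y) = poly_hom id (\<lambda>k. poly_at (zw_gen k) (linear_xy y)) p"
    by (rule poly_at_poly_hom_Const)
  ultimately show ?thesis by (simp add: poly_at_def)
qed

lemma zero_locus_subst_zw_gen: "linear_xy y \<in> zero_locus (subst zw_gen ` P) \<longleftrightarrow> y \<in> zero_locus P"
  by (simp add: zero_locus_def poly_at_subst_zw_gen)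

section \<open>Specialisation of the data and the involution\<close>

lemma fix_uv_hom: "comm_ring_hom (fix_uv u v)"
  unfolding fix_uv_def by (rule poly_hom_ring_hom[OF Const_hom])

lemma fix_uv_simps [simp]:
  "fix_uv u v (Const c) = Const c" "fix_uv u v (Var (Zvar k)) = Var (Inl k)" "fix_uv u v (Var (Wvar k)) = Var (Inr k)"
  "fix_uv u v (Var (Uvar k)) = Const (u $ k)" "fix_uv u v (Var (Vvar k)) = Const (v $ k)"
  by (simp_all add: fix_uv_def)

lemma surj_fix_uv: "surj (fix_uv u v)"
proof (rule surjI)
  fix q
  let ?s = "subst (case_sum (\<lambda>k. Var (Zvar k)) (\<lambda>k. Var (Wvar k)))"
  show "fix_uv u v (?s q) = q"
  proof (rule ring_hom_mpoly_eqI[OF comp_hom[OF fix_uv_hom poly_hom_ring_hom[OF Const_hom]] id_hom[unfolded id_def]])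
    show "fix_uv u v (?s (Var k)) = Var k" for k by (cases k) simp_all
  qed simp
qed

lemma star_hom: "comm_ring_hom star"
  unfolding star_def by (rule poly_hom_ring_hom[OF Const_cnj_hom])

lemma star_simps [simp]: "star (Const c) = Const (cnj c)" "star (Var x) = Var (swap_var x)"
  by (simp_all add: star_def)

lemma star_star: "star (star p) = p"
proof (rule ring_hom_mpoly_eqI[OF comp_hom[OF star_hom star_hom] id_hom[unfolded id_def]])
  show "star (star (Var k)) = Var k" for k by (cases k) simp_all
qed simp

lemma surj_star: "surj star"
  by (rule surjI[of star star]) (rule star_star)

text \<open>Specialises the data and then passes to \<open>x\<close>, \<open>y\<close>. Both this
  map and its composition with \<open>star\<close> are surjective, so the two halves of the
  Hermitian ideals can be computed as images of generators.\<close>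

definition herm_xy :: "complex ^ 'n \<Rightarrow> complex ^ 'n \<Rightarrow> ('n hvar, complex) mpoly \<Rightarrow> ('n + 'n, complex) mpoly" where
  "herm_xy u v p = subst zw_gen (fix_uv u v p)"

lemma herm_xy_hom: "comm_ring_hom (herm_xy u v)"
  unfolding herm_xy_def by (rule comp_hom[OF subst_zw_gen_hom fix_uv_hom])

lemma surj_herm_xy: "surj (herm_xy u v)"
proof -
  have "surj (subst zw_gen \<circ> fix_uv u v)"
    by (rule comp_surj[OF surj_fix_uv bij_is_surj[OF bij_subst_zw_gen]])
  then show ?thesis by (simp add: herm_xy_def[abs_def] comp_def)
qed

lemma herm_xy_star_hom: "comm_ring_hom (\<lambda>p. herm_xy u v (star p))"
  by (rule comp_hom[OF herm_xy_hom star_hom])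

lemma surj_herm_xy_star: "surj (\<lambda>p. herm_xy u v (star p))"
  using comp_surj[OF surj_star surj_herm_xy[of u v]] by (simp add: comp_def)

lemma herm_xy_in_z: "herm_xy u v (in_z p) = in_xy p"
proof (rule ring_hom_mpoly_eqI[OF comp_hom[OF herm_xy_hom poly_hom_ring_hom[OF Const_hom]] in_xy_hom])
qed (simp_all add: herm_xy_def)

lemma herm_xy_star_in_z: "herm_xy u v (star (in_z p)) = in_xyc p"
proof (rule ring_hom_mpoly_eqI[OF comp_hom[OF herm_xy_star_hom poly_hom_ring_hom[OF Const_hom]] in_xyc_hom])
qed (simp_all add: herm_xy_def in_xyc_Const)

lemma herm_xy_image_gen_in_z:
  "herm_xy u v ` ideal_gen (in_z ` G) = ideal_gen (in_xy ` G)"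
  "herm_xy u v ` star ` ideal_gen (in_z ` G) = ideal_gen (in_xyc ` G)"
  unfolding image_ideal_gen[OF herm_xy_hom surj_herm_xy] image_image[of "herm_xy u v" star]
    image_ideal_gen[OF herm_xy_star_hom surj_herm_xy_star]
  by (simp_all only: image_image herm_xy_in_z herm_xy_star_in_z)

text \<open>\<open>star\<close> exchanges \<open>u\<close> with \<open>v\<close> and
  \<open>z\<close> with \<open>w\<close>, and specialisation follows it; hence the row
  \<open>u - z\<close> meets the conjugate Jacobian.\<close>

lemma herm_xy_image_minor_ideal:
  "herm_xy u v ` herm_minor_ideal X f = ideal_gen (minors (codim X + 1)
     (add_row (\<lambda>k. Const (v $ k) - in_xyc (Var k)) (\<lambda>i k. in_xy (jacobian f i k))))"
  "herm_xy u v ` star ` herm_minor_ideal X f = ideal_gen (minors (codim X + 1)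
     (add_row (\<lambda>k. Const (u $ k) - in_xy (Var k)) (\<lambda>i k. in_xyc (jacobian f i k))))"
proof -
  let ?M = "add_row (\<lambda>k. Var (Vvar k) - Var (Wvar k)) (\<lambda>i k. in_z (jacobian f i k))"
  interpret h: comm_ring_hom "herm_xy u v" by (rule herm_xy_hom)
  interpret hs: comm_ring_hom "\<lambda>p. herm_xy u v (star p)" by (rule herm_xy_star_hom)
  have Var: "herm_xy u v (Var (Vvar k)) = Const (v $ k)" "herm_xy u v (Var (Wvar k)) = in_xyc (Var k)"
    "herm_xy u v (star (Var (Vvar k))) = Const (u $ k)" "herm_xy u v (star (Var (Wvar k))) = in_xy (Var k)" for k
    by (simp_all add: herm_xy_def)
  have 1: "herm_xy u v (?M i j) = add_row (\<lambda>k. Const (v $ k) - in_xyc (Var k)) (\<lambda>i k. in_xy (jacobian f i k)) i j" for i j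
    by (cases i) (simp_all only: add_row_simps h.hom_minus Var herm_xy_in_z)
  have 2: "herm_xy u v (star (?M i j)) = add_row (\<lambda>k. Const (u $ k) - in_xy (Var k)) (\<lambda>i k. in_xyc (jacobian f i k)) i j" for i j
    by (cases i) (simp_all only: add_row_simps hs.hom_minus Var herm_xy_star_in_z)
  show "herm_xy u v ` herm_minor_ideal X f = ideal_gen (minors (codim X + 1)
     (add_row (\<lambda>k. Const (v $ k) - in_xyc (Var k)) (\<lambda>i k. in_xy (jacobian f i k))))"
    unfolding herm_minor_ideal_def image_ideal_gen[OF herm_xy_hom surj_herm_xy] image_minors[OF herm_xy_hom] 1 by (rule refl)
  show "herm_xy u v ` star ` herm_minor_ideal X f = ideal_gen (minors (codim X + 1)
     (add_row (\<lambda>k. Const (u $ k) - in_xy (Var k)) (\<lambda>i k. in_xyc (jacobian f i k))))"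
    unfolding herm_minor_ideal_def image_image[of "herm_xy u v" star] image_ideal_gen[OF herm_xy_star_hom surj_herm_xy_star]
      image_minors[OF herm_xy_star_hom] 2 by (rule refl)
qed

lemma ideal_gen_Un_ideal_gen:
  "ideal_gen (ideal_gen A \<union> ideal_gen B \<union> ideal_gen C \<union> ideal_gen D) = ideal_gen (A \<union> B \<union> C \<union> D)"
proof (rule ideal_gen_cong)
  have "ideal_gen S \<subseteq> ideal_gen (A \<union> B \<union> C \<union> D)" if "S \<subseteq> A \<union> B \<union> C \<union> D" for S
    by (rule ideal_gen_mono[OF that])
  then show "ideal_gen A \<union> ideal_gen B \<union> ideal_gen C \<union> ideal_gen D \<subseteq> ideal_gen (A \<union> B \<union> C \<union> D)"
    by (intro Un_least) auto
qed (auto intro: ideal_gen_base)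

text \<open>Surjections respect generated ideals and products, so both Hermitian ideals are computed
  on generators; \<open>critical_saturation_eq\<close> compares the saturations, and invertible row
  and column operations reach the Euclidean matrix.\<close>

lemma image_herm_critical_ideal:
  fixes X :: "(complex ^ 'n) set" and f :: "'s::finite \<Rightarrow> ('n, complex) mpoly"
  assumes prime: "prime_ideal (vanishing_ideal X)" and f: "\<And>i. f i \<in> vanishing_ideal X"
  shows "subst zw_gen ` herm_critical_ideal X f u v = eucl_critical_ideal (tilde X) (tilde_eqs f) (to_xy (u, v))"
proof -
  let ?I = "vanishing_ideal X" and ?K = "vanishing_ideal (tilde X)" and ?c = "codim X"
  let ?M1 = "\<lambda>i k. in_xy (jacobian f i k)" and ?M2 = "\<lambda>i k. in_xyc (jacobian f i k)"
  let ?\<alpha> = "\<lambda>k. Const (v $ k) - in_xyc (Var k)" and ?\<beta> = "\<lambda>k. Const (u $ k) - in_xy (Var k)"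
  have K: "?K = ideal_gen (in_xy ` ?I \<union> in_xyc ` ?I)" by (rule vanishing_ideal_tilde)
  have image: "herm_xy u v ` ideal_gen (A \<union> B \<union> C \<union> D) =
      ideal_gen (herm_xy u v ` A \<union> herm_xy u v ` B \<union> herm_xy u v ` C \<union> herm_xy u v ` D)" for A B C D
    by (simp only: image_ideal_gen[OF herm_xy_hom surj_herm_xy] image_Un)
  have base: "herm_xy u v ` herm_base_ideal X f =
      ideal_gen (in_xy ` ?I \<union> in_xyc ` ?I \<union> minors (?c + 1) (add_row ?\<alpha> ?M1) \<union> minors (?c + 1) (add_row ?\<beta> ?M2))"
    unfolding herm_base_ideal_def Let_def image
      herm_xy_image_gen_in_z herm_xy_image_minor_ideal ideal_gen_Un_ideal_gen by (rule refl)
  have minors: "in_xy ` minors ?c (jacobian f) = minors ?c ?M1" "in_xyc ` minors ?c (jacobian f) = minors ?c ?M2"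
    by (rule image_minors[OF in_xy_hom], rule image_minors[OF in_xyc_hom])
  have sing: "herm_xy u v ` herm_singular_ideal X f =
      ideal_prod (ideal_gen (in_xy ` ?I \<union> minors ?c ?M1)) (ideal_gen (in_xyc ` ?I \<union> minors ?c ?M2))"
    unfolding herm_singular_ideal_def Let_def image_ideal_prod[OF herm_xy_hom surj_herm_xy]
      herm_xy_image_gen_in_z singular_ideal_def ideal_gen_image_ideal_gen[OF in_xy_hom]
      ideal_gen_image_ideal_gen[OF in_xyc_hom] image_Un minors by (rule refl)
  have rank: "minors (?c + 1) ?M1 \<subseteq> ideal_gen (in_xy ` ?I \<union> in_xyc ` ?I)"
    "minors (?c + 1) ?M2 \<subseteq> ideal_gen (in_xy ` ?I \<union> in_xyc ` ?I)"
  proof -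
    have "minors (?c + 1) (jacobian f) \<subseteq> ?I" by (rule minors_jacobian_vanish[OF prime f]) simp
    then show "minors (?c + 1) ?M1 \<subseteq> ideal_gen (in_xy ` ?I \<union> in_xyc ` ?I)"
      "minors (?c + 1) ?M2 \<subseteq> ideal_gen (in_xy ` ?I \<union> in_xyc ` ?I)"
      unfolding image_minors[OF in_xy_hom, symmetric] image_minors[OF in_xyc_hom, symmetric]
      by (auto intro: ideal_gen_base)
  qed
  have "subst zw_gen ` herm_critical_ideal X f u v
      = saturation (herm_xy u v ` herm_base_ideal X f) (herm_xy u v ` herm_singular_ideal X f)"
    unfolding herm_critical_ideal_def image_saturation[OF subst_zw_gen_hom bij_subst_zw_gen]
    by (simp add: image_image herm_xy_def)
  also have "\<dots> = saturation
      (ideal_gen (?K \<union> minors (2 * ?c + 1) (add_row (case_sum ?\<alpha> ?\<beta>) (block_diag ?M1 ?M2))))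
      (ideal_gen (?K \<union> minors (2 * ?c) (block_diag ?M1 ?M2)))"
    unfolding base sing K by (rule critical_saturation_eq[OF rank])
  also have "\<dots> = eucl_critical_ideal (tilde X) (tilde_eqs f) (to_xy (u, v))"
    \<comment> \<open>By \<open>codim_tilde\<close>, the sizes \<open>2 * ?c + 1\<close> and
      \<open>2 * ?c\<close> are the ones prescribed for \<open>tilde X\<close>.\<close>
    unfolding eucl_critical_ideal_def Let_def singular_ideal_def codim_tilde[OF prime]
    by (intro arg_cong2[of _ _ _ _ saturation] ideal_gen_Un_cong minors_eucl_matrix[symmetric] minors_jacobian_tilde_eqs[symmetric])
  finally show ?thesis .
qed

lemma to_xy_in_eucl_zeros:
  fixes X :: "(complex ^ 'n) set" and f :: "'s::finite \<Rightarrow> ('n, complex) mpoly"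
  assumes "prime_ideal (vanishing_ideal X)" "\<And>i. f i \<in> vanishing_ideal X"
  shows "to_xy (z, w) \<in> eucl_zeros (tilde X) (tilde_eqs f) (to_xy (u, v)) \<longleftrightarrow> (z, w) \<in> herm_zeros X f u v"
  using zero_locus_subst_zw_gen[of "vjoin z w" "herm_critical_ideal X f u v"]
  by (simp only: eucl_zeros_def herm_zeros_def image_herm_critical_ideal[OF assms] linear_xy_vjoin mem_Collect_eq case_prod_conv)


subsection \<open>Transfer of the degrees\<close>

lemma zero_locus_image_zw_gen: "zero_locus (subst zw_gen ` P) = linear_xy ` zero_locus P"
proof (intro equalityI subsetI)
  fix y assume y: "y \<in> zero_locus (subst zw_gen ` P)"
  obtain x where x: "y = linear_xy x" using surjD[OF bij_is_surj[OF bij_linear_xy]] by blast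
  have "x \<in> zero_locus P" using y unfolding x zero_locus_subst_zw_gen .
  then show "y \<in> linear_xy ` zero_locus P" unfolding x by (rule imageI)
next
  fix y assume "y \<in> linear_xy ` zero_locus P"
  then show "y \<in> zero_locus (subst zw_gen ` P)" by (auto simp only: zero_locus_subst_zw_gen)
qed

lemma zariski_open_linear_xy: "zariski_open (linear_xy ` U) \<longleftrightarrow> zariski_open U"
  for U :: "(complex ^ ('a::finite + 'a)) set"
proof -
  note Z = zero_locus_image_zw_gen
  have C: "- (linear_xy ` A) = linear_xy ` (- A)" for A
    by (rule bij_image_Compl_eq[OF bij_linear_xy, symmetric])
  show ?thesis
  proof
    assume "zariski_open U"
    then obtain P where "U = - zero_locus P" by (auto simp: zariski_open_def)
    then have "linear_xy ` U = - zero_locus (subst zw_gen ` P)" by (simp add: Z C)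
    then show "zariski_open (linear_xy ` U)" unfolding zariski_open_def by blast
  next
    assume "zariski_open (linear_xy ` U)"
    then obtain P where "linear_xy ` U = - zero_locus P" by (auto simp: zariski_open_def)
    moreover have "P = subst zw_gen ` (to_zw ` P)" by (simp add: image_image subst_zw_gen_to_zw)
    ultimately have "linear_xy ` U = linear_xy ` (- zero_locus (to_zw ` P))" by (metis Z C)
    then have "U = - zero_locus (to_zw ` P)" by (simp only: inj_image_eq_iff[OF bij_is_inj[OF bij_linear_xy]])
    then show "zariski_open U" unfolding zariski_open_def by blast
  qed
qed

lemma zariski_dense_linear_xy: "zariski_dense (linear_xy ` U) \<longleftrightarrow> zariski_dense U"
  for U :: "(complex ^ ('a::finite + 'a)) set"
proof -
  note Z = zero_locus_image_zw_gen
  note inj = bij_is_inj[OF bij_linear_xy] and surj = bij_is_surj[OF bij_linear_xy]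
  \<comment> \<open>Every \<open>P\<close> is the image under \<open>subst zw_gen\<close> of its own
    image under \<open>to_zw\<close>, so the quantifier may run over such images.\<close>
  have "(\<forall>P. linear_xy ` U \<subseteq> zero_locus P \<longrightarrow> zero_locus P = UNIV) \<longleftrightarrow>
      (\<forall>P. linear_xy ` U \<subseteq> zero_locus (subst zw_gen ` P) \<longrightarrow> zero_locus (subst zw_gen ` P) = UNIV)"
    by (metis (no_types, lifting) image_image image_cong subst_zw_gen_to_zw image_ident)
  also have "\<dots> \<longleftrightarrow> (\<forall>P. U \<subseteq> zero_locus P \<longrightarrow> zero_locus P = UNIV)"
  proof -
    have "linear_xy ` A = UNIV \<longleftrightarrow> A = UNIV" for A :: "(complex ^ ('a + 'a)) set"
      using inj_image_eq_iff[OF inj, of A UNIV] unfolding surj .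
    then show ?thesis unfolding Z inj_image_subset_iff[OF inj] by simp
  qed
  finally show ?thesis by (simp add: zariski_dense_def)
qed

text \<open>Real points are the fixed points of conjugation, which by \<open>vcnj_to_xy\<close>
  exchanges the two components and conjugates them.\<close>

lemma to_xy_in_real_points: "to_xy (z, w) \<in> real_points \<longleftrightarrow> w = vcnj z"
proof -
  have real_iff: "y \<in> real_points \<longleftrightarrow> vcnj y = y" for y :: "complex ^ 'v"
    by (simp add: real_points_def vcnj_def Finite_Cartesian_Product.vec_eq_iff Reals_cnj_iff)
  show ?thesis unfolding real_iff vcnj_to_xy to_xy_eq_iff by auto
qed

lemma continuous_on_to_xy_vcnj: "continuous_on UNIV (\<lambda>u :: complex ^ 'n. to_xy (u, vcnj u))"
proof -
  have "continuous_on UNIV (\<lambda>u :: complex ^ 'n. to_xy (u, vcnj u) $ k)" for k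
    by (cases k) (auto simp: to_xy_def vjoin_def vcnj_def intro!: continuous_intros)
  then have "continuous_on UNIV (\<lambda>u :: complex ^ 'n. \<chi> k. to_xy (u, vcnj u) $ k)"
    by (intro continuous_on_vec_lambda)
  then show ?thesis by simp
qed

lemma continuous_on_fst_from_xy: "continuous_on S (\<lambda>p :: complex ^ ('n::finite + 'n). fst (from_xy p))"
  unfolding from_xy_def fst_conv by (intro continuous_intros continuous_on_vec_lambda)

text \<open>Sending \<open>u\<close> to \<open>to_xy (u, vcnj u)\<close> is a homeomorphism onto
  \<open>real_points\<close>, so open sets of data correspond, and the given bijection preserves the
  number of critical points.\<close>

lemma HDdeg_eq_real_EDdegree:
  fixes X :: "(complex ^ 'n) set" and f :: "'s \<Rightarrow> ('n, complex) mpoly"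
  assumes bij: "\<And>u. bij_betw (\<lambda>z. to_xy (z, vcnj z)) (herm_critical_points X f u)
    (eucl_critical_points (tilde X) (tilde_eqs f) (to_xy (u, vcnj u)))"
  shows "HDdeg X f = real_EDdegree (tilde X) (tilde_eqs f)"
proof -
  let ?H = "\<lambda>u m. finite (herm_critical_points X f u) \<and> card (herm_critical_points X f u) = m"
  let ?E = "\<lambda>a m. finite (eucl_critical_points (tilde X) (tilde_eqs f) a) \<and> card (eucl_critical_points (tilde X) (tilde_eqs f) a) = m"
  have HE: "?E (to_xy (u, vcnj u)) m \<longleftrightarrow> ?H u m" for u m
    using bij_betw_finite[OF bij[of u]] bij_betw_same_card[OF bij[of u]] by auto
  show ?thesis
    unfolding HDdeg_def real_EDdegree_def
  proof (intro Collect_cong iffI)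
    fix m assume "\<exists>U. open U \<and> U \<noteq> {} \<and> (\<forall>u\<in>U. ?H u m)"
    then obtain U where U: "open U" "U \<noteq> {}" "\<And>u. u \<in> U \<Longrightarrow> ?H u m" by blast
    let ?U' = "real_points \<inter> (\<lambda>p. fst (from_xy p)) -` U"
    have real: "\<exists>u\<in>U. a = to_xy (u, vcnj u)" if "a \<in> ?U'" for a
    proof -
      obtain z w where a: "a = to_xy (z, w)" by (rule to_xy_exhaust)
      then show ?thesis using that by (auto simp: to_xy_in_real_points from_xy_to_xy)
    qed
    have "openin (top_of_set real_points) ?U'"
      by (rule continuous_openin_preimage_gen[OF continuous_on_fst_from_xy U(1)])
    moreover obtain u where "u \<in> U" using U(2) by blast
    then have "to_xy (u, vcnj u) \<in> ?U'" by (simp add: to_xy_in_real_points from_xy_to_xy)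
    then have "?U' \<noteq> {}" by blast
    moreover have "\<forall>a\<in>?U'. ?E a m" using real U(3) HE by metis
    ultimately show "\<exists>U. openin (top_of_set real_points) U \<and> U \<noteq> {} \<and> (\<forall>a\<in>U. ?E a m)" by blast
  next
    fix m assume "\<exists>U. openin (top_of_set real_points) U \<and> U \<noteq> {} \<and> (\<forall>a\<in>U. ?E a m)"
    then obtain U where U: "openin (top_of_set real_points) U" "U \<noteq> {}" "\<And>a. a \<in> U \<Longrightarrow> ?E a m" by blast
    then obtain T where T: "open T" "U = real_points \<inter> T" by (auto simp: openin_open)
    let ?U' = "(\<lambda>u. to_xy (u, vcnj u)) -` T"
    have "open ?U'" by (rule open_vimage[OF T(1) continuous_on_to_xy_vcnj])
    moreover obtain a where "a \<in> U" using U(2) by blast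
    then have "?U' \<noteq> {}"
    proof -
      obtain z w where "a = to_xy (z, w)" by (rule to_xy_exhaust)
      then show ?thesis using \<open>a \<in> U\<close> T(2) by (auto simp: to_xy_in_real_points)
    qed
    moreover have "?H u m" if "u \<in> ?U'" for u
    proof -
      have "to_xy (u, vcnj u) \<in> U" using that T(2) by (simp add: to_xy_in_real_points)
      then show ?thesis using U(3) HE by blast
    qed
    ultimately show "\<exists>U. open U \<and> U \<noteq> {} \<and> (\<forall>u\<in>U. ?H u m)" by blast
  qed
qed

theorem proposition3p3:
  fixes X :: "(complex ^ 'n) set"
    and f :: "'s::finite \<Rightarrow> ('n, complex) mpoly"
  assumes "X = zero_locus (ideal_gen (range f))"
    and "vanishing_ideal X = ideal_gen (range f)"
    and "prime_ideal (ideal_gen (range f))"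
  shows "(\<forall>z w :: complex ^ 'n. from_xy (to_xy (z, w)) = (z, w)) \<and>
         (\<forall>p :: complex ^ ('n + 'n). to_xy (from_xy p) = p) \<and>
         (\<forall>u v. bij_betw to_xy (herm_zeros X f u v)
            (eucl_zeros (tilde X) (tilde_eqs f) (to_xy (u, v)))) \<and>
         (\<forall>m. has_vHDdeg X f m \<longleftrightarrow> has_EDdegree (tilde X) (tilde_eqs f) m) \<and>
         vHDdeg X f = EDdegree (tilde X) (tilde_eqs f) \<and>
         (\<forall>u. bij_betw (\<lambda>z. to_xy (z, vcnj z)) (herm_critical_points X f u)
            (eucl_critical_points (tilde X) (tilde_eqs f) (to_xy (u, vcnj u)))) \<and>
         HDdeg X f = real_EDdegree (tilde X) (tilde_eqs f)"
proof (intro conjI)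
  have prime: "prime_ideal (vanishing_ideal X)" and f: "\<And>i. f i \<in> vanishing_ideal X"
    using assms by (auto intro: ideal_gen_base)
  note zeros = to_xy_in_eucl_zeros[of X f, OF prime f]
  show "\<forall>z w :: complex ^ 'n. from_xy (to_xy (z, w)) = (z, w)"
    and "\<forall>p :: complex ^ ('n + 'n). to_xy (from_xy p) = p"
    by (simp_all add: from_xy_to_xy to_xy_from_xy)
  have bij: "bij_betw to_xy (herm_zeros X f u v) (eucl_zeros (tilde X) (tilde_eqs f) (to_xy (u, v)))" for u v
  proof (rule bij_betw_imageI)
    show "inj_on to_xy (herm_zeros X f u v)" by (auto simp: inj_on_def)
    show "to_xy ` herm_zeros X f u v = eucl_zeros (tilde X) (tilde_eqs f) (to_xy (u, v))"
    proof (intro equalityI subsetI)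
      fix y assume y: "y \<in> eucl_zeros (tilde X) (tilde_eqs f) (to_xy (u, v))"
      obtain z w where "y = to_xy (z, w)" by (rule to_xy_exhaust)
      then show "y \<in> to_xy ` herm_zeros X f u v" using y zeros by blast
    qed (use zeros in auto)
  qed
  then show "\<forall>u v. bij_betw to_xy (herm_zeros X f u v) (eucl_zeros (tilde X) (tilde_eqs f) (to_xy (u, v)))"
    by blast
  \<comment> \<open>The bijection of zeros is restricted to the real points, which by
    \<open>to_xy_in_real_points\<close> are those with \<open>w = vcnj z\<close>.\<close>
  have crit: "bij_betw (\<lambda>z. to_xy (z, vcnj z)) (herm_critical_points X f u)
      (eucl_critical_points (tilde X) (tilde_eqs f) (to_xy (u, vcnj u)))" for u
  proof (rule bij_betw_imageI)
    show "inj_on (\<lambda>z. to_xy (z, vcnj z)) (herm_critical_points X f u)" by (auto simp: inj_on_def)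
    show "(\<lambda>z. to_xy (z, vcnj z)) ` herm_critical_points X f u = eucl_critical_points (tilde X) (tilde_eqs f) (to_xy (u, vcnj u))"
    proof (intro equalityI subsetI)
      fix y assume y: "y \<in> eucl_critical_points (tilde X) (tilde_eqs f) (to_xy (u, vcnj u))"
      obtain z w where "y = to_xy (z, w)" by (rule to_xy_exhaust)
      then have "y = to_xy (z, vcnj z)" "z \<in> herm_critical_points X f u"
        using y zeros by (auto simp: eucl_critical_points_def herm_critical_points_def to_xy_in_real_points)
      then show "y \<in> (\<lambda>z. to_xy (z, vcnj z)) ` herm_critical_points X f u" by blast
    qed (use zeros in \<open>auto simp: eucl_critical_points_def herm_critical_points_def to_xy_in_real_points\<close>)
  qed
  then show "\<forall>u. bij_betw (\<lambda>z. to_xy (z, vcnj z)) (herm_critical_points X f u)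
      (eucl_critical_points (tilde X) (tilde_eqs f) (to_xy (u, vcnj u)))"
    by blast
  from crit show "HDdeg X f = real_EDdegree (tilde X) (tilde_eqs f)" by (rule HDdeg_eq_real_EDdegree)
  have deg: "has_vHDdeg X f m \<longleftrightarrow> has_EDdegree (tilde X) (tilde_eqs f) m" for m
  proof -
    let ?H = "\<lambda>u v. finite (herm_zeros X f u v) \<and> card (herm_zeros X f u v) = m"
    let ?E = "\<lambda>a. finite (eucl_zeros (tilde X) (tilde_eqs f) a) \<and> card (eucl_zeros (tilde X) (tilde_eqs f) a) = m"
    have HE: "?E (to_xy (u, v)) \<longleftrightarrow> ?H u v" for u v
      using bij_betw_finite[OF bij[of u v]] bij_betw_same_card[OF bij[of u v]] by auto
    have iff: "(\<forall>a\<in>linear_xy ` U. ?E a) \<longleftrightarrow> (\<forall>u v. vjoin u v \<in> U \<longrightarrow> ?H u v)" for U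
    proof
      assume E: "\<forall>a\<in>linear_xy ` U. ?E a"
      show "\<forall>u v. vjoin u v \<in> U \<longrightarrow> ?H u v"
      proof (intro allI impI)
        fix u v assume "vjoin u v \<in> U"
        then have "to_xy (u, v) \<in> linear_xy ` U" by (metis imageI linear_xy_vjoin)
        then show "?H u v" using E HE by blast
      qed
    next
      assume H: "\<forall>u v. vjoin u v \<in> U \<longrightarrow> ?H u v"
      show "\<forall>a\<in>linear_xy ` U. ?E a"
      proof
        fix a assume "a \<in> linear_xy ` U"
        then obtain y where y: "a = linear_xy y" "y \<in> U" by blast
        then have "?H (\<chi> k. y $ Inl k) (\<chi> k. y $ Inr k)" using H by (simp add: vjoin_components)
        then show "?E a" unfolding y(1) linear_xy_def HE .
      qed
    qed
    \<comment> \<open>As \<open>linear_xy\<close> is bijective, every set of data is the image of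
      some \<open>U\<close>, so the quantifier may run over images.\<close>
    have "has_EDdegree (tilde X) (tilde_eqs f) m \<longleftrightarrow>
        (\<exists>U. zariski_open (linear_xy ` U) \<and> zariski_dense (linear_xy ` U) \<and> (\<forall>a\<in>linear_xy ` U. ?E a))"
      unfolding has_EDdegree_def using bij_linear_xy by (metis bij_def surj_image_vimage_eq)
    also have "\<dots> \<longleftrightarrow> has_vHDdeg X f m"
      unfolding has_vHDdeg_def zariski_open_linear_xy zariski_dense_linear_xy iff by (rule refl)
    finally show ?thesis by blast
  qed
  then show "\<forall>m. has_vHDdeg X f m \<longleftrightarrow> has_EDdegree (tilde X) (tilde_eqs f) m" by blast
  \<comment> \<open>Both numbers are definite descriptions by predicates that agree for every
    \<open>m\<close>.\<close>
  show "vHDdeg X f = EDdegree (tilde X) (tilde_eqs f)"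
    unfolding vHDdeg_def EDdegree_def deg by (rule refl)
qed

end
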